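(* Let $k\ge 1$ be an integer, let $p(u_0,u_1,\dots,u_k,u_{k+1})$ be a probability distribution on $\prod_{j=0}^{k+1}\mathcal U_j$, let $\delta>0$, and let $R_1,\dots,R_k$ be real numbers. For each positive integer $n$ let $M_1,\dots,M_k$ be nonnegative integers (which may depend on $n$), let $\mathcal M=\prod_{j=1}^k\{1,\dots,M_j\}$, and let $U_0^n$, $\{U_j^n(m): 1\le j\le k,\ 1\le m\le M_j\}$, $U_{k+1}^n$ be random vectors on a common probability space, with $U_0^n\in\mathcal U_0^n$, $U_j^n(m)\in\mathcal U_j^n$, $U_{k+1}^n\in\mathcal U_{k+1}^n$, satisfying the following two assumptions. (I) For all $\mathbf m=(m_1,\dots,m_k)$ and $\mathbf m'=(m'_1,\dots,m'_k)$ in $\mathcal M$, with $S=\{j\in[k]: m_j=m'_j\}$ and $S^c=[k]\setminus S$, the conditional joint distribution of $\big((U_j^n(m_j))_{j\in[k]},(U_j^n(m'_j))_{j\in S^c}\big)$ given $U_0^n=u_0^n$, $U_{k+1}^n=u_{k+1}^n$ is $$\prod_{j=1}^k p(u_j^n|u_0^n)\times\prod_{j\in S^c}p(u_j'^{\,n}|u_0^n),$$ where $p(u_j^n|u_0^n)=\prod_{i=1}^n p(u_{j,i}|u_{0,i})$. (II) For every $\mathbf m=(m_1,\dots,m_k)\in\mathcal M$, the vector $\big(U_0^n,U_1^n(m_1),\dots,U_k^n(m_k),U_{k+1}^n\big)$ consists of $n$ i.i.d. copies of a random vector with distribution $p(u_0)\prod_{j=1}^{k+1}p(u_j|u_0)$.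 Let $A_\delta^{(n)}$ be the weakly typical set for the joint distribution $p(u_0,u_1,\dots,u_{k+1})$, and consider the statement $$\lim_{n\to\infty}\mathbf P\Big\{\exists\,\mathbf m\in\mathcal M:\ \big(U_0^n,U_1^n(m_1),\dots,U_k^n(m_k),U_{k+1}^n\big)\in A_\delta^{(n)}\Big\}=1.\qquad( * )$$ Direct part: suppose that $M_j\ge e^{nR_j}$ for all $j\in[k]$ and all $n$. If for all nonempty $S\subseteq[k]$ $$\sum_{j\in S}R_j>\sum_{j\in S}H(U_j|U_0)-H(U_S|U_0,U_{k+1})+(8k-2|S|+10)\delta,$$ then $( * )$ holds. Converse part: suppose that $M_j\le e^{nR_j}$ for all $j\in[k]$ and all $n$. If $( * )$ holds, then for all nonempty $S\subseteq[k]$ $$\sum_{j\in S}R_j\ge\sum_{j\in S}H(U_j|U_0)-H(U_S|U_0,U_{k+1})-2(|S|+1)\delta.$$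
   Context: $[k]=\{1,\dots,k\}$; for $S\subseteq[k]$, $U_S=(U_j)_{j\in S}$. All logarithms are natural. Distributions. Each alphabet $\mathcal U_j$ is either a countable set (with counting measure) or a Euclidean space (with Lebesgue measure), and $p$ is a probability mass function / density with respect to the product of these reference measures. For $T\subseteq\{0,1,\dots,k+1\}$, $p(u_T)$ denotes the marginal of $p$ on the coordinates in $T$; $p(u_0)$ and $p(u_j|u_0)$ are the marginals and conditional marginals of $p(u_0,\dots,u_{k+1})$. "Distribution" in assumptions (I) and (II) means mass function or density in this sense; in the discrete case (I) says that for all $u_0^n,u_{k+1}^n$ of positive probability and all $(u_j^n)_j,(u_j'^{\,n})_j$ with $u_j^n=u_j'^{\,n}$ for $j\in S$, the conditional probability that $U_j^n(m_j)=u_j^n$ and $U_j^n(m_j')=u_j'^{\,n}$ for all $j\in[k]$ equals the displayed product. Entropies. $H$ denotes entropy (Shannon entropy in the discrete case, differential entropy in the continuous case), computed under the joint distribution $(U_0,U_1,\dots,U_{k+1})\sim p(u_0,u_1,\dots,u_{k+1})$ (not under the product-form distribution in (II)): $H(U_T)=-\mathbb E[\log p(U_T)]$ and $H(U_A|U_B)=H(U_A,U_B)-H(U_B)$. It is assumed that $H(U_T)$ is well defined and finite for every nonempty $T\subseteq\{0,\dots,k+1\}$. Weakly typical set. $A_\delta^{(n)}$ is the set of all $(u_0^n,u_1^n,\dots,u_{k+1}^n)\in\prod_{j=0}^{k+1}\mathcal U_j^n$ such that for every nonempty $T\subseteq\{0,1,\dots,k+1\}$, $$\Big|-\frac1n\sum_{i=1}^n\log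 p(u_{T,i})-H(U_T)\Big|<\delta,$$ where $u_{T,i}=(u_{j,i})_{j\in T}$ is the $i$-th component of $(u_j^n)_{j\in T}$ (in particular all $p(u_{T,i})$ must be positive). *)

theory Defs
  imports "HOL-Probability.Probability"
begin

text \<open>
  The alphabets may have different kinds and dimensions, so all symbols live in one
  sum type: letters of countable alphabets are tagged with \<^const>\<open>Inl\<close>, points of a
  Euclidean space of dimension \<open>d\<close> are functions on \<open>{..<d}\<close> tagged with \<^const>\<open>Inr\<close>.
  An alphabet is represented by its reference measure; the set of symbols is the
  \<^const>\<open>space\<close> of that measure.
\<close>

type_synonym 'a symbol = "'a + (nat \<Rightarrow> real)"

definition is_alphabet :: "'a symbol measure \<Rightarrow> bool" where
  "is_alphabet \<mu> \<longleftrightarrow>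
     (\<exists>A. countable A \<and> \<mu> = count_space (Inl ` A)) \<or>
     (\<exists>d. \<mu> = embed_measure (\<Pi>\<^sub>M i\<in>{..<d}. lborel) Inr)"

definition letters :: "nat \<Rightarrow> (nat \<Rightarrow> 'a symbol measure) \<Rightarrow> (nat \<Rightarrow> 'a symbol) measure" where
  "letters k \<mu> = Pi\<^sub>M {0..k+1} \<mu>"

definition block :: "nat \<Rightarrow> (nat \<Rightarrow> 'a symbol measure) \<Rightarrow> nat \<Rightarrow> (nat \<Rightarrow> 'a symbol) measure" where
  "block n \<mu> j = (\<Pi>\<^sub>M i\<in>{1..n}. \<mu> j)"

text \<open>
  The joint distribution \<open>p\<close> is a mass function or density with respect to
  \<^const>\<open>letters\<close>. The marginal \<open>p(u\<^sub>T)\<close> only depends on the coordinates of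
  its last argument in \<open>T\<close>. In the continuous case the integral may diverge on a null set,
  where the value is 0 by convention; likewise \<open>p(x|y)\<close> is 0 where the marginal of \<open>y\<close> vanishes.
\<close>

definition marginal ::
  "nat \<Rightarrow> (nat \<Rightarrow> 'a symbol measure) \<Rightarrow> ((nat \<Rightarrow> 'a symbol) \<Rightarrow> real) \<Rightarrow> nat set \<Rightarrow> (nat \<Rightarrow> 'a symbol) \<Rightarrow> real"
where
  "marginal k \<mu> p T u =
     (\<integral>v. p (merge T ({0..k+1} - T) (u, v)) \<partial>Pi\<^sub>M ({0..k+1} - T) \<mu>)"

text \<open>\<open>cond_marginal k \<mu> p j x y\<close> is \<open>p(u\<^sub>j|u\<^sub>0)\<close> at \<open>u\<^sub>j = x\<close>, \<open>u\<^sub>0 = y\<close>, for \<open>j \<noteq> 0\<close>.\<close>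

definition cond_marginal ::
  "nat \<Rightarrow> (nat \<Rightarrow> 'a symbol measure) \<Rightarrow> ((nat \<Rightarrow> 'a symbol) \<Rightarrow> real) \<Rightarrow> nat \<Rightarrow> 'a symbol \<Rightarrow> 'a symbol \<Rightarrow> real"
where
  "cond_marginal k \<mu> p j x y =
     marginal k \<mu> p {0, j} (\<lambda>i. if i = 0 then y else x) / marginal k \<mu> p {0} (\<lambda>i. y)"

definition cond_block ::
  "nat \<Rightarrow> (nat \<Rightarrow> 'a symbol measure) \<Rightarrow> ((nat \<Rightarrow> 'a symbol) \<Rightarrow> real) \<Rightarrow> nat \<Rightarrow> nat \<Rightarrow>
     (nat \<Rightarrow> 'a symbol) \<Rightarrow> (nat \<Rightarrow> 'a symbol) \<Rightarrow> real"
where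
  "cond_block k \<mu> p n j x y = (\<Prod>i=1..n. cond_marginal k \<mu> p j (x i) (y i))"

text \<open>The density \<open>p(u\<^sub>0) \<Prod>\<^sub>j p(u\<^sub>j|u\<^sub>0)\<close>, the product over \<open>1 \<le> j \<le> k+1\<close>.\<close>

definition cond_indep_density ::
  "nat \<Rightarrow> (nat \<Rightarrow> 'a symbol measure) \<Rightarrow> ((nat \<Rightarrow> 'a symbol) \<Rightarrow> real) \<Rightarrow> (nat \<Rightarrow> 'a symbol) \<Rightarrow> real"
where
  "cond_indep_density k \<mu> p u =
     marginal k \<mu> p {0} u * (\<Prod>j=1..k+1. cond_marginal k \<mu> p j (u j) (u 0))"

definition ent ::
  "nat \<Rightarrow> (nat \<Rightarrow> 'a symbol measure) \<Rightarrow> ((nat \<Rightarrow> 'a symbol) \<Rightarrow> real) \<Rightarrow> nat set \<Rightarrow> real"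
where
  "ent k \<mu> p T = - (\<integral>u. ln (marginal k \<mu> p T u) \<partial>density (letters k \<mu>) p)"

definition cond_ent ::
  "nat \<Rightarrow> (nat \<Rightarrow> 'a symbol measure) \<Rightarrow> ((nat \<Rightarrow> 'a symbol) \<Rightarrow> real) \<Rightarrow> nat set \<Rightarrow> nat set \<Rightarrow> real"
where
  "cond_ent k \<mu> p A B = ent k \<mu> p (A \<union> B) - ent k \<mu> p B"

text \<open>In a tuple \<open>u\<close> of blocks, \<open>u j i\<close> is the \<open>i\<close>-th component of the \<open>j\<close>-th block.\<close>

definition typical_set ::
  "nat \<Rightarrow> (nat \<Rightarrow> 'a symbol measure) \<Rightarrow> ((nat \<Rightarrow> 'a symbol) \<Rightarrow> real) \<Rightarrow> real \<Rightarrow> nat \<Rightarrow>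
     (nat \<Rightarrow> nat \<Rightarrow> 'a symbol) set"
where
  "typical_set k \<mu> p \<delta> n =
     {u \<in> space (\<Pi>\<^sub>M j\<in>{0..k+1}. block n \<mu> j).
        \<forall>T. T \<noteq> {} \<and> T \<subseteq> {0..k+1} \<longrightarrow>
          (\<forall>i\<in>{1..n}. marginal k \<mu> p T (\<lambda>j. u j i) > 0) \<and>
          \<bar>- (1 / real n) * (\<Sum>i=1..n. ln (marginal k \<mu> p T (\<lambda>j. u j i))) - ent k \<mu> p T\<bar> < \<delta>}"

text \<open>
  \<open>has_cond_density P N V Q X f\<close>: under \<open>P\<close>, the conditional distribution of \<open>X\<close> given
  \<open>V = v\<close> has the density \<open>f v\<close> with respect to \<open>Q\<close>, i.e. \<open>v \<mapsto> density Q (f v)\<close> is a version of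
  the regular conditional distribution of \<open>X\<close> given \<open>V\<close>.
\<close>

definition has_cond_density ::
  "'w measure \<Rightarrow> 'v measure \<Rightarrow> ('w \<Rightarrow> 'v) \<Rightarrow> 'x measure \<Rightarrow> ('w \<Rightarrow> 'x) \<Rightarrow> ('v \<Rightarrow> 'x \<Rightarrow> real) \<Rightarrow> bool"
where
  "has_cond_density P N V Q X f \<longleftrightarrow>
     V \<in> measurable P N \<and> X \<in> measurable P Q \<and>
     (\<lambda>(v, x). f v x) \<in> borel_measurable (N \<Otimes>\<^sub>M Q) \<and>
     (\<forall>C\<in>sets N. \<forall>B\<in>sets Q.
        emeasure P {\<omega> \<in> space P. V \<omega> \<in> C \<and> X \<omega> \<in> B} =
        (\<integral>\<^sup>+v\<in>C. emeasure (density Q (\<lambda>x. ennreal (f v x))) B \<partial>distr P N V))"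

definition codebook_indices :: "nat \<Rightarrow> (nat \<Rightarrow> nat) \<Rightarrow> (nat \<Rightarrow> nat) set" where
  "codebook_indices k M = (\<Pi>\<^sub>E j\<in>{1..k}. {1..M j})"

definition codeword_tuple ::
  "nat \<Rightarrow> ('w \<Rightarrow> nat \<Rightarrow> 'a symbol) \<Rightarrow> (nat \<Rightarrow> nat \<Rightarrow> 'w \<Rightarrow> nat \<Rightarrow> 'a symbol) \<Rightarrow>
     ('w \<Rightarrow> nat \<Rightarrow> 'a symbol) \<Rightarrow> (nat \<Rightarrow> nat) \<Rightarrow> 'w \<Rightarrow> nat \<Rightarrow> nat \<Rightarrow> 'a symbol"
where
  "codeword_tuple k U0 U Ulast m \<omega> =
     (\<lambda>j\<in>{0..k+1}. if j = 0 then U0 \<omega> else if j = k + 1 then Ulast \<omega> else U j (m j) \<omega>)"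

definition covering_prob ::
  "'w measure \<Rightarrow> nat \<Rightarrow> (nat \<Rightarrow> nat) \<Rightarrow> (nat \<Rightarrow> nat \<Rightarrow> 'a symbol) set \<Rightarrow>
     ('w \<Rightarrow> nat \<Rightarrow> 'a symbol) \<Rightarrow> (nat \<Rightarrow> nat \<Rightarrow> 'w \<Rightarrow> nat \<Rightarrow> 'a symbol) \<Rightarrow> ('w \<Rightarrow> nat \<Rightarrow> 'a symbol) \<Rightarrow> real"
where
  "covering_prob P k M A U0 U Ulast =
     measure P {\<omega> \<in> space P. \<exists>m\<in>codebook_indices k M. codeword_tuple k U0 U Ulast m \<omega> \<in> A}"

text \<open>
  Under \<open>p\<close>, \<open>marginal k \<mu> p T\<close> is indeed the density of the coordinates in \<open>T\<close>, and \<^const>\<open>ent\<close> is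
  the library entropy (to base e) of these coordinates.
\<close>

lemma distributed_marginal:
  fixes \<mu> :: "nat \<Rightarrow> 'a symbol measure"
  assumes "product_sigma_finite \<mu>" and T: "T \<subseteq> {0..k+1}"
    and p[measurable]: "p \<in> borel_measurable (letters k \<mu>)"
    and nn: "\<And>u. u \<in> space (letters k \<mu>) \<Longrightarrow> 0 \<le> p u"
    and prob: "prob_space (density (letters k \<mu>) p)"
  shows "distributed (density (letters k \<mu>) p) (Pi\<^sub>M T \<mu>) (\<lambda>u. restrict u T) (marginal k \<mu> p T)"
proof -
  interpret product_sigma_finite \<mu> by fact
  define J where "J = {0..k+1}"
  define K where "K = J - T"
  have fin: "finite T" "finite K" and TK: "T \<inter> K = {}" "T \<union> K = J"
    using T finite_subset[OF T] by (auto simp: J_def K_def)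
  have L: "letters k \<mu> = Pi\<^sub>M (T \<union> K) \<mu>" by (simp add: letters_def TK J_def)
  interpret K: finite_product_sigma_finite \<mu> K by standard fact
  have pm[measurable]: "p \<in> borel_measurable (Pi\<^sub>M (T \<union> K) \<mu>)" using p by (simp add: L)
  have marg: "marginal k \<mu> p T = (\<lambda>u. \<integral>v. p (merge T K (u, v)) \<partial>Pi\<^sub>M K \<mu>)"
    by (auto simp: marginal_def J_def K_def)
  have m[measurable]: "marginal k \<mu> p T \<in> borel_measurable (Pi\<^sub>M T \<mu>)"
    unfolding marg by measurable
  have res[measurable]: "(\<lambda>u. restrict u T) \<in> measurable (Pi\<^sub>M (T \<union> K) \<mu>) (Pi\<^sub>M T \<mu>)"
    by (rule measurable_restrict_subset) auto
  have ms: "merge T K (u, v) \<in> space (letters k \<mu>)"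
    if "u \<in> space (Pi\<^sub>M T \<mu>)" "v \<in> space (Pi\<^sub>M K \<mu>)" for u v
    using that measurable_space[OF measurable_merge[of T K \<mu>], of "(u, v)"]
    by (auto simp: L space_pair_measure)
  define g where "g u = (\<integral>\<^sup>+v. ennreal (p (merge T K (u, v))) \<partial>Pi\<^sub>M K \<mu>)" for u
  have g[measurable]: "g \<in> borel_measurable (Pi\<^sub>M T \<mu>)" unfolding g_def by measurable
  have "(\<integral>\<^sup>+u. g u \<partial>Pi\<^sub>M T \<mu>) = (\<integral>\<^sup>+u. ennreal (p u) \<partial>letters k \<mu>)"
    unfolding g_def L by (rule product_nn_integral_fold[symmetric]) (use fin TK in auto)
  also have "\<dots> = 1"
    using prob_space.emeasure_space_1[OF prob] by (simp add: emeasure_density cong: nn_integral_cong)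
  finally have "AE u in Pi\<^sub>M T \<mu>. g u \<noteq> \<infinity>" by (intro nn_integral_PInf_AE) auto
  then have ge: "AE u in Pi\<^sub>M T \<mu>. g u = ennreal (marginal k \<mu> p T u)"
  proof (rule AE_mp, intro AE_I2 impI)
    fix u assume u: "u \<in> space (Pi\<^sub>M T \<mu>)" and f: "g u \<noteq> \<infinity>"
    have um: "(\<lambda>v. p (merge T K (u, v))) \<in> borel_measurable (Pi\<^sub>M K \<mu>)"
      using u by measurable
    have nnv: "AE v in Pi\<^sub>M K \<mu>. 0 \<le> p (merge T K (u, v))"
      using nn ms[OF u] by (intro AE_I2) auto
    have "integrable (Pi\<^sub>M K \<mu>) (\<lambda>v. p (merge T K (u, v)))"
      using f nnv um by (intro integrableI_nonneg) (auto simp: g_def top.not_eq_extremum)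
    from nn_integral_eq_integral[OF this nnv] show "g u = ennreal (marginal k \<mu> p T u)"
      by (simp add: g_def marg)
  qed
  have "distr (density (letters k \<mu>) p) (Pi\<^sub>M T \<mu>) (\<lambda>u. restrict u T) =
    density (Pi\<^sub>M T \<mu>) (marginal k \<mu> p T)"
  proof (rule measure_eqI)
    fix A assume "A \<in> sets (distr (density (letters k \<mu>) p) (Pi\<^sub>M T \<mu>) (\<lambda>u. restrict u T))"
    then have A[measurable]: "A \<in> sets (Pi\<^sub>M T \<mu>)" by simp
    have "emeasure (distr (density (letters k \<mu>) p) (Pi\<^sub>M T \<mu>) (\<lambda>u. restrict u T)) A =
      (\<integral>\<^sup>+u. indicator A u \<partial>distr (density (letters k \<mu>) p) (Pi\<^sub>M T \<mu>) (\<lambda>u. restrict u T))"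
      by simp
    also have "\<dots> = (\<integral>\<^sup>+u. ennreal (p u) * indicator A (restrict u T) \<partial>Pi\<^sub>M (T \<union> K) \<mu>)"
      by (subst nn_integral_distr) (auto simp: L nn_integral_density)
    also have "\<dots> = (\<integral>\<^sup>+u. (\<integral>\<^sup>+v. ennreal (p (merge T K (u, v))) *
        indicator A (restrict (merge T K (u, v)) T) \<partial>Pi\<^sub>M K \<mu>) \<partial>Pi\<^sub>M T \<mu>)"
      by (rule product_nn_integral_fold) (use fin TK in auto)
    also have "\<dots> = (\<integral>\<^sup>+u. g u * indicator A u \<partial>Pi\<^sub>M T \<mu>)"
    proof (rule nn_integral_cong)
      fix u assume u: "u \<in> space (Pi\<^sub>M T \<mu>)"
      have r: "restrict (merge T K (u, v)) T = u" for v
        using u by (auto simp: space_PiM PiE_def restrict_merge extensional_restrict TK)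
      have um: "(\<lambda>v. p (merge T K (u, v))) \<in> borel_measurable (Pi\<^sub>M K \<mu>)"
        using u by measurable
      show "(\<integral>\<^sup>+v. ennreal (p (merge T K (u, v))) * indicator A (restrict (merge T K (u, v)) T) \<partial>Pi\<^sub>M K \<mu>)
          = g u * indicator A u"
        unfolding r g_def using um by (intro nn_integral_multc) auto
    qed
    also have "\<dots> = (\<integral>\<^sup>+u. ennreal (marginal k \<mu> p T u) * indicator A u \<partial>Pi\<^sub>M T \<mu>)"
      by (rule nn_integral_cong_AE) (use ge in auto)
    also have "\<dots> = emeasure (density (Pi\<^sub>M T \<mu>) (marginal k \<mu> p T)) A"
      by (simp add: emeasure_density)
    finally show "emeasure (distr (density (letters k \<mu>) p) (Pi\<^sub>M T \<mu>) (\<lambda>u. restrict u T)) A =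
      emeasure (density (Pi\<^sub>M T \<mu>) (marginal k \<mu> p T)) A" .
  qed simp
  then show ?thesis unfolding distributed_def by (simp add: L)
qed

lemma ent_eq_entropy:
  fixes \<mu> :: "nat \<Rightarrow> 'a symbol measure"
  assumes S: "product_sigma_finite \<mu>" and T: "T \<subseteq> {0..k+1}"
    and p[measurable]: "p \<in> borel_measurable (letters k \<mu>)"
    and nn: "\<And>u. u \<in> space (letters k \<mu>) \<Longrightarrow> 0 \<le> p u"
    and prob: "prob_space (density (letters k \<mu>) p)"
  shows "ent k \<mu> p T =
    prob_space.entropy (density (letters k \<mu>) p) (exp 1) (Pi\<^sub>M T \<mu>) (\<lambda>u. restrict u T)"
proof -
  interpret product_sigma_finite \<mu> by fact
  interpret T: finite_product_sigma_finite \<mu> T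
    by standard (use T finite_subset in auto)
  interpret P: information_space "density (letters k \<mu>) p" "exp 1"
    using prob by (simp add: information_space_def information_space_axioms_def)
  have D: "distributed (density (letters k \<mu>) p) (Pi\<^sub>M T \<mu>) (\<lambda>u. restrict u T) (marginal k \<mu> p T)"
    by (rule distributed_marginal[OF assms])
  have mn: "0 \<le> marginal k \<mu> p T u" if "u \<in> space (Pi\<^sub>M T \<mu>)" for u
  proof -
    have "merge T ({0..k+1} - T) (u, v) \<in> space (letters k \<mu>)"
      if "v \<in> space (Pi\<^sub>M ({0..k+1} - T) \<mu>)" for v
      using that \<open>u \<in> _\<close> T measurable_space[OF measurable_merge[of T "{0..k+1} - T" \<mu>], of "(u, v)"]
      by (auto simp: letters_def space_pair_measure Un_absorb1)
    then show ?thesis unfolding marginal_def by (intro integral_nonneg_AE AE_I2 nn) auto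
  qed
  have meas: "marginal k \<mu> p T \<in> borel_measurable (Pi\<^sub>M T \<mu>)"
    using distributed_real_measurable[OF mn D] by simp
  have r: "marginal k \<mu> p T (restrict u T) = marginal k \<mu> p T u" for u
    by (simp add: marginal_def merge_def restrict_def cong: if_cong)
  have "P.entropy (exp 1) (Pi\<^sub>M T \<mu>) (\<lambda>u. restrict u T) =
    - (\<integral>x. marginal k \<mu> p T x * log (exp 1) (marginal k \<mu> p T x) \<partial>Pi\<^sub>M T \<mu>)"
    by (rule P.entropy_distr[OF D mn])
  also have "(\<integral>x. marginal k \<mu> p T x * log (exp 1) (marginal k \<mu> p T x) \<partial>Pi\<^sub>M T \<mu>) =
    (\<integral>u. ln (marginal k \<mu> p T (restrict u T)) \<partial>density (letters k \<mu>) p)"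
    by (subst distributed_integral[OF D, symmetric])
       (use meas mn in \<open>auto simp: log_def\<close>)
  finally show ?thesis by (simp only: ent_def r)
qed

end

(*
On the typical set every p(u_T^n) is exp(- n H(U_T)) up to a factor exp(n delta), so
the product of the conditional densities p(u_j^n | u_0^n) and the true conditional density of a
group of coordinates differ by an explicit exponential factor.

Converse: for a fixed tuple the probability that (U_0, U_S(m_S), U_{k+1}) is typical is at most
exp(- n (sum_S H(U_j|U_0) - H(U_S|U_0,U_{k+1}) - 2(|S|+1) delta)); a union bound over m_S concludes.

Direct part: conditionally on (U_0, U_{k+1}), the number of jointly typical tuples has mean
|M| times a hitting probability which is bounded below outside a small "not good" set of
conditions (weak law of large numbers for the true joint distribution).  Two tuples that differ
everywhere are conditionally independent, and tuples that agree exactly on S contribute a term of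
order exp(n (..)) / prod_S M_j to the normalised variance.  Chebyshev's inequality finishes the
proof.
*)
theory Submission
  imports Defs "HOL-Real_Asymp.Real_Asymp"
begin

section \<open>Product measures and conditional densities\<close>

text \<open>The weak law holds under p, while the codebook follows another law. The bridge is the
  pair (U_0, U_{k+1}): p(u_0) p(u_{k+1}|u_0) is bounded by p(u_0, u_{k+1}), so conditions that are
  rare under p are rare for the codebook. The lower bound c on the hitting probability r(w) enters
  only once: a pair that agrees somewhere has probability at most r(w) times a section bound, and
  dividing by the squared mean leaves a single 1/r(w), replaced by 1/c. For pairs agreeing exactly
  on S, the section bound has exponent \<open>rate\<close> of the remaining coordinates given S and
  L, and c has exponent \<open>rate L {1..k}\<close>. By the chain rule their difference is exactly
  the entropy expression for S. The obstacle is that \<open>marginal\<close> is a Bochner integral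
  with default value 0 and hence the right density only almost everywhere. All integration is
  therefore done with extended nonnegative marginals, and conditional densities are only shown to
  have mass at most 1; every use is an upper bound or takes place on typical tuples, where both
  kinds of marginals agree.\<close>

lemma measurable_component_component:
  assumes "i \<in> I" "j \<in> K"
  shows "(\<lambda>w. w i j) \<in> Pi\<^sub>M I (\<lambda>_. Pi\<^sub>M K M) \<rightarrow>\<^sub>M M j"
  by (rule measurable_compose[OF measurable_component_singleton[OF assms(1)] measurable_component_singleton[OF assms(2)]])

lemma measurable_transpose:
  "(\<lambda>w. \<lambda>j\<in>K. \<lambda>i\<in>I. w i j) \<in> Pi\<^sub>M I (\<lambda>_. Pi\<^sub>M K M) \<rightarrow>\<^sub>M Pi\<^sub>M K (\<lambda>j. Pi\<^sub>M I (\<lambda>_. M j))"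
  by (intro measurable_restrict measurable_component_component)

text \<open>Blocks are indexed by coordinate and then time, sequences of letter tuples by time and
  then coordinate. For factorised integrands the two orders are compared by induction on the time
  indices: peeling off time \<open>i\<close> extends block \<open>j\<close> by the letter
  \<open>x j\<close>, and the remaining integral over the letters \<open>x\<close> factorises
  again.\<close>

lemma (in product_sigma_finite) nn_integral_prod_transpose:
  assumes K: "finite K" and I: "finite I"
    and f: "\<And>j. j \<in> K \<Longrightarrow> f j \<in> borel_measurable (Pi\<^sub>M I (\<lambda>_. M j))"
  shows "(\<integral>\<^sup>+w. (\<Prod>j\<in>K. f j (\<lambda>i\<in>I. w i j)) \<partial>Pi\<^sub>M I (\<lambda>_. Pi\<^sub>M K M)) =
    (\<Prod>j\<in>K. \<integral>\<^sup>+x. f j x \<partial>Pi\<^sub>M I (\<lambda>_. M j))"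
  using I f
proof (induction I arbitrary: f rule: finite_induct)
  case empty
  then show ?case
    by (simp add: PiM_empty nn_integral_count_space_finite restrict_def)
next
  case (insert i I)
  interpret KK: product_sigma_finite "\<lambda>_::'b. Pi\<^sub>M K M"
    using sigma_finite[OF K] by (simp add: product_sigma_finite_def)
  interpret M: product_sigma_finite "\<lambda>_::'b. M j" for j
    by standard
  note [measurable] = insert.prems
  have r: "(\<lambda>i'\<in>insert i I. (w(i := x)) i' j) = (\<lambda>i'\<in>I. w i' j)(i := x j)" for w x j
    using insert.hyps by (auto simp: fun_eq_iff)
  have [measurable]: "(\<lambda>y. \<lambda>i'\<in>insert i I. y i' j) \<in> Pi\<^sub>M (insert i I) (\<lambda>_. Pi\<^sub>M K M) \<rightarrow>\<^sub>M Pi\<^sub>M (insert i I) (\<lambda>_. M j)"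
    if "j \<in> K" for j
    by (intro measurable_restrict measurable_component_component that)
  have fm: "(\<lambda>w. f j (w(i := y))) \<in> borel_measurable (Pi\<^sub>M I (\<lambda>_. M j))"
    if "j \<in> K" "y \<in> space (M j)" for j y
  proof -
    have "(\<lambda>w. w(i := y)) \<in> Pi\<^sub>M I (\<lambda>_. M j) \<rightarrow>\<^sub>M Pi\<^sub>M (insert i I) (\<lambda>_. M j)"
      by (rule measurable_fun_upd[where J = I]) (use that in auto)
    from measurable_comp[OF this insert.prems[OF that(1)]] show ?thesis by (simp add: comp_def)
  qed
  have pm: "(\<lambda>y. \<integral>\<^sup>+w. f j (w(i := y)) \<partial>Pi\<^sub>M I (\<lambda>_. M j)) \<in> borel_measurable (M j)" if j: "j \<in> K" for j
  proof -
    interpret S: sigma_finite_measure "Pi\<^sub>M I (\<lambda>_. M j)" by (rule M.sigma_finite) fact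
    have "(\<lambda>(y, w). w(i := y)) \<in> M j \<Otimes>\<^sub>M Pi\<^sub>M I (\<lambda>_. M j) \<rightarrow>\<^sub>M Pi\<^sub>M (insert i I) (\<lambda>_. M j)"
      unfolding split_beta by (rule measurable_fun_upd[where J = I]) auto
    from measurable_comp[OF this insert.prems[OF j]] show ?thesis
      by (intro S.borel_measurable_nn_integral) (simp add: comp_def split_beta)
  qed
  have "(\<integral>\<^sup>+w. (\<Prod>j\<in>K. f j (\<lambda>i\<in>insert i I. w i j)) \<partial>Pi\<^sub>M (insert i I) (\<lambda>_. Pi\<^sub>M K M)) =
    (\<integral>\<^sup>+x. (\<integral>\<^sup>+w. (\<Prod>j\<in>K. f j ((\<lambda>i\<in>I. w i j)(i := x j))) \<partial>Pi\<^sub>M I (\<lambda>_. Pi\<^sub>M K M)) \<partial>Pi\<^sub>M K M)"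
    by (subst KK.product_nn_integral_insert_rev) (use insert.hyps in \<open>simp_all only: r, measurable\<close>)
  also have "\<dots> = (\<integral>\<^sup>+x. (\<Prod>j\<in>K. \<integral>\<^sup>+w. f j (w(i := x j)) \<partial>Pi\<^sub>M I (\<lambda>_. M j)) \<partial>Pi\<^sub>M K M)"
    by (intro nn_integral_cong insert.IH fm) (auto simp: space_PiM)
  also have "\<dots> = (\<Prod>j\<in>K. \<integral>\<^sup>+y. \<integral>\<^sup>+w. f j (w(i := y)) \<partial>Pi\<^sub>M I (\<lambda>_. M j) \<partial>M j)"
    by (rule product_nn_integral_prod[OF K pm])
  also have "\<dots> = (\<Prod>j\<in>K. \<integral>\<^sup>+x. f j x \<partial>Pi\<^sub>M (insert i I) (\<lambda>_. M j))"
    by (intro prod.cong refl M.product_nn_integral_insert_rev[symmetric]) (use insert.hyps in auto)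
  finally show ?case .
qed

text \<open>Indicators of rectangles factorise over the coordinates, and rectangles determine the
  sigma-finite product.\<close>

lemma (in product_sigma_finite) distr_PiM_transpose:
  assumes K: "finite K" and I: "finite I"
  shows "distr (Pi\<^sub>M I (\<lambda>_. Pi\<^sub>M K M)) (Pi\<^sub>M K (\<lambda>j. Pi\<^sub>M I (\<lambda>_. M j))) (\<lambda>w. \<lambda>j\<in>K. \<lambda>i\<in>I. w i j) =
    Pi\<^sub>M K (\<lambda>j. Pi\<^sub>M I (\<lambda>_. M j))"
proof -
  interpret M: product_sigma_finite "\<lambda>_::'b. M j" for j by standard
  interpret B: product_sigma_finite "\<lambda>j. Pi\<^sub>M I (\<lambda>_::'b. M j)"
    using M.sigma_finite[OF I] by (simp add: product_sigma_finite_def)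
  have [measurable]: "(\<lambda>w. \<lambda>j\<in>K. \<lambda>i\<in>I. w i j) \<in> Pi\<^sub>M I (\<lambda>_. Pi\<^sub>M K M) \<rightarrow>\<^sub>M Pi\<^sub>M K (\<lambda>j. Pi\<^sub>M I (\<lambda>_. M j))"
    by (rule measurable_transpose)
  show ?thesis
  proof (rule B.PiM_eqI[OF K])
    fix A assume A: "\<And>j. j \<in> K \<Longrightarrow> A j \<in> sets (Pi\<^sub>M I (\<lambda>_. M j))"
    then have [measurable]: "Pi\<^sub>E K A \<in> sets (Pi\<^sub>M K (\<lambda>j. Pi\<^sub>M I (\<lambda>_. M j)))"
      using K by (intro sets_PiM_I_finite) auto
    have "emeasure (distr (Pi\<^sub>M I (\<lambda>_. Pi\<^sub>M K M)) (Pi\<^sub>M K (\<lambda>j. Pi\<^sub>M I (\<lambda>_. M j))) (\<lambda>w. \<lambda>j\<in>K. \<lambda>i\<in>I. w i j)) (Pi\<^sub>E K A) =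
      (\<integral>\<^sup>+w. indicator (Pi\<^sub>E K A) (\<lambda>j\<in>K. \<lambda>i\<in>I. w i j) \<partial>Pi\<^sub>M I (\<lambda>_. Pi\<^sub>M K M))"
      by (subst nn_integral_indicator[symmetric], simp, subst nn_integral_distr) auto
    also have "\<dots> = (\<integral>\<^sup>+w. (\<Prod>j\<in>K. indicator (A j) (\<lambda>i\<in>I. w i j)) \<partial>Pi\<^sub>M I (\<lambda>_. Pi\<^sub>M K M))"
      using K by (intro nn_integral_cong) (auto simp: indicator_def PiE_iff prod_eq_1_iff intro!: prod_zero[symmetric] prod.neutral[symmetric])
    also have "\<dots> = (\<Prod>j\<in>K. emeasure (Pi\<^sub>M I (\<lambda>_. M j)) (A j))"
      by (subst nn_integral_prod_transpose[OF K I]) (use A in \<open>auto intro!: prod.cong\<close>)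
    finally show "emeasure (distr (Pi\<^sub>M I (\<lambda>_. Pi\<^sub>M K M)) (Pi\<^sub>M K (\<lambda>j. Pi\<^sub>M I (\<lambda>_. M j))) (\<lambda>w. \<lambda>j\<in>K. \<lambda>i\<in>I. w i j)) (Pi\<^sub>E K A) =
      (\<Prod>j\<in>K. emeasure (Pi\<^sub>M I (\<lambda>_. M j)) (A j))" .
  qed simp
qed

lemma (in product_sigma_finite) nn_integral_transpose:
  assumes K: "finite K" and I: "finite I"
    and f[measurable]: "f \<in> borel_measurable (Pi\<^sub>M K (\<lambda>j. Pi\<^sub>M I (\<lambda>_. M j)))"
  shows "(\<integral>\<^sup>+u. f u \<partial>Pi\<^sub>M K (\<lambda>j. Pi\<^sub>M I (\<lambda>_. M j))) =
    (\<integral>\<^sup>+w. f (\<lambda>j\<in>K. \<lambda>i\<in>I. w i j) \<partial>Pi\<^sub>M I (\<lambda>_. Pi\<^sub>M K M))"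
proof -
  have "(\<lambda>w. \<lambda>j\<in>K. \<lambda>i\<in>I. w i j) \<in> Pi\<^sub>M I (\<lambda>_. Pi\<^sub>M K M) \<rightarrow>\<^sub>M Pi\<^sub>M K (\<lambda>j. Pi\<^sub>M I (\<lambda>_. M j))"
    by (rule measurable_transpose)
  then show ?thesis
    by (subst distr_PiM_transpose[OF K I, symmetric], rule nn_integral_distr) auto
qed

text \<open>Turns the density of one letter tuple into that of n independent ones. Both measures
  agree on rectangles, and sigma-finiteness of the factors makes the product measure unique.\<close>

lemma PiM_density:
  fixes M :: "'i \<Rightarrow> 'b measure"
  assumes "product_sigma_finite M" "product_sigma_finite (\<lambda>i. density (M i) (f i))" and I: "finite I"
    and f[measurable]: "\<And>i. i \<in> I \<Longrightarrow> f i \<in> borel_measurable (M i)"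
  shows "Pi\<^sub>M I (\<lambda>i. density (M i) (f i)) = density (Pi\<^sub>M I M) (\<lambda>w. \<Prod>i\<in>I. f i (w i))"
proof -
  interpret M: product_sigma_finite M by fact
  interpret D: product_sigma_finite "\<lambda>i. density (M i) (f i)" by fact
  show ?thesis
  proof (rule D.PiM_eqI[OF I, symmetric])
    show "sets (density (Pi\<^sub>M I M) (\<lambda>w. \<Prod>i\<in>I. f i (w i))) = sets (Pi\<^sub>M I (\<lambda>i. density (M i) (f i)))"
      by (simp cong: sets_PiM_cong)
    fix A assume "\<And>i. i \<in> I \<Longrightarrow> A i \<in> sets (density (M i) (f i))"
    then have A[measurable]: "\<And>i. i \<in> I \<Longrightarrow> A i \<in> sets (M i)" by simp
    have [measurable]: "Pi\<^sub>E I A \<in> sets (Pi\<^sub>M I M)" using I by (intro sets_PiM_I_finite) auto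
    have "emeasure (density (Pi\<^sub>M I M) (\<lambda>w. \<Prod>i\<in>I. f i (w i))) (Pi\<^sub>E I A) =
      (\<integral>\<^sup>+w. (\<Prod>i\<in>I. f i (w i)) * indicator (Pi\<^sub>E I A) w \<partial>Pi\<^sub>M I M)"
      by (simp add: emeasure_density)
    also have "\<dots> = (\<integral>\<^sup>+w. (\<Prod>i\<in>I. f i (w i) * indicator (A i) (w i)) \<partial>Pi\<^sub>M I M)"
      using I by (intro nn_integral_cong)
        (auto simp: indicator_def PiE_iff space_PiM intro!: prod_zero[symmetric] prod.cong)
    also have "\<dots> = (\<Prod>i\<in>I. emeasure (density (M i) (f i)) (A i))"
      by (subst M.product_nn_integral_prod[OF I]) (auto simp: emeasure_density intro!: prod.cong)
    finally show "emeasure (density (Pi\<^sub>M I M) (\<lambda>w. \<Prod>i\<in>I. f i (w i))) (Pi\<^sub>E I A) =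
      (\<Prod>i\<in>I. emeasure (density (M i) (f i)) (A i))" .
  qed
qed

text \<open>The definition fixes the law of (V, X) only on rectangles, but typicality is a joint
  condition on V and X. Rectangles form an intersection-stable generator and the law is finite, so
  the joint law has density \<open>f\<close> with respect to the law of V times Q.\<close>

lemma has_cond_density_nn_integral:
  assumes P: "prob_space P" and Q: "sigma_finite_measure Q" and h: "has_cond_density P N V Q X f"
    and F[measurable]: "F \<in> borel_measurable (N \<Otimes>\<^sub>M Q)"
  shows "(\<integral>\<^sup>+\<omega>. F (V \<omega>, X \<omega>) \<partial>P) = (\<integral>\<^sup>+v. (\<integral>\<^sup>+x. ennreal (f v x) * F (v, x) \<partial>Q) \<partial>distr P N V)"
proof -
  interpret P: prob_space P by fact
  interpret Q: sigma_finite_measure Q by fact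
  have [measurable]: "V \<in> P \<rightarrow>\<^sub>M N" "X \<in> P \<rightarrow>\<^sub>M Q" and fm[measurable]: "(\<lambda>(v, x). f v x) \<in> borel_measurable (N \<Otimes>\<^sub>M Q)"
    and eq: "\<And>B C. C \<in> sets N \<Longrightarrow> B \<in> sets Q \<Longrightarrow> emeasure P {\<omega> \<in> space P. V \<omega> \<in> C \<and> X \<omega> \<in> B} =
        (\<integral>\<^sup>+v\<in>C. emeasure (density Q (\<lambda>x. ennreal (f v x))) B \<partial>distr P N V)"
    using h by (auto simp: has_cond_density_def)
  interpret D: prob_space "distr P N V" by (rule P.prob_space_distr) simp
  interpret DQ: pair_sigma_finite "distr P N V" Q by standard
  define E where "E = density (distr P N V \<Otimes>\<^sub>M Q) (\<lambda>z. ennreal (f (fst z) (snd z)))"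
  have fm'[measurable]: "(\<lambda>z. f (fst z) (snd z)) \<in> borel_measurable (N \<Otimes>\<^sub>M Q)"
    using fm by (simp add: split_beta')
  have sp: "sets (distr P N V \<Otimes>\<^sub>M Q) = sets (N \<Otimes>\<^sub>M Q)" by (rule sets_pair_measure_cong) auto
  have fv[measurable]: "f v \<in> borel_measurable Q" if "v \<in> space N" for v
    using measurable_compose[OF measurable_Pair1'[OF that] fm] by simp
  have "distr P (N \<Otimes>\<^sub>M Q) (\<lambda>\<omega>. (V \<omega>, X \<omega>)) = E"
  proof (rule measure_eqI_generator_eq[OF Int_stable_pair_measure_generator[of N Q], where \<Omega> = "space N \<times> space Q" and A = "\<lambda>_. space N \<times> space Q"])
    show "{a \<times> b |a b. a \<in> sets N \<and> b \<in> sets Q} \<subseteq> Pow (space N \<times> space Q)"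
      by (rule pair_measure_closed)
    show "sets (distr P (N \<Otimes>\<^sub>M Q) (\<lambda>\<omega>. (V \<omega>, X \<omega>))) = sigma_sets (space N \<times> space Q) {a \<times> b |a b. a \<in> sets N \<and> b \<in> sets Q}"
      by (simp add: sets_pair_measure)
    show "sets E = sigma_sets (space N \<times> space Q) {a \<times> b |a b. a \<in> sets N \<and> b \<in> sets Q}"
      by (simp add: E_def sp sets_pair_measure)
    show "emeasure (distr P (N \<Otimes>\<^sub>M Q) (\<lambda>\<omega>. (V \<omega>, X \<omega>))) (space N \<times> space Q) \<noteq> \<infinity>"
      by (simp add: emeasure_distr)
    fix A assume "A \<in> {a \<times> b |a b. a \<in> sets N \<and> b \<in> sets Q}"
    then obtain C B where A: "A = C \<times> B" and [measurable]: "C \<in> sets N" "B \<in> sets Q" by auto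
    have "emeasure (distr P (N \<Otimes>\<^sub>M Q) (\<lambda>\<omega>. (V \<omega>, X \<omega>))) A = emeasure P {\<omega> \<in> space P. V \<omega> \<in> C \<and> X \<omega> \<in> B}"
      unfolding A by (subst emeasure_distr) (auto intro!: arg_cong[where f = "emeasure P"])
    also have "\<dots> = (\<integral>\<^sup>+v. \<integral>\<^sup>+x. ennreal (f v x) * indicator (C \<times> B) (v, x) \<partial>Q \<partial>distr P N V)"
      unfolding eq[OF \<open>C \<in> sets N\<close> \<open>B \<in> sets Q\<close>]
      by (intro nn_integral_cong) (auto simp: emeasure_density indicator_def nn_integral_cmult)
    also have "\<dots> = emeasure E A"
      unfolding E_def A by (subst emeasure_density) (auto simp: Q.nn_integral_fst[symmetric] sp cong: measurable_cong_sets)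
    finally show "emeasure (distr P (N \<Otimes>\<^sub>M Q) (\<lambda>\<omega>. (V \<omega>, X \<omega>))) A = emeasure E A" .
  qed auto
  then have "(\<integral>\<^sup>+\<omega>. F (V \<omega>, X \<omega>) \<partial>P) = (\<integral>\<^sup>+z. F z \<partial>E)"
    by (subst nn_integral_distr[symmetric, where M' = "N \<Otimes>\<^sub>M Q"]) auto
  also have "\<dots> = (\<integral>\<^sup>+v. (\<integral>\<^sup>+x. ennreal (f v x) * F (v, x) \<partial>Q) \<partial>distr P N V)"
    unfolding E_def
    by (subst nn_integral_density) (auto simp: Q.nn_integral_fst[symmetric] sp cong: measurable_cong_sets)
  finally show ?thesis .
qed

section \<open>The weak law of large numbers\<close>

lemma (in prob_space) indep_vars_PiM_coordinates:
  assumes I: "I \<noteq> {}" and f: "f \<in> borel_measurable M"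
  shows "prob_space.indep_vars (Pi\<^sub>M I (\<lambda>_. M)) (\<lambda>_. borel) (\<lambda>i w. f (w i)) I"
proof -
  interpret P: prob_space "Pi\<^sub>M I (\<lambda>_. M)" by (intro prob_space_PiM prob_space_axioms)
  have "P.indep_vars (\<lambda>_. M) (\<lambda>i w. w i) I"
  proof (subst P.indep_vars_iff_distr_eq_PiM'[OF I])
    have "distr (Pi\<^sub>M I (\<lambda>_. M)) (Pi\<^sub>M I (\<lambda>_. M)) (\<lambda>x. \<lambda>i\<in>I. x i) = distr (Pi\<^sub>M I (\<lambda>_. M)) (Pi\<^sub>M I (\<lambda>_. M)) (\<lambda>x. x)"
      by (intro distr_cong) (auto simp: space_PiM PiE_def extensional_restrict)
    also have "\<dots> = Pi\<^sub>M I (\<lambda>_. M)" by (rule distr_id2) simp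
    also have "\<dots> = Pi\<^sub>M I (\<lambda>i. distr (Pi\<^sub>M I (\<lambda>_. M)) M (\<lambda>x. x i))"
      by (intro PiM_cong refl distr_PiM_component[symmetric] prob_space_axioms)
    finally show "distr (Pi\<^sub>M I (\<lambda>_. M)) (Pi\<^sub>M I (\<lambda>_. M)) (\<lambda>x. \<lambda>i\<in>I. x i) =
      Pi\<^sub>M I (\<lambda>i. distr (Pi\<^sub>M I (\<lambda>_. M)) M (\<lambda>x. x i))" .
  qed simp
  from P.indep_vars_compose2[OF this, where N = "\<lambda>_. borel" and Y = "\<lambda>_. f"] show ?thesis
    using f by simp
qed

text \<open>Only a first moment is assumed: truncate at a fixed level, apply Hoeffding's inequality to the
  truncated variables and Markov's inequality to the remainder.\<close>

lemma (in prob_space) weak_law_of_large_numbers: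
  fixes f :: "'a \<Rightarrow> real"
  assumes f: "integrable M f" and \<delta>: "\<delta> > 0"
  shows "(\<lambda>n. measure (Pi\<^sub>M {1..n} (\<lambda>_. M))
    {w \<in> space (Pi\<^sub>M {1..n} (\<lambda>_. M)). \<bar>(1 / real n) * (\<Sum>i=1..n. f (w i)) - expectation f\<bar> \<ge> \<delta>}) \<longlonglongrightarrow> 0"
proof (rule LIMSEQ_I)
  fix r :: real assume r: "r > 0"
  have [measurable]: "f \<in> borel_measurable M" using f by simp
  define g where "g K x = (if \<bar>f x\<bar> \<le> real K then f x else 0)" for K x
  have gm[measurable]: "g K \<in> borel_measurable M" for K unfolding g_def by measurable
  have gb: "\<bar>g K x\<bar> \<le> real K" for K x by (auto simp: g_def)
  have gi: "integrable M (g K)" for K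
    by (rule integrable_const_bound[where B = "real K"]) (auto simp: gb)
  have "(\<lambda>K. expectation (\<lambda>x. \<bar>f x - g K x\<bar>)) \<longlonglongrightarrow> expectation (\<lambda>x. 0)"
  proof (rule integral_dominated_convergence[where w = "\<lambda>x. \<bar>f x\<bar>"])
    show "AE x in M. (\<lambda>K. \<bar>f x - g K x\<bar>) \<longlonglongrightarrow> 0"
    proof (intro AE_I2 tendsto_eventually)
      fix x
      obtain K0 where "\<bar>f x\<bar> \<le> real K0" using real_arch_simple by blast
      then show "\<forall>\<^sub>F K in sequentially. \<bar>f x - g K x\<bar> = 0"
        by (intro eventually_sequentiallyI[of K0]) (auto simp: g_def)
    qed
  qed (use f in \<open>auto simp: g_def\<close>)
  then have "(\<lambda>K. expectation (\<lambda>x. \<bar>f x - g K x\<bar>)) \<longlonglongrightarrow> 0" by simp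
  \<comment> \<open>The first term keeps the truncation bias below \<delta>/3; the second makes
    Markov's bound for the remainder, \<open>expectation h / (\<delta>/3)\<close>, smaller than
    r/2.\<close>
  moreover define \<epsilon> where "\<epsilon> = min (\<delta>/3) (\<delta> * r / 6)"
  moreover have "\<epsilon> > 0" using \<delta> r by (simp add: \<epsilon>_def)
  ultimately obtain K0 where K0: "\<And>K. K \<ge> K0 \<Longrightarrow> expectation (\<lambda>x. \<bar>f x - g K x\<bar>) < \<epsilon>"
    using LIMSEQ_D[of _ 0 \<epsilon>] by fastforce
  \<comment> \<open>The successor makes the truncation level positive, so that Hoeffding's
    denominator n (2 K)^2 does not vanish.\<close>
  define K where "K = Suc K0"
  define h where "h x = \<bar>f x - g K x\<bar>" for x
  have hm[measurable]: "h \<in> borel_measurable M" unfolding h_def by measurable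
  have hi: "integrable M h" unfolding h_def using f gi by auto
  have h: "expectation h < \<epsilon>" using K0[of K] by (simp add: K_def h_def[abs_def])
  have h0: "h x \<ge> 0" for x by (simp add: h_def)
  have eg: "\<bar>expectation f - expectation (g K)\<bar> \<le> expectation h"
    unfolding h_def using integral_abs_bound[of M "\<lambda>x. f x - g K x"] f gi by simp
  have lim: "(\<lambda>n. 2 * exp (-2 * (real n * (\<delta>/3))\<^sup>2 / (real n * (2 * real K)\<^sup>2))) \<longlonglongrightarrow> 0"
  proof -
    have K: "real K > 0" by (simp add: K_def)
    define c where "c = 2 * (\<delta>/3)\<^sup>2 / (2 * real K)\<^sup>2"
    have c: "c > 0" using \<delta> K by (simp add: c_def)
    have "(\<lambda>n. 2 * exp (- (c * real n))) \<longlonglongrightarrow> 0"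
      using c by real_asymp
    moreover have "exp (- (c * real n)) = exp (-2 * (real n * (\<delta>/3))\<^sup>2 / (real n * (2 * real K)\<^sup>2))" for n
      by (cases "n = 0") (auto simp: c_def power2_eq_square field_simps)
    ultimately show ?thesis by simp
  qed
  then obtain N where N: "\<And>n. n \<ge> N \<Longrightarrow>
      2 * exp (-2 * (real n * (\<delta>/3))\<^sup>2 / (real n * (2 * real K)\<^sup>2)) < r/2"
    using LIMSEQ_D[OF lim, of "r/2"] r by auto
  show "\<exists>no. \<forall>n\<ge>no. norm (measure (Pi\<^sub>M {1..n} (\<lambda>_. M))
    {w \<in> space (Pi\<^sub>M {1..n} (\<lambda>_. M)). \<bar>(1 / real n) * (\<Sum>i=1..n. f (w i)) - expectation f\<bar> \<ge> \<delta>} - 0) < r"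
  proof (intro exI[of _ "max N 1"] allI impI)
    fix n assume n: "max N 1 \<le> n"
    define P where "P = Pi\<^sub>M {1..n} (\<lambda>_. M)"
    interpret P: prob_space P unfolding P_def by (intro prob_space_PiM prob_space_axioms)
    have cmM: "(\<lambda>w. w i) \<in> P \<rightarrow>\<^sub>M M" if "i \<in> {1..n}" for i
      unfolding P_def using that by (rule measurable_component_singleton)
    have cm[measurable]: "(\<lambda>w. u (w i)) \<in> borel_measurable P" if "i \<in> {1..n}" "u \<in> borel_measurable M" for i and u :: "'a \<Rightarrow> real"
      by (rule measurable_compose[OF cmM[OF that(1)] that(2)])
    have D: "distr P M (\<lambda>w. w i) = M" if "i \<in> {1..n}" for i
      unfolding P_def by (rule distr_PiM_component) (use that prob_space_axioms in auto)
    have ce: "P.expectation (\<lambda>w. u (w i)) = expectation u" if "i \<in> {1..n}" "u \<in> borel_measurable M" for i and u :: "'a \<Rightarrow> real"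
      using integral_distr[OF cmM[OF that(1)] that(2)] D[OF that(1)] by simp
    have ci: "integrable P (\<lambda>w. u (w i))" if "i \<in> {1..n}" "integrable M u" for i and u :: "'a \<Rightarrow> real"
      using integrable_distr_eq[OF cmM[OF that(1)], of u] that D[OF that(1)] by simp
    interpret H: Hoeffding_ineq P "{1..n}" "\<lambda>i w. g K (w i)" "\<lambda>_. - real K" "\<lambda>_. real K"
        "\<Sum>i\<in>{1..n}. P.expectation (\<lambda>w. g K (w i))"
    proof unfold_locales
      show "P.indep_vars (\<lambda>_. borel) (\<lambda>i w. g K (w i)) {1..n}"
        unfolding P_def by (rule indep_vars_PiM_coordinates) (use n in auto)
    qed (use gb in \<open>auto simp: abs_le_iff minus_le_iff\<close>)
    have A: "P.prob {w \<in> space P. \<bar>(\<Sum>i\<in>{1..n}. g K (w i)) - real n * expectation (g K)\<bar> \<ge> real n * (\<delta>/3)}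
        < r/2"
    proof -
      have "(\<Sum>i\<in>{1..n}. P.expectation (\<lambda>w. g K (w i))) = real n * expectation (g K)"
        by (simp add: ce)
      moreover have "(\<Sum>i\<in>{1..n}. (real K - - real K)\<^sup>2) = real n * (2 * real K)\<^sup>2"
        by simp
      moreover have "real n * (2 * real K)\<^sup>2 > 0" using n by (simp add: K_def)
      ultimately show ?thesis
        using H.Hoeffding_ineq_abs_ge[of "real n * (\<delta>/3)"] N[of n] n \<delta> by simp
    qed
    have B: "P.prob {w \<in> space P. (\<Sum>i\<in>{1..n}. h (w i)) \<ge> real n * (\<delta>/3)} < r/2"
    proof -
      have "P.prob {w \<in> space P. (\<Sum>i\<in>{1..n}. h (w i)) \<ge> real n * (\<delta>/3)} \<le>
          P.expectation (\<lambda>w. \<Sum>i\<in>{1..n}. h (w i)) / (real n * (\<delta>/3))"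
        by (rule integral_Markov_inequality_measure[where A = "{}"])
           (use n \<delta> ci hi h0 in \<open>auto intro!: sum_nonneg\<close>)
      also have "P.expectation (\<lambda>w. \<Sum>i\<in>{1..n}. h (w i)) = real n * expectation h"
        by (subst Bochner_Integration.integral_sum) (use ci hi in \<open>auto simp: ce\<close>)
      also have "real n * expectation h / (real n * (\<delta>/3)) = expectation h / (\<delta>/3)" using n by simp
      also have "\<dots> < \<epsilon> / (\<delta>/3)" using h \<delta> by (simp add: divide_strict_right_mono)
      also have "\<dots> \<le> (\<delta> * r / 6) / (\<delta>/3)" using \<delta> by (intro divide_right_mono) (auto simp: \<epsilon>_def)
      also have "\<dots> = r/2" using \<delta> by simp
      finally show ?thesis .
    qed
    have "P.prob {w \<in> space P. \<bar>(1 / real n) * (\<Sum>i=1..n. f (w i)) - expectation f\<bar> \<ge> \<delta>} \<le>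
      P.prob ({w \<in> space P. \<bar>(\<Sum>i\<in>{1..n}. g K (w i)) - real n * expectation (g K)\<bar> \<ge> real n * (\<delta>/3)} \<union>
        {w \<in> space P. (\<Sum>i\<in>{1..n}. h (w i)) \<ge> real n * (\<delta>/3)})"
    proof (rule P.finite_measure_mono)
      show "{w \<in> space P. \<bar>(1 / real n) * (\<Sum>i=1..n. f (w i)) - expectation f\<bar> \<ge> \<delta>} \<subseteq>
        {w \<in> space P. \<bar>(\<Sum>i\<in>{1..n}. g K (w i)) - real n * expectation (g K)\<bar> \<ge> real n * (\<delta>/3)} \<union>
        {w \<in> space P. (\<Sum>i\<in>{1..n}. h (w i)) \<ge> real n * (\<delta>/3)}"
      proof (rule subsetI, rule ccontr)
        fix w assume w: "w \<in> {w \<in> space P. \<bar>(1 / real n) * (\<Sum>i=1..n. f (w i)) - expectation f\<bar> \<ge> \<delta>}"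
          and nw: "w \<notin> {w \<in> space P. \<bar>(\<Sum>i\<in>{1..n}. g K (w i)) - real n * expectation (g K)\<bar> \<ge> real n * (\<delta>/3)} \<union>
            {w \<in> space P. (\<Sum>i\<in>{1..n}. h (w i)) \<ge> real n * (\<delta>/3)}"
        \<comment> \<open>The deviation of the average splits into remainder, fluctuation of the
          truncated average, and bias. Outside the two exceptional events each of them is below
          \<delta>/3.\<close>
        define F G where "F = (\<Sum>i=1..n. f (w i))" and "G = (\<Sum>i=1..n. g K (w i))"
        have 1: "\<bar>G - real n * expectation (g K)\<bar> < real n * (\<delta>/3)"
          and 2: "(\<Sum>i=1..n. h (w i)) < real n * (\<delta>/3)" using w nw by (auto simp: G_def)
        have 3: "\<bar>F - G\<bar> < real n * (\<delta>/3)"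
          using sum_abs[of "\<lambda>i. f (w i) - g K (w i)" "{1..n}"] 2
          by (simp add: F_def G_def sum_subtractf h_def)
        have "\<bar>expectation f - expectation (g K)\<bar> < \<delta>/3" using eg h by (simp add: \<epsilon>_def)
        then have "real n * \<bar>expectation f - expectation (g K)\<bar> < real n * (\<delta>/3)"
          using n by (intro mult_strict_left_mono) auto
        then have 4: "\<bar>real n * expectation f - real n * expectation (g K)\<bar> < real n * (\<delta>/3)"
          by (simp add: abs_mult[symmetric] right_diff_distrib[symmetric] del: abs_mult)
             (simp add: abs_mult)
        have "\<bar>F - real n * expectation f\<bar> < real n * \<delta>" using 1 3 4 by linarith
        moreover have "(1 / real n) * F - expectation f = (F - real n * expectation f) / real n"
          using n by (simp add: field_simps)
        ultimately have "\<bar>(1 / real n) * F - expectation f\<bar> < \<delta>"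
          using n by (simp add: field_simps)
        then show False using w by (simp add: F_def)
      qed
    qed auto
    also have "\<dots> \<le> P.prob {w \<in> space P. \<bar>(\<Sum>i\<in>{1..n}. g K (w i)) - real n * expectation (g K)\<bar> \<ge> real n * (\<delta>/3)} +
        P.prob {w \<in> space P. (\<Sum>i\<in>{1..n}. h (w i)) \<ge> real n * (\<delta>/3)}"
      by (rule measure_Un_le) auto
    also have "\<dots> < r" using A B by simp
    finally show "norm (measure (Pi\<^sub>M {1..n} (\<lambda>_. M))
      {w \<in> space (Pi\<^sub>M {1..n} (\<lambda>_. M)). \<bar>(1 / real n) * (\<Sum>i=1..n. f (w i)) - expectation f\<bar> \<ge> \<delta>} - 0) < r"
      by (simp add: P_def)
  qed
qed

section \<open>Marginals of letters and blocks\<close>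

locale joint_density = product_sigma_finite \<mu>
  for \<mu> :: "nat \<Rightarrow> 'a symbol measure" +
  fixes k :: nat and p :: "(nat \<Rightarrow> 'a symbol) \<Rightarrow> real"
  assumes p_measurable: "p \<in> borel_measurable (letters k \<mu>)"
    and p_nonneg: "\<And>u. u \<in> space (letters k \<mu>) \<Longrightarrow> p u \<ge> 0"
    and p_prob: "prob_space (density (letters k \<mu>) p)"
begin

abbreviation "J \<equiv> {0..Suc k}"
abbreviation "marg \<equiv> marginal k \<mu> p"
abbreviation "cnd \<equiv> cond_marginal k \<mu> p"
abbreviation "B n \<equiv> block n \<mu>"

text \<open>Unlike \<^const>\<open>marginal\<close>, the \<^typ>\<open>ennreal\<close>-valued marginals satisfy Tonelli's theorem at
  every point, not just almost everywhere, and both agree wherever \<^const>\<open>marginal\<close> is positive.\<close>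

definition nnmarg :: "nat set \<Rightarrow> (nat \<Rightarrow> 'a symbol) \<Rightarrow> ennreal" where
  "nnmarg T u = (\<integral>\<^sup>+v. ennreal (p (merge T (J - T) (u, v))) \<partial>Pi\<^sub>M (J - T) \<mu>)"

definition nnblock :: "nat \<Rightarrow> nat set \<Rightarrow> (nat \<Rightarrow> nat \<Rightarrow> 'a symbol) \<Rightarrow> ennreal" where
  "nnblock n T u = (\<Prod>i=1..n. nnmarg T (\<lambda>j. u j i))"

definition mblock :: "nat \<Rightarrow> nat set \<Rightarrow> (nat \<Rightarrow> nat \<Rightarrow> 'a symbol) \<Rightarrow> real" where
  "mblock n T u = (\<Prod>i=1..n. marg T (\<lambda>j. u j i))"

lemma letters_J: "letters k \<mu> = Pi\<^sub>M J \<mu>"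
  by (simp add: letters_def)

lemma marg_J: "marg T u = (\<integral>v. p (merge T (J - T) (u, v)) \<partial>Pi\<^sub>M (J - T) \<mu>)"
  by (simp add: marginal_def)

lemma finite_subset_J: "K \<subseteq> J \<Longrightarrow> finite K"
  by (rule finite_subset) auto

lemma product_sigma_finite_block: "product_sigma_finite (B n)"
proof -
  interpret M: product_sigma_finite "\<lambda>_::nat. \<mu> j" for j
    using sigma_finite_measures by (simp add: product_sigma_finite_def)
  show ?thesis using M.sigma_finite[of "{1..n}"] by (simp add: product_sigma_finite_def block_def)
qed

lemma sigma_finite_letters: "product_sigma_finite (\<lambda>_::nat. letters k \<mu>)"
  using sigma_finite[of J] by (simp add: product_sigma_finite_def letters_J)

lemma nnmarg_cong: "(\<And>j. j \<in> T \<Longrightarrow> u j = u' j) \<Longrightarrow> nnmarg T u = nnmarg T u'"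
  by (simp add: nnmarg_def merge_def cong: if_cong)

lemma marg_cong: "(\<And>j. j \<in> T \<Longrightarrow> u j = u' j) \<Longrightarrow> marg T u = marg T u'"
  by (simp add: marg_J merge_def cong: if_cong)

lemma nnblock_cong: "(\<And>j. j \<in> T \<Longrightarrow> u j = u' j) \<Longrightarrow> nnblock n T u = nnblock n T u'"
  unfolding nnblock_def by (intro prod.cong refl nnmarg_cong) auto

lemma mblock_cong: "(\<And>j. j \<in> T \<Longrightarrow> u j = u' j) \<Longrightarrow> mblock n T u = mblock n T u'"
  unfolding mblock_def by (intro prod.cong refl marg_cong) auto

lemma merge_in_letters:
  assumes "T \<subseteq> J" "\<And>j. j \<in> T \<Longrightarrow> u j \<in> space (\<mu> j)" "v \<in> space (Pi\<^sub>M (J - T) \<mu>)"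
  shows "merge T (J - T) (u, v) \<in> space (letters k \<mu>)"
  using assms by (auto simp: letters_J space_PiM PiE_iff merge_def extensional_def)

lemma measurable_p_merge:
  assumes T: "T \<subseteq> J"
  shows "(\<lambda>(u, v). p (merge T (J - T) (u, v))) \<in> borel_measurable (Pi\<^sub>M T \<mu> \<Otimes>\<^sub>M Pi\<^sub>M (J - T) \<mu>)"
proof -
  have "p \<in> borel_measurable (Pi\<^sub>M (T \<union> (J - T)) \<mu>)"
    using p_measurable T by (simp add: letters_J Un_absorb1)
  from measurable_compose[OF measurable_merge this] show ?thesis by (simp add: split_beta)
qed

lemma measurable_p_section:
  assumes T: "T \<subseteq> J" and u: "\<And>j. j \<in> T \<Longrightarrow> u j \<in> space (\<mu> j)"
  shows "(\<lambda>v. p (merge T (J - T) (u, v))) \<in> borel_measurable (Pi\<^sub>M (J - T) \<mu>)"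
proof -
  have "restrict u T \<in> space (Pi\<^sub>M T \<mu>)" using u by (auto simp: space_PiM)
  from measurable_compose[OF measurable_Pair1'[OF this] measurable_p_merge[OF T]]
  have "(\<lambda>v. p (merge T (J - T) (restrict u T, v))) \<in> borel_measurable (Pi\<^sub>M (J - T) \<mu>)" by simp
  moreover have "merge T (J - T) (restrict u T, v) = merge T (J - T) (u, v)" for v
    by (auto simp: merge_def fun_eq_iff)
  ultimately show ?thesis by simp
qed

lemma sigma_finite_PiM: "K \<subseteq> J \<Longrightarrow> sigma_finite_measure (Pi\<^sub>M K \<mu>)"
  by (rule sigma_finite[OF finite_subset_J])

lemma nnmarg_measurable: assumes "T \<subseteq> J" shows "nnmarg T \<in> borel_measurable (Pi\<^sub>M T \<mu>)"
proof -
  interpret S: sigma_finite_measure "Pi\<^sub>M (J - T) \<mu>" by (rule sigma_finite_PiM) auto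
  show ?thesis unfolding nnmarg_def[abs_def]
    by (rule S.borel_measurable_nn_integral)
       (use measurable_compose[OF measurable_p_merge[OF assms] measurable_ennreal] in \<open>simp add: split_beta\<close>)
qed

lemma marg_measurable: assumes "T \<subseteq> J" shows "marg T \<in> borel_measurable (Pi\<^sub>M T \<mu>)"
proof -
  interpret S: sigma_finite_measure "Pi\<^sub>M (J - T) \<mu>" by (rule sigma_finite_PiM) auto
  show ?thesis unfolding fun_eq_iff[THEN iffD2, OF allI, OF marg_J]
    by (rule S.borel_measurable_lebesgue_integral) (rule measurable_p_merge[OF assms])
qed

lemma marg_nonneg:
  assumes "T \<subseteq> J" "\<And>j. j \<in> T \<Longrightarrow> u j \<in> space (\<mu> j)"
  shows "0 \<le> marg T u"
  unfolding marg_J by (intro integral_nonneg_AE AE_I2 p_nonneg merge_in_letters assms) auto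

text \<open>If the section of p is not integrable, the Bochner integral takes its default value 0,
  so the inequality is trivial. A positive value thus certifies integrability, and then the two
  integrals agree.\<close>

lemma marg_le_g:
  assumes T: "T \<subseteq> J" and u: "\<And>j. j \<in> T \<Longrightarrow> u j \<in> space (\<mu> j)"
  shows "ennreal (marg T u) \<le> nnmarg T u" and "marg T u > 0 \<Longrightarrow> nnmarg T u = ennreal (marg T u)"
proof -
  have *: "nnmarg T u = ennreal (marg T u)" if "integrable (Pi\<^sub>M (J - T) \<mu>) (\<lambda>v. p (merge T (J - T) (u, v)))"
    unfolding nnmarg_def marg_J
    by (rule nn_integral_eq_integral[OF that]) (intro AE_I2 p_nonneg merge_in_letters assms; simp)
  show "ennreal (marg T u) \<le> nnmarg T u"
    using * by (cases "integrable (Pi\<^sub>M (J - T) \<mu>) (\<lambda>v. p (merge T (J - T) (u, v)))")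
      (auto simp: marg_J not_integrable_integral_eq)
  show "marg T u > 0 \<Longrightarrow> nnmarg T u = ennreal (marg T u)"
    using * by (cases "integrable (Pi\<^sub>M (J - T) \<mu>) (\<lambda>v. p (merge T (J - T) (u, v)))")
      (auto simp: marg_J not_integrable_integral_eq)
qed

text \<open>Tonelli for the coordinates in \<open>K\<close> and those outside
  \<open>T \<union> K\<close>; the value infinity is allowed, so no exceptional null set
  appears.\<close>

lemma nnmarg_fold:
  assumes TK: "T \<inter> K = {}" "T \<union> K \<subseteq> J" and u: "\<And>j. j \<in> T \<Longrightarrow> u j \<in> space (\<mu> j)"
  shows "(\<integral>\<^sup>+v. nnmarg (T \<union> K) (merge T K (u, v)) \<partial>Pi\<^sub>M K \<mu>) = nnmarg T u"
proof -
  define L where "L = J - (T \<union> K)"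
  have KL: "K \<inter> L = {}" "K \<union> L = J - T" "finite K" "finite L"
    using TK finite_subset_J[of K] by (auto simp: L_def)
  have m: "(\<lambda>v. ennreal (p (merge T (J - T) (u, v)))) \<in> borel_measurable (Pi\<^sub>M (K \<union> L) \<mu>)"
    unfolding KL using measurable_p_section[of T u] TK u by auto
  have eq: "merge (T \<union> K) L (merge T K (u, v), w) = merge T (J - T) (u, merge K L (v, w))" for v w
    using TK by (auto simp: merge_def fun_eq_iff L_def)
  show ?thesis
    unfolding nnmarg_def L_def[symmetric] eq
    unfolding KL(2)[symmetric]
    by (rule product_nn_integral_fold[OF KL(1,3,4), symmetric]) (use m KL(2) in simp)
qed

lemma nnmarg_full:
  assumes "u \<in> space (letters k \<mu>)"
  shows "nnmarg J u = ennreal (p u)"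
proof -
  have "merge J {} (u, \<lambda>_. undefined) = u"
    using assms by (auto simp: merge_def fun_eq_iff letters_J space_PiM PiE_def extensional_def)
  then show ?thesis by (simp add: nnmarg_def nn_integral_empty)
qed

section \<open>Marginal densities of blocks\<close>

lemma measurable_column:
  assumes "i \<in> {1..n}"
  shows "(\<lambda>u. \<lambda>j\<in>T. u j i) \<in> Pi\<^sub>M T (B n) \<rightarrow>\<^sub>M Pi\<^sub>M T \<mu>"
proof (rule measurable_restrict)
  fix j assume j: "j \<in> T"
  show "(\<lambda>u. u j i) \<in> Pi\<^sub>M T (B n) \<rightarrow>\<^sub>M \<mu> j"
    using measurable_compose[OF measurable_component_singleton[OF j, of "B n"], of "\<lambda>x. x i" "\<mu> j"] assms
    by (simp add: block_def)
qed

lemma nnblock_measurable: assumes "T \<subseteq> J" shows "nnblock n T \<in> borel_measurable (Pi\<^sub>M T (B n))"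
proof -
  have "(\<lambda>u. nnmarg T (\<lambda>j. u j i)) \<in> borel_measurable (Pi\<^sub>M T (B n))" if "i \<in> {1..n}" for i
  proof -
    have "nnmarg T (\<lambda>j. u j i) = nnmarg T (\<lambda>j\<in>T. u j i)" for u by (rule nnmarg_cong) auto
    then show ?thesis using measurable_compose[OF measurable_column[OF that] nnmarg_measurable[OF assms]] by simp
  qed
  then show ?thesis unfolding nnblock_def[abs_def] by measurable
qed

lemma marg_column_measurable:
  assumes "T' \<subseteq> T" "T \<subseteq> J" "i \<in> {1..n}"
  shows "(\<lambda>u. marg T' (\<lambda>j. u j i)) \<in> borel_measurable (Pi\<^sub>M T (B n))"
proof -
  have "marg T' (\<lambda>j. u j i) = marg T' (restrict (\<lambda>j\<in>T. u j i) T')" for u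
    by (rule marg_cong) (use assms in auto)
  moreover have "(\<lambda>u. marg T' (restrict (\<lambda>j\<in>T. u j i) T')) \<in> borel_measurable (Pi\<^sub>M T (B n))"
    using assms by (intro measurable_compose[OF measurable_column[OF assms(3)]]
      measurable_compose[OF measurable_restrict_subset[OF assms(1)]] marg_measurable) auto
  ultimately show ?thesis by simp
qed

lemma space_block: "x \<in> space (B n j) \<Longrightarrow> i \<in> {1..n} \<Longrightarrow> x i \<in> space (\<mu> j)"
  by (auto simp: block_def space_PiM)

lemma space_block_column:
  "u \<in> space (Pi\<^sub>M T (B n)) \<Longrightarrow> j \<in> T \<Longrightarrow> i \<in> {1..n} \<Longrightarrow> u j i \<in> space (\<mu> j)"
  by (auto simp: space_PiM intro!: space_block)

text \<open>After transposition the integrand is a product over time, so the letterwise identity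
  \<open>nnmarg_fold\<close> applies factor by factor.\<close>

lemma nnblock_fold:
  assumes TK: "T \<inter> K = {}" "T \<union> K \<subseteq> J" and u: "u \<in> space (Pi\<^sub>M T (B n))"
  shows "(\<integral>\<^sup>+v. nnblock n (T \<union> K) (merge T K (u, v)) \<partial>Pi\<^sub>M K (B n)) = nnblock n T u"
proof -
  have K: "finite K" using TK finite_subset_J[of K] by auto
  interpret L: product_sigma_finite "\<lambda>_::nat. Pi\<^sub>M K \<mu>"
    using sigma_finite[OF K] by (simp add: product_sigma_finite_def)
  have m: "(\<lambda>v. nnblock n (T \<union> K) (merge T K (u, v))) \<in> borel_measurable (Pi\<^sub>M K (B n))"
    using measurable_compose[OF measurable_Pair1'[OF u] measurable_compose[OF measurable_merge nnblock_measurable[OF TK(2)]]]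
    by simp
  have gm: "(\<lambda>v. nnmarg (T \<union> K) (merge T K (\<lambda>j. u j i, v))) \<in> borel_measurable (Pi\<^sub>M K \<mu>)" if "i \<in> {1..n}" for i
  proof -
    have "(\<lambda>j\<in>T. u j i) \<in> space (Pi\<^sub>M T \<mu>)"
      using space_block_column[OF u _ that] by (auto simp: space_PiM)
    from measurable_compose[OF measurable_Pair1'[OF this] measurable_compose[OF measurable_merge nnmarg_measurable[OF TK(2)]]]
    have "(\<lambda>v. nnmarg (T \<union> K) (merge T K (\<lambda>j\<in>T. u j i, v))) \<in> borel_measurable (Pi\<^sub>M K \<mu>)" .
    moreover have "nnmarg (T \<union> K) (merge T K (\<lambda>j\<in>T. u j i, v)) = nnmarg (T \<union> K) (merge T K (\<lambda>j. u j i, v))" for v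
      by (rule nnmarg_cong) (auto simp: merge_def)
    ultimately show ?thesis by simp
  qed
  have "(\<integral>\<^sup>+v. nnblock n (T \<union> K) (merge T K (u, v)) \<partial>Pi\<^sub>M K (B n)) =
    (\<integral>\<^sup>+w. nnblock n (T \<union> K) (merge T K (u, \<lambda>j\<in>K. \<lambda>i\<in>{1..n}. w i j)) \<partial>Pi\<^sub>M {1..n} (\<lambda>_. Pi\<^sub>M K \<mu>))"
    using nn_integral_transpose[OF K, of "{1..n}" "\<lambda>v. nnblock n (T \<union> K) (merge T K (u, v))"] m
    by (simp add: block_def[abs_def])
  also have "\<dots> = (\<integral>\<^sup>+w. (\<Prod>i=1..n. nnmarg (T \<union> K) (merge T K (\<lambda>j. u j i, w i))) \<partial>Pi\<^sub>M {1..n} (\<lambda>_. Pi\<^sub>M K \<mu>))"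
    unfolding nnblock_def by (intro nn_integral_cong prod.cong refl nnmarg_cong) (auto simp: merge_def)
  also have "\<dots> = (\<Prod>i=1..n. \<integral>\<^sup>+v. nnmarg (T \<union> K) (merge T K (\<lambda>j. u j i, v)) \<partial>Pi\<^sub>M K \<mu>)"
    by (rule L.product_nn_integral_prod) (use gm in auto)
  also have "\<dots> = nnblock n T u"
    unfolding nnblock_def using space_block_column[OF u] by (intro prod.cong refl nnmarg_fold TK) auto
  finally show ?thesis .
qed

section \<open>Conditional densities given the coordinate 0\<close>

lemma cond_marginal_measurable:
  assumes "j \<in> {1..k+1}"
  shows "(\<lambda>(x, y). cnd j x y) \<in> borel_measurable (\<mu> j \<Otimes>\<^sub>M \<mu> 0)"
proof -
  have "(\<lambda>z. \<lambda>i\<in>{0, j}. if i = 0 then snd z else fst z) \<in> \<mu> j \<Otimes>\<^sub>M \<mu> 0 \<rightarrow>\<^sub>M Pi\<^sub>M {0, j} \<mu>"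
    by (rule measurable_restrict) (use assms in auto)
  then have "(\<lambda>z. marg {0, j} (\<lambda>i\<in>{0, j}. if i = 0 then snd z else fst z)) \<in> borel_measurable (\<mu> j \<Otimes>\<^sub>M \<mu> 0)"
    by (rule measurable_compose) (use assms in \<open>auto intro!: marg_measurable\<close>)
  moreover have "(\<lambda>z. \<lambda>i\<in>{0}. snd z) \<in> \<mu> j \<Otimes>\<^sub>M \<mu> 0 \<rightarrow>\<^sub>M Pi\<^sub>M {0} \<mu>"
    by (rule measurable_restrict) auto
  then have "(\<lambda>z. marg {0} (\<lambda>i\<in>{0}. snd z)) \<in> borel_measurable (\<mu> j \<Otimes>\<^sub>M \<mu> 0)"
    by (rule measurable_compose) (auto intro!: marg_measurable)
  moreover have "cnd j x y = marg {0, j} (\<lambda>i\<in>{0, j}. if i = 0 then y else x) / marg {0} (\<lambda>i\<in>{0}. y)" for x y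
    unfolding cond_marginal_def by (intro arg_cong2[where f = "(/)"] marg_cong) auto
  ultimately show ?thesis by (simp add: split_beta)
qed

lemma cond_marginal_nonneg:
  assumes "j \<in> {1..k+1}" "x \<in> space (\<mu> j)" "y \<in> space (\<mu> 0)"
  shows "0 \<le> cnd j x y"
  unfolding cond_marginal_def by (intro divide_nonneg_nonneg marg_nonneg) (use assms in auto)

text \<open>Where p(u_0) = 0 the quotient is 0 by convention. Elsewhere the numerator is at most its
  extended counterpart, whose integral over u_j is p(u_0) by \<open>nnmarg_fold\<close>; it may be
  smaller at points where the integral defining the numerator diverges, so only an inequality is
  claimed.\<close>

lemma nn_integral_cond_marginal_le_1:
  assumes j: "j \<in> {1..k+1}" and y: "y \<in> space (\<mu> 0)"
  shows "(\<integral>\<^sup>+x. ennreal (cnd j x y) \<partial>\<mu> j) \<le> 1"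
proof (cases "marg {0} (\<lambda>i. y) > 0")
  case False
  then have "marg {0} (\<lambda>i. y) = 0" using marg_nonneg[of "{0}" "\<lambda>i. y"] y by simp
  then show ?thesis by (simp add: cond_marginal_def)
next
  case pos: True
  define c where "c = marg {0} (\<lambda>i. y)"
  have c: "c > 0" and gc: "nnmarg {0} (\<lambda>i. y) = ennreal c"
    using pos marg_le_g(2)[of "{0}" "\<lambda>i. y"] y by (auto simp: c_def)
  have "(\<lambda>v. \<lambda>i\<in>{0, j}. if i = 0 then y else v) \<in> \<mu> j \<rightarrow>\<^sub>M Pi\<^sub>M {0, j} \<mu>"
    by (rule measurable_restrict) (use y j in auto)
  then have m: "(\<lambda>v. nnmarg {0, j} (\<lambda>i\<in>{0, j}. if i = 0 then y else v)) \<in> borel_measurable (\<mu> j)"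
    by (rule measurable_compose) (use j in \<open>auto intro!: nnmarg_measurable\<close>)
  have r: "nnmarg {0, j} (\<lambda>i\<in>{0, j}. if i = 0 then y else v) = nnmarg {0, j} (\<lambda>i. if i = 0 then y else v)" for v
    by (rule nnmarg_cong) auto
  note m = m[unfolded r]
  have "(\<integral>\<^sup>+x. ennreal (cnd j x y) \<partial>\<mu> j) \<le> (\<integral>\<^sup>+x. ennreal (1 / c) * nnmarg {0, j} (\<lambda>i. if i = 0 then y else x) \<partial>\<mu> j)"
  proof (rule nn_integral_mono)
    fix x assume x: "x \<in> space (\<mu> j)"
    have "ennreal (cnd j x y) = ennreal (1 / c) * ennreal (marg {0, j} (\<lambda>i. if i = 0 then y else x))"
      using c by (simp add: cond_marginal_def c_def ennreal_mult'[symmetric])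
    also have "\<dots> \<le> ennreal (1 / c) * nnmarg {0, j} (\<lambda>i. if i = 0 then y else x)"
      by (intro mult_left_mono marg_le_g(1)) (use x y j in auto)
    finally show "ennreal (cnd j x y) \<le> ennreal (1 / c) * nnmarg {0, j} (\<lambda>i. if i = 0 then y else x)" .
  qed
  also have "\<dots> = ennreal (1 / c) * (\<integral>\<^sup>+x. nnmarg {0, j} (\<lambda>i. if i = 0 then y else x) \<partial>\<mu> j)"
    by (rule nn_integral_cmult[OF m])
  also have "(\<integral>\<^sup>+x. nnmarg {0, j} (\<lambda>i. if i = 0 then y else x) \<partial>\<mu> j) =
    (\<integral>\<^sup>+v. nnmarg {0, j} (\<lambda>i. if i = 0 then y else v j) \<partial>Pi\<^sub>M {j} \<mu>)"
    by (rule product_nn_integral_singleton[OF m, symmetric])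
  also have "\<dots> = (\<integral>\<^sup>+v. nnmarg ({0} \<union> {j}) (merge {0} {j} (\<lambda>i. y, v)) \<partial>Pi\<^sub>M {j} \<mu>)"
    unfolding insert_is_Un[symmetric] by (intro nn_integral_cong nnmarg_cong) (auto simp: merge_def)
  also have "\<dots> = ennreal c"
    by (subst nnmarg_fold) (use j y gc in auto)
  finally show ?thesis using c by (simp add: ennreal_mult'[symmetric])
qed

lemma cond_block_nonneg:
  assumes "j \<in> {1..k+1}" "x \<in> space (B n j)" "y \<in> space (B n 0)"
  shows "0 \<le> cond_block k \<mu> p n j x y"
  unfolding cond_block_def by (intro prod_nonneg ballI cond_marginal_nonneg) (use assms space_block in auto)

lemma cond_block_measurable:
  assumes "j \<in> {1..k+1}"
  shows "(\<lambda>(x, y). cond_block k \<mu> p n j x y) \<in> borel_measurable (B n j \<Otimes>\<^sub>M B n 0)"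
proof -
  have "(\<lambda>z. cnd j (fst z i) (snd z i)) \<in> borel_measurable (B n j \<Otimes>\<^sub>M B n 0)" if "i \<in> {1..n}" for i
  proof -
    have "(\<lambda>z. (fst z i, snd z i)) \<in> B n j \<Otimes>\<^sub>M B n 0 \<rightarrow>\<^sub>M \<mu> j \<Otimes>\<^sub>M \<mu> 0"
      unfolding block_def using that by measurable
    from measurable_compose[OF this cond_marginal_measurable[OF assms]] show ?thesis by simp
  qed
  then show ?thesis unfolding cond_block_def split_beta by measurable
qed

lemma nn_integral_cond_block_le_1:
  assumes j: "j \<in> {1..k+1}" and y: "y \<in> space (B n 0)"
  shows "(\<integral>\<^sup>+x. ennreal (cond_block k \<mu> p n j x y) \<partial>B n j) \<le> 1"
proof -
  interpret M: product_sigma_finite "\<lambda>_::nat. \<mu> j"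
    using sigma_finite_measures by (simp add: product_sigma_finite_def)
  have "(\<integral>\<^sup>+x. ennreal (cond_block k \<mu> p n j x y) \<partial>B n j) =
    (\<integral>\<^sup>+x. (\<Prod>i=1..n. ennreal (cnd j (x i) (y i))) \<partial>Pi\<^sub>M {1..n} (\<lambda>_. \<mu> j))"
    unfolding cond_block_def block_def
    by (intro nn_integral_cong prod_ennreal[symmetric] cond_marginal_nonneg j)
       (use y in \<open>auto simp: space_PiM block_def\<close>)
  also have "\<dots> = (\<Prod>i=1..n. \<integral>\<^sup>+x. ennreal (cnd j x (y i)) \<partial>\<mu> j)"
  proof (rule M.product_nn_integral_prod)
    fix i assume "i \<in> {1..n}"
    then have "y i \<in> space (\<mu> 0)" using y by (rule space_block[rotated])
    from measurable_compose[OF measurable_Pair2'[OF this] cond_marginal_measurable[OF j]]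
    show "(\<lambda>x. ennreal (cnd j x (y i))) \<in> borel_measurable (\<mu> j)" by simp
  qed simp
  also have "\<dots> \<le> 1"
    by (rule prod_le_1) (use nn_integral_cond_marginal_le_1[OF j] space_block[OF y] in auto)
  finally show ?thesis .
qed

end

section \<open>The typical set\<close>

locale joint_density_ent = joint_density \<mu> k p
  for \<mu> :: "nat \<Rightarrow> 'a symbol measure" and k p +
  assumes finite_ent: "\<And>T. T \<noteq> {} \<Longrightarrow> T \<subseteq> {0..k+1} \<Longrightarrow>
          integrable (density (letters k \<mu>) p) (\<lambda>u. ln (marginal k \<mu> p T u))"
  fixes \<delta> :: real
  assumes \<delta>: "\<delta> > 0"
begin

abbreviation "H \<equiv> ent k \<mu> p"

text \<open>Typicality of a subtuple, with conditions only for subsets of \<open>T\<close>. It is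
  inherited by restrictions, and sections of the typical set can be estimated for any pair of
  coordinate groups.\<close>

definition typset :: "nat \<Rightarrow> nat set \<Rightarrow> (nat \<Rightarrow> nat \<Rightarrow> 'a symbol) set" where
  "typset n T = {u \<in> space (Pi\<^sub>M T (B n)).
     \<forall>T'. T' \<noteq> {} \<and> T' \<subseteq> T \<longrightarrow>
       (\<forall>i\<in>{1..n}. marg T' (\<lambda>j. u j i) > 0) \<and>
       \<bar>- (1 / real n) * (\<Sum>i=1..n. ln (marg T' (\<lambda>j. u j i))) - H T'\<bar> < \<delta>}"

lemma typical_set_eq: "typical_set k \<mu> p \<delta> n = typset n J"
  by (simp add: typical_set_def typset_def)

lemma typset_restrict:
  assumes u: "u \<in> typset n T" and T: "T' \<subseteq> T"
  shows "restrict u T' \<in> typset n T'"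
proof -
  have e: "marg S (\<lambda>j. restrict u T' j i) = marg S (\<lambda>j. u j i)" if "S \<subseteq> T'" for S i
    by (rule marg_cong) (use that in auto)
  have "restrict u T' \<in> space (Pi\<^sub>M T' (B n))"
    using u T by (auto simp: typset_def space_PiM)
  then show ?thesis
    unfolding typset_def mem_Collect_eq
  proof (rule conjI, intro allI impI)
    fix S assume S: "S \<noteq> {} \<and> S \<subseteq> T'"
    then have "(\<forall>i\<in>{1..n}. marg S (\<lambda>j. u j i) > 0) \<and>
       \<bar>- (1 / real n) * (\<Sum>i=1..n. ln (marg S (\<lambda>j. u j i))) - H S\<bar> < \<delta>"
      using u T unfolding typset_def by blast
    then show "(\<forall>i\<in>{1..n}. marg S (\<lambda>j. restrict u T' j i) > 0) \<and>
       \<bar>- (1 / real n) * (\<Sum>i=1..n. ln (marg S (\<lambda>j. restrict u T' j i))) - H S\<bar> < \<delta>"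
      using e S by simp
  qed
qed

lemma typset_sets:
  assumes T: "T \<subseteq> J"
  shows "typset n T \<in> sets (Pi\<^sub>M T (B n))"
proof -
  have fin: "finite {S. S \<noteq> {} \<and> S \<subseteq> T}" using finite_subset_J[OF T] by simp
  have m[measurable]: "(\<lambda>u. marg S (\<lambda>j. u j i)) \<in> borel_measurable (Pi\<^sub>M T (B n))"
    if "S \<in> {S. S \<noteq> {} \<and> S \<subseteq> T}" "i \<in> {1..n}" for S i
    using that T by (intro marg_column_measurable) auto
  have "typset n T = {u \<in> space (Pi\<^sub>M T (B n)).
     \<forall>T'\<in>{S. S \<noteq> {} \<and> S \<subseteq> T}.
       (\<forall>i\<in>{1..n}. marg T' (\<lambda>j. u j i) > 0) \<and>
       \<bar>- (1 / real n) * (\<Sum>i=1..n. ln (marg T' (\<lambda>j. u j i))) - H T'\<bar> < \<delta>}"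
    unfolding typset_def by auto
  also have "\<dots> \<in> sets (Pi\<^sub>M T (B n))"
    using fin by measurable
  finally show ?thesis .
qed

text \<open>Typicality includes positivity of all marginals, so by \<open>marg_le_g\<close> the
  extended and the real block densities coincide here. This is the place where integrals of
  \<open>nnblock\<close> and the quotients of the theorem meet.\<close>

lemma typset_G:
  assumes u: "u \<in> typset n T" and T: "T \<subseteq> J" and S: "S \<noteq> {}" "S \<subseteq> T" and n: "n \<ge> 1"
  shows "mblock n S u > 0" and "nnblock n S u = ennreal (mblock n S u)"
    and "exp (- (real n * (H S + \<delta>))) \<le> mblock n S u" and "mblock n S u \<le> exp (- (real n * (H S - \<delta>)))"
proof -
  have pos: "marg S (\<lambda>j. u j i) > 0" if "i \<in> {1..n}" for i
    using u S that by (auto simp: typset_def)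
  then show p: "mblock n S u > 0" by (auto simp: mblock_def intro!: prod_pos)
  have sp: "u j i \<in> space (\<mu> j)" if "i \<in> {1..n}" "j \<in> S" for i j
    using space_block_column[of u T n j i] u that S by (auto simp: typset_def)
  have "nnblock n S u = (\<Prod>i=1..n. ennreal (marg S (\<lambda>j. u j i)))"
    unfolding nnblock_def by (intro prod.cong refl marg_le_g(2) pos) (use S T sp in auto)
  also have "\<dots> = ennreal (mblock n S u)"
    unfolding mblock_def by (rule prod_ennreal) (use pos less_imp_le in blast)
  finally show "nnblock n S u = ennreal (mblock n S u)" .
  have nz: "marg S (\<lambda>j. u j i) \<noteq> 0" if "i \<in> {1..n}" for i
    using pos[OF that] by simp
  have "ln (mblock n S u) = (\<Sum>i=1..n. ln (marg S (\<lambda>j. u j i)))"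
    unfolding mblock_def by (rule ln_prod[OF _ nz]) simp_all
  moreover have "\<bar>- (1 / real n) * (\<Sum>i=1..n. ln (marg S (\<lambda>j. u j i))) - H S\<bar> < \<delta>"
    using u S by (auto simp: typset_def)
  \<comment> \<open>The normalised log-density lies within \<delta> of - H(U_S). Recovering it from
    the logarithm requires division by n, hence n at least 1.\<close>
  moreover define a where "a = ln (mblock n S u) / real n"
  ultimately have "\<bar>- a - H S\<bar> < \<delta>" and "ln (mblock n S u) = real n * a" using n by auto
  then have l: "mblock n S u = exp (real n * a)" and a: "- (H S + \<delta>) \<le> a" "a \<le> - (H S - \<delta>)"
    using p exp_ln[OF p] by auto
  show "exp (- (real n * (H S + \<delta>))) \<le> mblock n S u"
    unfolding l using mult_left_mono[OF a(1), of "real n"] by (simp add: algebra_simps)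
  show "mblock n S u \<le> exp (- (real n * (H S - \<delta>)))"
    unfolding l using mult_left_mono[OF a(2), of "real n"] by (simp add: right_diff_distrib)
qed

lemma cond_block_eq_ratio:
  assumes j: "j \<in> {1..k+1}"
  shows "cond_block k \<mu> p n j (u j) (u 0) = mblock n {0, j} u / mblock n {0} u"
proof -
  have "cnd j (u j i) (u 0 i) = marg {0, j} (\<lambda>j. u j i) / marg {0} (\<lambda>j. u j i)" for i
    unfolding cond_marginal_def by (intro arg_cong2[where f = "(/)"] marg_cong) auto
  then show ?thesis by (simp add: cond_block_def mblock_def prod_dividef)
qed

text \<open>The conditional density is a quotient of two marginals, each known up to exp(n
  \<delta>). This is the origin of the 2 \<delta> paid for every codeword coordinate.\<close>

lemma typset_cond_block:
  assumes u: "u \<in> typset n T" and T: "T \<subseteq> J" "{0, j} \<subseteq> T" and n: "n \<ge> 1" and j: "j \<in> {1..k+1}"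
  shows "exp (- (real n * (cond_ent k \<mu> p {j} {0} + 2 * \<delta>))) \<le> cond_block k \<mu> p n j (u j) (u 0)"
    and "cond_block k \<mu> p n j (u j) (u 0) \<le> exp (- (real n * (cond_ent k \<mu> p {j} {0} - 2 * \<delta>)))"
proof -
  note a = typset_G[OF u T(1) _ T(2) n]
  note b = typset_G[OF u T(1) _ _ n, of "{0}"]
  have e: "cond_ent k \<mu> p {j} {0} = H {0, j} - H {0}"
    by (simp add: cond_ent_def insert_commute)
  have "exp (- (real n * (cond_ent k \<mu> p {j} {0} + 2 * \<delta>))) =
    exp (- (real n * (H {0, j} + \<delta>))) / exp (- (real n * (H {0} - \<delta>)))"
    by (simp add: e exp_diff[symmetric] algebra_simps)
  also have "\<dots> \<le> mblock n {0, j} u / mblock n {0} u"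
    by (rule frac_le) (use a b T in \<open>auto intro: less_imp_le\<close>)
  finally show "exp (- (real n * (cond_ent k \<mu> p {j} {0} + 2 * \<delta>))) \<le> cond_block k \<mu> p n j (u j) (u 0)"
    unfolding cond_block_eq_ratio[OF j] .
  have "mblock n {0, j} u / mblock n {0} u \<le> exp (- (real n * (H {0, j} - \<delta>))) / exp (- (real n * (H {0} + \<delta>)))"
    by (rule frac_le) (use a b T in \<open>auto intro: less_imp_le\<close>)
  also have "\<dots> = exp (- (real n * (cond_ent k \<mu> p {j} {0} - 2 * \<delta>)))"
    by (simp add: e exp_diff[symmetric] algebra_simps)
  finally show "cond_block k \<mu> p n j (u j) (u 0) \<le> exp (- (real n * (cond_ent k \<mu> p {j} {0} - 2 * \<delta>)))"
    unfolding cond_block_eq_ratio[OF j] .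
qed

text \<open>A density is positive almost surely under the law that it defines. This disposes of the
  positivity conditions in the typical set, about which the law of large numbers says
  nothing.\<close>

lemma AE_marg_pos:
  assumes T: "T \<subseteq> J"
  shows "AE u in density (letters k \<mu>) p. marg T u > 0"
proof -
  have D: "distributed (density (letters k \<mu>) p) (Pi\<^sub>M T \<mu>) (\<lambda>u. restrict u T) (marg T)"
    by (rule distributed_marginal[OF product_sigma_finite_axioms _ p_measurable p_nonneg p_prob]) (use T in simp_all)
  note [measurable] = marg_measurable[OF T]
  have "AE u in density (Pi\<^sub>M T \<mu>) (marg T). marg T u > 0"
    by (subst AE_density) (auto simp: ennreal_eq_0_iff not_le)
  then have "AE u in distr (density (letters k \<mu>) p) (Pi\<^sub>M T \<mu>) (\<lambda>u. restrict u T). marg T u > 0"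
    by (simp only: distributed_distr_eq_density[OF D])
  then have "AE u in density (letters k \<mu>) p. marg T (restrict u T) > 0"
    using D by (subst (asm) AE_distr_iff) (auto simp: distributed_def)
  moreover have "marg T (restrict u T) = marg T u" for u by (rule marg_cong) auto
  ultimately show ?thesis by simp
qed

lemma nnblock_full:
  assumes w: "w \<in> space (Pi\<^sub>M {1..n} (\<lambda>_. letters k \<mu>))"
  shows "nnblock n J (\<lambda>j\<in>J. \<lambda>i\<in>{1..n}. w i j) = (\<Prod>i=1..n. ennreal (p (w i)))"
  unfolding nnblock_def
proof (rule prod.cong[OF refl])
  fix i assume i: "i \<in> {1..n}"
  have "nnmarg J (\<lambda>j. (\<lambda>j\<in>J. \<lambda>i\<in>{1..n}. w i j) j i) = nnmarg J (w i)"
    by (rule nnmarg_cong) (use i in auto)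
  then show "nnmarg J (\<lambda>j. (\<lambda>j\<in>J. \<lambda>i\<in>{1..n}. w i j) j i) = ennreal (p (w i))"
    using w i by (simp add: nnmarg_full space_PiM PiE_iff)
qed

text \<open>The integral is the probability that n independent letters drawn from p form an atypical
  tuple of blocks. It is at most the sum, over the finitely many nonempty \<open>T\<close>, of the
  deviation probabilities for averages of - ln p(U_T).\<close>

lemma nn_integral_atypical_tendsto_0:
  "(\<lambda>n. \<integral>\<^sup>+u. nnblock n J u * indicator (- typset n J) u \<partial>Pi\<^sub>M J (B n)) \<longlonglongrightarrow> 0"
proof -
  define P where "P = density (letters k \<mu>) p"
  interpret P: prob_space P using p_prob by (simp add: P_def)
  define Pn where "Pn n = Pi\<^sub>M {1..n::nat} (\<lambda>_. P)" for n
  interpret Pn: prob_space "Pn n" for n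
    unfolding Pn_def by (intro prob_space_PiM P.prob_space_axioms)
  have spP: "space P = space (letters k \<mu>)" "sets P = sets (letters k \<mu>)" by (auto simp: P_def)
  have sPn: "sets (Pn n) = sets (Pi\<^sub>M {1..n} (\<lambda>_. letters k \<mu>))" for n
    unfolding Pn_def by (intro sets_PiM_cong refl) (simp add: spP)
  have spPn: "space (Pn n) = space (Pi\<^sub>M {1..n} (\<lambda>_. letters k \<mu>))" for n
    using sets_eq_imp_space_eq[OF sPn] .
  have PnD: "Pn n = density (Pi\<^sub>M {1..n} (\<lambda>_. letters k \<mu>)) (\<lambda>w. \<Prod>i\<in>{1..n}. ennreal (p (w i)))" for n
    unfolding Pn_def P_def
  proof (rule PiM_density[OF sigma_finite_letters])
    show "product_sigma_finite (\<lambda>_::nat. density (letters k \<mu>) (\<lambda>x. ennreal (p x)))"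
      using P.sigma_finite_measure_axioms by (simp add: product_sigma_finite_def P_def)
  qed (use p_measurable in auto)
  define S where "S = {T. T \<noteq> {} \<and> T \<subseteq> J}"
  have finS: "finite S" by (simp add: S_def)
  define bad where "bad T n = {w \<in> space (Pn n). \<bar>(1 / real n) * (\<Sum>i=1..n. - ln (marg T (w i))) - P.expectation (\<lambda>u. - ln (marg T u))\<bar> \<ge> \<delta>}" for T n
  have HT: "P.expectation (\<lambda>u. - ln (marg T u)) = H T" for T
    by (simp add: ent_def P_def)
  have le: "(\<integral>\<^sup>+u. nnblock n J u * indicator (- typset n J) u \<partial>Pi\<^sub>M J (B n)) \<le> ennreal (\<Sum>T\<in>S. Pn.prob n (bad T n))" for n
  proof -
    define tr where "tr w = (\<lambda>j\<in>J. \<lambda>i\<in>{1..n}. w i j)" for w :: "nat \<Rightarrow> nat \<Rightarrow> 'a symbol"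
    have trm[measurable]: "tr \<in> Pn n \<rightarrow>\<^sub>M Pi\<^sub>M J (B n)"
      unfolding measurable_cong_sets[OF sPn refl] letters_J block_def[abs_def] tr_def[abs_def]
      by (rule measurable_transpose)
    have [measurable]: "typset n J \<in> sets (Pi\<^sub>M J (B n))" by (rule typset_sets) simp
    have [measurable]: "nnblock n J \<in> borel_measurable (Pi\<^sub>M J (B n))" by (rule nnblock_measurable) simp
    have badm[measurable]: "bad T n \<in> sets (Pn n)" if "T \<in> S" for T
    proof -
      have "marg T \<in> borel_measurable P"
      proof -
        have "(\<lambda>u. marg T (restrict u T)) \<in> borel_measurable P"
          using that unfolding measurable_cong_sets[OF spP(2) refl] letters_J S_def
          by (intro measurable_compose[OF measurable_restrict_subset] marg_measurable) auto
        moreover have "marg T (restrict u T) = marg T u" for u by (rule marg_cong) auto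
        ultimately show ?thesis by simp
      qed
      then have "(\<lambda>w. marg T (w i)) \<in> borel_measurable (Pn n)" if "i \<in> {1..n}" for i
        unfolding Pn_def using measurable_component_singleton[OF that, of "\<lambda>_. P"] by (rule measurable_compose[rotated])
      then show ?thesis unfolding bad_def by measurable
    qed
    have fm: "(\<lambda>u. nnblock n J u * indicator (- typset n J) u) \<in> borel_measurable (Pi\<^sub>M J (B n))"
      by measurable
    have "(\<integral>\<^sup>+u. nnblock n J u * indicator (- typset n J) u \<partial>Pi\<^sub>M J (B n)) =
      (\<integral>\<^sup>+w. nnblock n J (tr w) * indicator (- typset n J) (tr w) \<partial>Pi\<^sub>M {1..n} (\<lambda>_. letters k \<mu>))"
      using nn_integral_transpose[OF _ _ fm[unfolded block_def[abs_def]]] by (simp add: block_def[abs_def] tr_def letters_J)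
    also have "\<dots> = (\<integral>\<^sup>+w. (\<Prod>i\<in>{1..n}. ennreal (p (w i))) * indicator {w \<in> space (Pn n). tr w \<notin> typset n J} w \<partial>Pi\<^sub>M {1..n} (\<lambda>_. letters k \<mu>))"
      unfolding tr_def by (intro nn_integral_cong) (auto simp: nnblock_full[simplified] spPn indicator_def)
    also have "\<dots> = emeasure (Pn n) {w \<in> space (Pn n). tr w \<notin> typset n J}"
    proof -
      have "{w \<in> space (Pn n). tr w \<notin> typset n J} \<in> sets (Pn n)"
        using measurable_sets[OF trm, of "space (Pi\<^sub>M J (B n)) - typset n J"] measurable_space[OF trm]
        by (auto simp: vimage_def Int_def conj_commute cong: conj_cong)
      moreover have "(\<lambda>w. \<Prod>i\<in>{1..n}. ennreal (p (w i))) \<in> borel_measurable (Pi\<^sub>M {1..n} (\<lambda>_. letters k \<mu>))"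
        using p_measurable by measurable
      moreover have "emeasure (Pn n) A = emeasure (density (Pi\<^sub>M {1..n} (\<lambda>_. letters k \<mu>)) (\<lambda>w. \<Prod>i\<in>{1..n}. ennreal (p (w i)))) A" for A
        by (simp only: PnD[symmetric])
      ultimately show ?thesis by (simp only: emeasure_density sPn)
    qed
    \<comment> \<open>Atypicality may also come from a vanishing marginal, so the inclusion in the
      bad events holds only almost everywhere.\<close>
    also have "\<dots> \<le> emeasure (Pn n) (\<Union>T\<in>S. bad T n)"
    proof (rule emeasure_mono_AE)
      have "AE w in Pn n. marg T (w i) > 0" if "T \<in> S" "i \<in> {1..n}" for T i
        unfolding Pn_def
        by (rule AE_PiM_component[where P = "\<lambda>u. marg T u > 0"])
           (use that AE_marg_pos[of T, folded P_def] P.prob_space_axioms in \<open>auto simp: S_def\<close>)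
      then have "AE w in Pn n. \<forall>T\<in>S. \<forall>i\<in>{1..n}. marg T (w i) > 0"
        by (simp add: AE_finite_all finS)
      then show "AE w in Pn n. w \<in> {w \<in> space (Pn n). tr w \<notin> typset n J} \<longrightarrow> w \<in> (\<Union>T\<in>S. bad T n)"
      proof (rule AE_mp, intro AE_I2 impI)
        fix w assume w: "w \<in> space (Pn n)" and pos: "\<forall>T\<in>S. \<forall>i\<in>{1..n}. marg T (w i) > 0"
          and "w \<in> {w \<in> space (Pn n). tr w \<notin> typset n J}"
        then have nt: "tr w \<notin> typset n J" by simp
        have tw: "tr w \<in> space (Pi\<^sub>M J (B n))" using measurable_space[OF trm w] .
        have e: "marg T (\<lambda>j. tr w j i) = marg T (w i)" if "T \<in> S" "i \<in> {1..n}" for T i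
          by (rule marg_cong) (use that in \<open>auto simp: tr_def S_def\<close>)
        from nt tw obtain T where "T \<noteq> {}" "T \<subseteq> J" and
          n: "\<not> ((\<forall>i\<in>{1..n}. marg T (\<lambda>j. tr w j i) > 0) \<and>
            \<bar>- (1 / real n) * (\<Sum>i=1..n. ln (marg T (\<lambda>j. tr w j i))) - H T\<bar> < \<delta>)"
          unfolding typset_def by blast
        then have T: "T \<in> S" by (simp add: S_def)
        have "(\<Sum>i=1..n. ln (marg T (\<lambda>j. tr w j i))) = (\<Sum>i=1..n. ln (marg T (w i)))"
          by (intro sum.cong refl arg_cong[where f = ln] e T)
        then have "\<not> \<bar>- (1 / real n) * (\<Sum>i=1..n. ln (marg T (w i))) - H T\<bar> < \<delta>"
          using n e[OF T] pos T by auto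
        then have "w \<in> bad T n"
          using w unfolding bad_def HT by (simp add: sum_negf)
        then show "w \<in> (\<Union>T\<in>S. bad T n)" using T by auto
      qed
    qed (rule sets.finite_UN[OF finS badm])
    also have "\<dots> = ennreal (Pn.prob n (\<Union>T\<in>S. bad T n))" by (rule Pn.emeasure_eq_measure)
    also have "\<dots> \<le> ennreal (\<Sum>T\<in>S. Pn.prob n (bad T n))"
      by (intro ennreal_leI Pn.finite_measure_subadditive_finite finS) auto
    finally show ?thesis .
  qed
  have "(\<lambda>n. \<Sum>T\<in>S. Pn.prob n (bad T n)) \<longlonglongrightarrow> (\<Sum>T\<in>S. 0)"
  proof (rule tendsto_sum)
    fix T assume "T \<in> S"
    then have "integrable P (\<lambda>u. - ln (marg T u))"
      using finite_ent[of T] by (auto simp: S_def P_def)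
    from P.weak_law_of_large_numbers[OF this \<delta>]
    show "(\<lambda>n. Pn.prob n (bad T n)) \<longlonglongrightarrow> 0" by (simp add: bad_def Pn_def)
  qed
  then have "(\<lambda>n. ennreal (\<Sum>T\<in>S. Pn.prob n (bad T n))) \<longlonglongrightarrow> 0"
    using tendsto_ennrealI by fastforce
  from tendsto_sandwich[OF _ _ tendsto_const this] show ?thesis using le by simp
qed

section \<open>Sections of the typical set\<close>

lemma exp_minus_sum: "finite K \<Longrightarrow> exp (- (c * (\<Sum>j\<in>K. f j))) = (\<Prod>j\<in>K. exp (- (c * f j :: real)))"
  by (simp add: sum_distrib_left sum_negf[symmetric] exp_sum)

abbreviation "L \<equiv> {0, Suc k}"

definition cond_prod :: "nat \<Rightarrow> nat set \<Rightarrow> (nat \<Rightarrow> nat \<Rightarrow> 'a symbol) \<Rightarrow> ennreal" where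
  "cond_prod n S u = (\<Prod>j\<in>S. ennreal (cond_block k \<mu> p n j (u j) (u 0)))"

lemma cond_prod_cong: "(\<And>j. j \<in> insert 0 S \<Longrightarrow> u j = u' j) \<Longrightarrow> cond_prod n S u = cond_prod n S u'"
  by (simp add: cond_prod_def)

lemma cond_prod_union:
  "finite S \<Longrightarrow> finite S' \<Longrightarrow> S \<inter> S' = {} \<Longrightarrow> cond_prod n (S \<union> S') u = cond_prod n S u * cond_prod n S' u"
  by (simp add: cond_prod_def prod.union_disjoint)

lemma subset_J_minus_0:
  assumes "K \<subseteq> J" "0 \<notin> K"
  shows "K \<subseteq> {1..k+1}"
proof
  fix j assume "j \<in> K"
  then have "j \<in> J" "j \<noteq> 0" using assms by (blast, metis)
  then show "j \<in> {1..k+1}" by auto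
qed

lemma cond_block_measurable_PiM:
  assumes "j \<in> {1..Suc k}" "j \<in> T" "0 \<in> T"
  shows "(\<lambda>u. cond_block k \<mu> p n j (u j) (u 0)) \<in> borel_measurable (Pi\<^sub>M T (B n))"
proof -
  have "(\<lambda>u. (u j, u 0)) \<in> Pi\<^sub>M T (B n) \<rightarrow>\<^sub>M B n j \<Otimes>\<^sub>M B n 0"
    using assms by (intro measurable_Pair measurable_component_singleton) auto
  from measurable_compose[OF this cond_block_measurable] show ?thesis using assms by simp
qed

lemma cond_prod_measurable:
  assumes "S \<subseteq> {1..Suc k}" "S \<subseteq> T" "0 \<in> T"
  shows "cond_prod n S \<in> borel_measurable (Pi\<^sub>M T (B n))"
proof -
  have [measurable]: "(\<lambda>u. cond_block k \<mu> p n j (u j) (u 0)) \<in> borel_measurable (Pi\<^sub>M T (B n))" if "j \<in> S" for j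
    by (rule cond_block_measurable_PiM) (use assms that in auto)
  show ?thesis unfolding cond_prod_def[abs_def] by measurable
qed

lemma nn_integral_cond_prod_le_1:
  assumes TK: "T \<inter> K = {}" "0 \<in> T" "T \<union> K \<subseteq> J" and x: "x \<in> space (Pi\<^sub>M T (B n))"
  shows "(\<integral>\<^sup>+v. cond_prod n K (merge T K (x, v)) \<partial>Pi\<^sub>M K (B n)) \<le> 1"
proof -
  interpret Bn: product_sigma_finite "B n" by (rule product_sigma_finite_block)
  have K: "K \<subseteq> {1..k+1}" "finite K" using TK finite_subset_J[of K] subset_J_minus_0[of K] by blast+
  have x0: "x 0 \<in> space (B n 0)" using x TK by (auto simp: space_PiM)
  have "(\<integral>\<^sup>+v. cond_prod n K (merge T K (x, v)) \<partial>Pi\<^sub>M K (B n)) =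
    (\<integral>\<^sup>+v. (\<Prod>j\<in>K. ennreal (cond_block k \<mu> p n j (v j) (x 0))) \<partial>Pi\<^sub>M K (B n))"
    unfolding cond_prod_def using TK by (intro nn_integral_cong prod.cong) (auto simp: merge_def)
  also have "\<dots> = (\<Prod>j\<in>K. \<integral>\<^sup>+y. ennreal (cond_block k \<mu> p n j y (x 0)) \<partial>B n j)"
  proof (rule Bn.product_nn_integral_prod[OF K(2)])
    fix j assume "j \<in> K"
    then have "j \<in> {1..k+1}" using K by auto
    from measurable_compose[OF measurable_Pair2'[OF x0] cond_block_measurable[OF this]]
    show "(\<lambda>y. ennreal (cond_block k \<mu> p n j y (x 0))) \<in> borel_measurable (B n j)" by simp
  qed
  also have "\<dots> \<le> 1"
    by (rule prod_le_1) (use nn_integral_cond_block_le_1[OF _ x0] K in auto)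
  finally show ?thesis .
qed

lemma merge_space_block:
  assumes "x \<in> space (Pi\<^sub>M T (B n))" "v \<in> space (Pi\<^sub>M K (B n))"
  shows "merge T K (x, v) \<in> space (Pi\<^sub>M (T \<union> K) (B n))"
  using measurable_space[OF measurable_merge, of "(x, v)" T "B n" K] assms by (simp add: space_pair_measure)

lemma measurable_merge_section:
  assumes "x \<in> space (Pi\<^sub>M T (B n))" "f \<in> borel_measurable (Pi\<^sub>M (T \<union> K) (B n))"
  shows "(\<lambda>v. f (merge T K (x, v))) \<in> borel_measurable (Pi\<^sub>M K (B n))"
  using measurable_compose[OF measurable_Pair1'[OF assms(1)] measurable_compose[OF measurable_merge assms(2)]] .

lemma cond_prod_typset:
  assumes u: "u \<in> typset n T" and T: "T \<subseteq> J" "K \<subseteq> T" "0 \<in> T" "0 \<notin> K" and n: "n \<ge> 1"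
  obtains c where "cond_prod n K u = ennreal c"
    "exp (- (real n * (\<Sum>j\<in>K. cond_ent k \<mu> p {j} {0} + 2 * \<delta>))) \<le> c"
    "c \<le> exp (- (real n * (\<Sum>j\<in>K. cond_ent k \<mu> p {j} {0} - 2 * \<delta>)))"
proof -
  have K: "finite K" "K \<subseteq> {1..k+1}"
    using finite_subset_J[of K] subset_J_minus_0[of K] T by blast+
  define c where "c = (\<Prod>j\<in>K. cond_block k \<mu> p n j (u j) (u 0))"
  note b = typset_cond_block[OF u T(1) _ n]
  have sp: "u j \<in> space (B n j)" if "j \<in> T" for j
    using u that by (auto simp: typset_def space_PiM)
  show ?thesis
  proof (rule that)
    show "cond_prod n K u = ennreal c"
      unfolding cond_prod_def c_def by (rule prod_ennreal) (use K T sp in \<open>auto intro!: cond_block_nonneg\<close>)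
    show "exp (- (real n * (\<Sum>j\<in>K. cond_ent k \<mu> p {j} {0} + 2 * \<delta>))) \<le> c"
      unfolding exp_minus_sum[OF K(1)] c_def by (intro prod_mono conjI b(1)) (use K T in auto)
    show "c \<le> exp (- (real n * (\<Sum>j\<in>K. cond_ent k \<mu> p {j} {0} - 2 * \<delta>)))"
      unfolding exp_minus_sum[OF K(1)] c_def
      by (intro prod_mono conjI b(2) cond_block_nonneg) (use K T sp in auto)
  qed
qed

text \<open>The sum of H(U_j|U_0) over \<open>K\<close> minus H(U_K|U_T): the exponential cost for
  codewords drawn independently given u_0 to complete a typical tuple on \<open>T\<close>. For
  \<open>T = L\<close> and \<open>K = S\<close> it is the entropy expression in the theorem.\<close>

definition rate :: "nat set \<Rightarrow> nat set \<Rightarrow> real" where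
  "rate T K = (\<Sum>j\<in>K. cond_ent k \<mu> p {j} {0}) - (H (T \<union> K) - H T)"

text \<open>Change of measure: on the typical set the drawing density \<open>cond_prod\<close> is at
  most the claimed bound times the true conditional density
  \<open>nnblock n (T \<union> K) / m\<close>, whose integral over the \<open>K\<close> coordinates
  is 1. The slack is 2 \<delta> for each coordinate in \<open>K\<close> and one \<delta> for each of
  the marginals on \<open>T\<close> and \<open>T \<union> K\<close>.\<close>

lemma section_upper_bound:
  assumes TK: "T \<inter> K = {}" "0 \<in> T" "T \<union> K \<subseteq> J" and x: "x \<in> space (Pi\<^sub>M T (B n))" and n: "n \<ge> 1"
  shows "(\<integral>\<^sup>+v. indicator (typset n (T \<union> K)) (merge T K (x, v)) * cond_prod n K (merge T K (x, v)) \<partial>Pi\<^sub>M K (B n))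
    \<le> ennreal (exp (- (real n * (rate T K - 2 * (real (card K) + 1) * \<delta>))))"
    (is "?I \<le> ennreal ?E")
\<comment> \<open>\<open>x\<close> is not assumed typical. One typical completion suffices to make
  its density \<open>m\<close> positive and finite; without any, the integrand vanishes.\<close>
proof (cases "\<exists>v\<in>space (Pi\<^sub>M K (B n)). merge T K (x, v) \<in> typset n (T \<union> K)")
  case False
  then have "?I = (\<integral>\<^sup>+v. 0 \<partial>Pi\<^sub>M K (B n))" by (intro nn_integral_cong) auto
  then show ?thesis by simp
next
  case True
  have T: "T \<noteq> {}" "T \<subseteq> T \<union> K" "T \<union> K \<noteq> {}" using TK by auto
  define m where "m = mblock n T x"
  have mx: "mblock n T (merge T K (x, v)) = m" "nnblock n T (merge T K (x, v)) = nnblock n T x" for v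
    unfolding m_def by (intro mblock_cong nnblock_cong; simp add: merge_def)+
  from True obtain v0 where v0: "merge T K (x, v0) \<in> typset n (T \<union> K)" by auto
  note a = typset_G[OF v0 TK(3) T(1,2) n, unfolded mx]
  have le: "indicator (typset n (T \<union> K)) (merge T K (x, v)) * cond_prod n K (merge T K (x, v))
      \<le> ennreal (?E / m) * nnblock n (T \<union> K) (merge T K (x, v))" for v
  proof (cases "merge T K (x, v) \<in> typset n (T \<union> K)")
    case u: True
    define M where "M = mblock n (T \<union> K) (merge T K (x, v))"
    note b = typset_G[OF u TK(3) T(3) order_refl n, folded M_def]
    obtain c where c: "cond_prod n K (merge T K (x, v)) = ennreal c"
      "c \<le> exp (- (real n * (\<Sum>j\<in>K. cond_ent k \<mu> p {j} {0} - 2 * \<delta>)))"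
      by (rule cond_prod_typset[OF u TK(3) _ _ _ n, of K]) (use TK in auto)
    have "c \<le> exp (- (real n * (\<Sum>j\<in>K. cond_ent k \<mu> p {j} {0} - 2 * \<delta>)))" by (rule c)
    also have "\<dots> = ?E / exp (- (real n * (H T - \<delta>))) * exp (- (real n * (H (T \<union> K) + \<delta>)))"
      by (simp add: exp_diff[symmetric] exp_add[symmetric] rate_def sum_subtractf algebra_simps)
    also have "\<dots> \<le> ?E / m * M"
      by (intro mult_mono divide_left_mono mult_pos_pos) (use a b in auto)
    finally have "ennreal c \<le> ennreal (?E / m) * ennreal M"
      using a b by (subst ennreal_mult'[symmetric]) (auto intro!: ennreal_leI)
    then show ?thesis using u by (simp add: c b)
  qed simp
  have "?I \<le> (\<integral>\<^sup>+v. ennreal (?E / m) * nnblock n (T \<union> K) (merge T K (x, v)) \<partial>Pi\<^sub>M K (B n))"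
    by (intro nn_integral_mono le)
  also have "\<dots> = ennreal (?E / m) * (\<integral>\<^sup>+v. nnblock n (T \<union> K) (merge T K (x, v)) \<partial>Pi\<^sub>M K (B n))"
    by (intro nn_integral_cmult measurable_merge_section[OF x] nnblock_measurable TK)
  also have "\<dots> = ennreal (?E / m) * ennreal m"
    by (simp only: nnblock_fold[OF TK(1,3) x] a)
  also have "\<dots> = ennreal ?E" using a by (subst ennreal_mult'[symmetric]) auto
  finally show ?thesis .
qed

text \<open>The conditional probability that a tuple is typical, given the blocks \<open>w\<close> at the
  coordinates \<open>0\<close> and \<open>k + 1\<close>; \<open>w\<close> is good if more than half of the true conditional
  distribution of the remaining coordinates is typical.\<close>

definition hit_prob :: "nat \<Rightarrow> (nat \<Rightarrow> nat \<Rightarrow> 'a symbol) \<Rightarrow> ennreal" where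
  "hit_prob n w = (\<integral>\<^sup>+u. indicator (typset n J) (merge L {1..k} (w, u)) * cond_prod n {1..k} (merge L {1..k} (w, u)) \<partial>Pi\<^sub>M {1..k} (B n))"

definition good :: "nat \<Rightarrow> (nat \<Rightarrow> nat \<Rightarrow> 'a symbol) set" where
  "good n = {w \<in> space (Pi\<^sub>M L (B n)).
     (\<integral>\<^sup>+u. nnblock n J (merge L {1..k} (w, u)) * indicator (- typset n J) (merge L {1..k} (w, u)) \<partial>Pi\<^sub>M {1..k} (B n))
     < (\<integral>\<^sup>+u. nnblock n J (merge L {1..k} (w, u)) * indicator (typset n J) (merge L {1..k} (w, u)) \<partial>Pi\<^sub>M {1..k} (B n))}"

lemma L_Un: "L \<union> {1..k} = J" "L \<inter> {1..k} = {}"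
  by auto

lemma merge_measurable_L:
  assumes "f \<in> borel_measurable (Pi\<^sub>M J (B n))"
  shows "(\<lambda>w. \<integral>\<^sup>+u. f (merge L {1..k} (w, u)) \<partial>Pi\<^sub>M {1..k} (B n)) \<in> borel_measurable (Pi\<^sub>M L (B n))"
proof -
  interpret Bn: product_sigma_finite "B n" by (rule product_sigma_finite_block)
  interpret S: sigma_finite_measure "Pi\<^sub>M {1..k} (B n)" by (rule Bn.sigma_finite) simp
  have "f \<in> borel_measurable (Pi\<^sub>M (L \<union> {1..k}) (B n))" using assms by (simp only: L_Un)
  from measurable_compose[OF measurable_merge this]
  show ?thesis by (intro S.borel_measurable_nn_integral) (simp add: split_beta)
qed

lemma nn_integral_fold_L:
  assumes "f \<in> borel_measurable (Pi\<^sub>M J (B n))"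
  shows "(\<integral>\<^sup>+u. f u \<partial>Pi\<^sub>M J (B n)) = (\<integral>\<^sup>+w. \<integral>\<^sup>+u. f (merge L {1..k} (w, u)) \<partial>Pi\<^sub>M {1..k} (B n) \<partial>Pi\<^sub>M L (B n))"
proof -
  interpret Bn: product_sigma_finite "B n" by (rule product_sigma_finite_block)
  show ?thesis
    using Bn.product_nn_integral_fold[OF L_Un(2), of f] assms by (simp only: L_Un) simp
qed

lemma typset_J_sets[measurable]: "typset n J \<in> sets (Pi\<^sub>M J (B n))"
  by (rule typset_sets) simp

lemma nnblock_J_measurable[measurable]: "nnblock n J \<in> borel_measurable (Pi\<^sub>M J (B n))"
  by (rule nnblock_measurable) simp

lemma cond_prod_J_measurable[measurable]: "cond_prod n {1..k} \<in> borel_measurable (Pi\<^sub>M J (B n))"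
  by (rule cond_prod_measurable) auto

lemma hit_prob_measurable[measurable]: "hit_prob n \<in> borel_measurable (Pi\<^sub>M L (B n))"
  unfolding hit_prob_def[abs_def]
  by (rule merge_measurable_L[where f = "\<lambda>x. indicator (typset n J) x * cond_prod n {1..k} x"]) measurable

lemma good_sets[measurable]: "good n \<in> sets (Pi\<^sub>M L (B n))"
proof -
  have [measurable]: "(\<lambda>w. \<integral>\<^sup>+u. nnblock n J (merge L {1..k} (w, u)) * indicator (- typset n J) (merge L {1..k} (w, u)) \<partial>Pi\<^sub>M {1..k} (B n)) \<in> borel_measurable (Pi\<^sub>M L (B n))"
    "(\<lambda>w. \<integral>\<^sup>+u. nnblock n J (merge L {1..k} (w, u)) * indicator (typset n J) (merge L {1..k} (w, u)) \<partial>Pi\<^sub>M {1..k} (B n)) \<in> borel_measurable (Pi\<^sub>M L (B n))"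
    by (rule merge_measurable_L[where f = "\<lambda>x. nnblock n J x * indicator _ x"], measurable)+
  show ?thesis unfolding good_def by measurable
qed

lemma hit_prob_le_1: assumes w: "w \<in> space (Pi\<^sub>M L (B n))" shows "hit_prob n w \<le> 1"
proof -
  have "hit_prob n w \<le> (\<integral>\<^sup>+u. cond_prod n {1..k} (merge L {1..k} (w, u)) \<partial>Pi\<^sub>M {1..k} (B n))"
    unfolding hit_prob_def by (intro nn_integral_mono) (auto simp: indicator_def)
  also have "\<dots> \<le> 1" by (rule nn_integral_cond_prod_le_1) (use w in auto)
  finally show ?thesis .
qed

lemma nnblock_L_split:
  assumes w: "w \<in> space (Pi\<^sub>M L (B n))"
  shows "nnblock n L w = (\<integral>\<^sup>+u. nnblock n J (merge L {1..k} (w, u)) * indicator (typset n J) (merge L {1..k} (w, u)) \<partial>Pi\<^sub>M {1..k} (B n))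
    + (\<integral>\<^sup>+u. nnblock n J (merge L {1..k} (w, u)) * indicator (- typset n J) (merge L {1..k} (w, u)) \<partial>Pi\<^sub>M {1..k} (B n))"
proof -
  have "nnblock n L w = (\<integral>\<^sup>+u. nnblock n (L \<union> {1..k}) (merge L {1..k} (w, u)) \<partial>Pi\<^sub>M {1..k} (B n))"
    by (rule nnblock_fold[symmetric]) (use w in auto)
  also have "\<dots> = (\<integral>\<^sup>+u. nnblock n J (merge L {1..k} (w, u)) * indicator (typset n J) (merge L {1..k} (w, u)) +
    nnblock n J (merge L {1..k} (w, u)) * indicator (- typset n J) (merge L {1..k} (w, u)) \<partial>Pi\<^sub>M {1..k} (B n))"
    unfolding L_Un by (intro nn_integral_cong) (auto simp: indicator_def)
  also have "\<dots> = (\<integral>\<^sup>+u. nnblock n J (merge L {1..k} (w, u)) * indicator (typset n J) (merge L {1..k} (w, u)) \<partial>Pi\<^sub>M {1..k} (B n))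
    + (\<integral>\<^sup>+u. nnblock n J (merge L {1..k} (w, u)) * indicator (- typset n J) (merge L {1..k} (w, u)) \<partial>Pi\<^sub>M {1..k} (B n))"
    by (rule nn_integral_add; rule measurable_merge_section[OF w, where f = "\<lambda>x. nnblock n J x * indicator _ x"];
      simp only: L_Un; measurable)
  finally show ?thesis .
qed

text \<open>The change of measure in the opposite direction: on the typical set the true density is
  at most \<open>m * E\<close> times the drawing density. Goodness says that typical completions
  carry at least half of the true mass \<open>m\<close>, which is where the factor 1/2 comes from.
  The slack 2 (k + 1) \<delta> counts the k codewords and the marginals on \<open>J\<close> and
  \<open>L\<close>.\<close>

lemma hit_prob_lower_bound:
  assumes w: "w \<in> good n" and n: "n \<ge> 1"
  shows "ennreal (exp (- (real n * (rate L {1..k} + 2 * (real k + 1) * \<delta>))) / 2) \<le> hit_prob n w"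
proof -
  define E where "E = exp (real n * (rate L {1..k} + 2 * (real k + 1) * \<delta>))"
  have ws: "w \<in> space (Pi\<^sub>M L (B n))" using w by (simp add: good_def)
  define gA where "gA = (\<integral>\<^sup>+u. nnblock n J (merge L {1..k} (w, u)) * indicator (typset n J) (merge L {1..k} (w, u)) \<partial>Pi\<^sub>M {1..k} (B n))"
  define gC where "gC = (\<integral>\<^sup>+u. nnblock n J (merge L {1..k} (w, u)) * indicator (- typset n J) (merge L {1..k} (w, u)) \<partial>Pi\<^sub>M {1..k} (B n))"
  have "gC < gA" using w unfolding good_def gA_def gC_def by simp
  moreover have "nnblock n L w = gA + gC" unfolding gA_def gC_def by (rule nnblock_L_split[OF ws])
  ultimately have gA: "nnblock n L w \<le> 2 * gA" "gA \<noteq> 0"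
    by (auto simp: mult_2 less_imp_le intro!: add_left_mono)
  \<comment> \<open>The typical part of the mass is nonzero, so some completion of \<open>w\<close>
    is typical; this bounds the density of \<open>w\<close> from below.\<close>
  obtain u0 where u0: "merge L {1..k} (w, u0) \<in> typset n J"
  proof (rule ccontr)
    assume "\<not> thesis"
    then have "\<And>u. merge L {1..k} (w, u) \<notin> typset n J" using that by auto
    then have "gA = 0" by (simp add: gA_def)
    then show False using gA by simp
  qed
  define m where "m = mblock n L w"
  have mx: "mblock n L (merge L {1..k} (w, v)) = m" "nnblock n L (merge L {1..k} (w, v)) = nnblock n L w" for v
    unfolding m_def by (intro mblock_cong nnblock_cong; simp add: merge_def)+
  have a: "m > 0" "nnblock n L w = ennreal m" "exp (- (real n * (H L + \<delta>))) \<le> m"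
    using typset_G[OF u0 order_refl _ _ n, of L, unfolded mx] by auto
  have le: "nnblock n J (merge L {1..k} (w, u)) * indicator (typset n J) (merge L {1..k} (w, u))
      \<le> ennreal (m * E) * (indicator (typset n J) (merge L {1..k} (w, u)) * cond_prod n {1..k} (merge L {1..k} (w, u)))" for u
  proof (cases "merge L {1..k} (w, u) \<in> typset n J")
    case u: True
    define M where "M = mblock n J (merge L {1..k} (w, u))"
    have b: "M > 0" "nnblock n J (merge L {1..k} (w, u)) = ennreal M" "M \<le> exp (- (real n * (H J - \<delta>)))"
      using typset_G[OF u order_refl _ order_refl n] by (auto simp: M_def)
    obtain c where c: "cond_prod n {1..k} (merge L {1..k} (w, u)) = ennreal c"
      "exp (- (real n * (\<Sum>j\<in>{1..k}. cond_ent k \<mu> p {j} {0} + 2 * \<delta>))) \<le> c"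
      by (rule cond_prod_typset[OF u order_refl _ _ _ n, of "{1..k}"]) auto
    have "M \<le> exp (- (real n * (H J - \<delta>)))" by (rule b)
    also have "\<dots> = exp (- (real n * (H L + \<delta>))) * E * exp (- (real n * (\<Sum>j\<in>{1..k}. cond_ent k \<mu> p {j} {0} + 2 * \<delta>)))"
      unfolding E_def rate_def L_Un by (simp add: exp_add[symmetric] sum.distrib algebra_simps)
    also have "\<dots> \<le> m * E * c"
      by (intro mult_mono) (use a c in \<open>auto simp: E_def\<close>)
    finally have "ennreal M \<le> ennreal (m * E) * ennreal c"
      using a by (subst ennreal_mult'[symmetric]) (auto intro!: ennreal_leI simp: E_def)
    then show ?thesis using u unfolding c(1) b(2) by simp
  qed simp
  have "gA \<le> (\<integral>\<^sup>+u. ennreal (m * E) * (indicator (typset n J) (merge L {1..k} (w, u)) * cond_prod n {1..k} (merge L {1..k} (w, u))) \<partial>Pi\<^sub>M {1..k} (B n))"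
    unfolding gA_def by (intro nn_integral_mono le)
  also have "\<dots> = ennreal (m * E) * hit_prob n w"
    unfolding hit_prob_def
    by (rule nn_integral_cmult, rule measurable_merge_section[OF ws, where f = "\<lambda>x. indicator (typset n J) x * cond_prod n {1..k} x"])
       (simp only: L_Un, measurable)
  finally have 1: "gA \<le> ennreal (m * E) * hit_prob n w" .
  \<comment> \<open>The hitting probability is finite, so the factor \<open>m\<close> can be
    cancelled in real arithmetic.\<close>
  obtain r where r: "hit_prob n w = ennreal r" "r \<ge> 0"
    using hit_prob_le_1[OF ws] by (cases "hit_prob n w") (auto simp: top_unique)
  have "ennreal m \<le> 2 * (ennreal (m * E) * ennreal r)"
    using gA(1) mult_left_mono[OF 1, of 2] by (simp add: a r)
  also have "\<dots> = ennreal (2 * (m * E * r))"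
    using a r by (simp add: ennreal_mult' E_def)
  finally have "m \<le> 2 * (m * E * r)" using a r by (subst (asm) ennreal_le_iff) (auto simp: E_def)
  then have "1 \<le> 2 * (E * r)" using a by (simp add: mult.assoc mult.left_commute)
  moreover have "E > 0" by (simp add: E_def)
  ultimately have "1 / E / 2 \<le> r" by (simp add: field_simps)
  then show ?thesis unfolding r by (intro ennreal_leI) (simp add: E_def exp_minus inverse_eq_divide)
qed

text \<open>If \<open>w\<close> is not good, the typical part of its mass is at most the atypical
  part, so the total is at most twice the latter. Integrating over \<open>w\<close> reassembles the
  atypical mass on all coordinates.\<close>

lemma nn_integral_not_good_le:
  "(\<integral>\<^sup>+w. nnblock n L w * indicator (- good n) w \<partial>Pi\<^sub>M L (B n)) \<le>
    2 * (\<integral>\<^sup>+u. nnblock n J u * indicator (- typset n J) u \<partial>Pi\<^sub>M J (B n))"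
proof -
  have "(\<integral>\<^sup>+w. nnblock n L w * indicator (- good n) w \<partial>Pi\<^sub>M L (B n)) \<le>
    (\<integral>\<^sup>+w. 2 * (\<integral>\<^sup>+u. nnblock n J (merge L {1..k} (w, u)) * indicator (- typset n J) (merge L {1..k} (w, u)) \<partial>Pi\<^sub>M {1..k} (B n)) \<partial>Pi\<^sub>M L (B n))"
  proof (rule nn_integral_mono)
    fix w assume w: "w \<in> space (Pi\<^sub>M L (B n))"
    show "nnblock n L w * indicator (- good n) w \<le> 2 * (\<integral>\<^sup>+u. nnblock n J (merge L {1..k} (w, u)) * indicator (- typset n J) (merge L {1..k} (w, u)) \<partial>Pi\<^sub>M {1..k} (B n))"
      using w by (cases "w \<in> good n") (auto simp: nnblock_L_split good_def not_less mult_2 intro!: add_right_mono)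
  qed
  also have "\<dots> = 2 * (\<integral>\<^sup>+u. nnblock n J u * indicator (- typset n J) u \<partial>Pi\<^sub>M J (B n))"
  proof -
    have m: "(\<lambda>u. nnblock n J u * indicator (- typset n J) u) \<in> borel_measurable (Pi\<^sub>M J (B n))" by measurable
    show ?thesis
      unfolding nn_integral_fold_L[OF m] by (rule nn_integral_cmult[OF merge_measurable_L[OF m]])
  qed
  finally show ?thesis .
qed

section \<open>The law of a single tuple of codewords\<close>

text \<open>This is p(u_0^n), with \<open>marginal\<close> instead of \<open>nnmarg\<close> because
  it is a factor of the density in assumption (II).\<close>

definition base_block :: "nat \<Rightarrow> (nat \<Rightarrow> nat \<Rightarrow> 'a symbol) \<Rightarrow> ennreal" where
  "base_block n u = (\<Prod>i=1..n. ennreal (marg {0} (\<lambda>j. u j i)))"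

lemma base_block_cong: "u 0 = u' 0 \<Longrightarrow> base_block n u = base_block n u'"
  unfolding base_block_def by (intro prod.cong refl arg_cong[where f = ennreal] marg_cong) auto

lemma base_block_measurable:
  assumes "T \<subseteq> J" "0 \<in> T"
  shows "base_block n \<in> borel_measurable (Pi\<^sub>M T (B n))"
proof -
  have [measurable]: "(\<lambda>u. marg {0} (\<lambda>j. u j i)) \<in> borel_measurable (Pi\<^sub>M T (B n))" if "i \<in> {1..n}" for i
    by (rule marg_column_measurable) (use assms that in auto)
  show ?thesis unfolding base_block_def[abs_def] by measurable
qed

lemma prod_cond_indep_density:
  assumes u: "u \<in> space (Pi\<^sub>M J (B n))"
  shows "(\<Prod>i=1..n. ennreal (cond_indep_density k \<mu> p (\<lambda>j. u j i))) = base_block n u * cond_prod n {1..Suc k} u"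
proof -
  have sp: "u j i \<in> space (\<mu> j)" if "j \<in> J" "i \<in> {1..n}" for i j
    using space_block_column[OF u that] .
  have "ennreal (cond_indep_density k \<mu> p (\<lambda>j. u j i)) =
    ennreal (marg {0} (\<lambda>j. u j i)) * (\<Prod>j=1..k+1. ennreal (cnd j (u j i) (u 0 i)))" if i: "i \<in> {1..n}" for i
  proof -
    have nn: "cnd j (u j i) (u 0 i) \<ge> 0" if "j \<in> {1..k+1}" for j
      by (rule cond_marginal_nonneg[OF that]) (use that i sp in auto)
    have "(\<Prod>j=1..k+1. ennreal (cnd j (u j i) (u 0 i))) = ennreal (\<Prod>j=1..k+1. cnd j (u j i) (u 0 i))"
      by (rule prod_ennreal) (rule nn)
    moreover have "marg {0} (\<lambda>j. u j i) \<ge> 0" by (rule marg_nonneg) (use i sp in auto)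
    ultimately show ?thesis
      unfolding cond_indep_density_def using nn by (simp only: ennreal_mult prod_nonneg)
  qed
  then have "(\<Prod>i=1..n. ennreal (cond_indep_density k \<mu> p (\<lambda>j. u j i))) =
    (\<Prod>i=1..n. ennreal (marg {0} (\<lambda>j. u j i)) * (\<Prod>j=1..k+1. ennreal (cnd j (u j i) (u 0 i))))"
    by (intro prod.cong) auto
  also have "\<dots> = base_block n u * (\<Prod>j=1..k+1. \<Prod>i=1..n. ennreal (cnd j (u j i) (u 0 i)))"
    unfolding prod.distrib base_block_def by (subst prod.swap) simp
  also have "(\<Prod>j=1..k+1. \<Prod>i=1..n. ennreal (cnd j (u j i) (u 0 i))) = cond_prod n {1..Suc k} u"
    unfolding cond_prod_def cond_block_def
    by (intro prod.cong prod_ennreal cond_marginal_nonneg sp) auto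
  finally show ?thesis .
qed

text \<open>Assumption (II) describes time columns, so the law is first written for the sequence of
  letter tuples and then transposed to blocks. The coordinates outside \<open>T\<close> are
  integrated out against conditional densities of mass at most 1, which gives an inequality.\<close>

lemma law_le:
  assumes P: "prob_space P" and n: "n \<ge> 1" and Y[measurable]: "Y \<in> P \<rightarrow>\<^sub>M Pi\<^sub>M J (B n)"
    and indep: "prob_space.indep_vars P (\<lambda>i. letters k \<mu>) (\<lambda>i \<omega>. \<lambda>j\<in>{0..k+1}. Y \<omega> j i) {1..n}"
    and dist: "\<And>i. i \<in> {1..n} \<Longrightarrow> distributed P (letters k \<mu>) (\<lambda>\<omega>. \<lambda>j\<in>{0..k+1}. Y \<omega> j i)
            (\<lambda>u. ennreal (cond_indep_density k \<mu> p u))"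
    and T: "T \<subseteq> J" "0 \<in> T" and f[measurable]: "f \<in> borel_measurable (Pi\<^sub>M T (B n))"
  shows "(\<integral>\<^sup>+\<omega>. f (restrict (Y \<omega>) T) \<partial>P) \<le> (\<integral>\<^sup>+u. f u * (base_block n u * cond_prod n (T - {0}) u) \<partial>Pi\<^sub>M T (B n))"
proof -
  interpret P: prob_space P by fact
  interpret Bn: product_sigma_finite "B n" by (rule product_sigma_finite_block)
  define d where "d u = ennreal (cond_indep_density k \<mu> p u)" for u
  define X where "X i \<omega> = (\<lambda>j\<in>{0..k+1}. Y \<omega> j i)" for i \<omega>
  define W where "W \<omega> = (\<lambda>i\<in>{1..n}. X i \<omega>)" for \<omega>
  define tr where "tr w = (\<lambda>j\<in>J. \<lambda>i\<in>{1..n}. w i j)" for w :: "nat \<Rightarrow> nat \<Rightarrow> 'a symbol"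
  have dist: "distributed P (letters k \<mu>) (X i) d" if "i \<in> {1..n}" for i
    using dist[OF that] by (simp add: X_def[abs_def] d_def[abs_def])
  have Xm: "X i \<in> P \<rightarrow>\<^sub>M letters k \<mu>" if "i \<in> {1..n}" for i
    using dist[OF that] by (simp add: distributed_def)
  have Wm[measurable]: "W \<in> P \<rightarrow>\<^sub>M Pi\<^sub>M {1..n} (\<lambda>_. letters k \<mu>)"
    unfolding W_def[abs_def] by (rule measurable_restrict) (rule Xm)
  have dm[measurable]: "d \<in> borel_measurable (letters k \<mu>)"
    using dist[of 1] n by (simp add: distributed_def)
  have trm[measurable]: "tr \<in> Pi\<^sub>M {1..n} (\<lambda>_. letters k \<mu>) \<rightarrow>\<^sub>M Pi\<^sub>M J (B n)"
    unfolding letters_J block_def[abs_def] tr_def[abs_def] by (rule measurable_transpose)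
  have dd: "distr P (letters k \<mu>) (X i) = density (letters k \<mu>) d" if "i \<in> {1..n}" for i
    using dist[OF that] by (simp add: distributed_def)
  have "distr P (Pi\<^sub>M {1..n} (\<lambda>_. letters k \<mu>)) W = Pi\<^sub>M {1..n} (\<lambda>i. distr P (letters k \<mu>) (X i))"
    using indep n unfolding X_def[symmetric] W_def[abs_def]
    by (subst (asm) P.indep_vars_iff_distr_eq_PiM') (use Xm in auto)
  also have "\<dots> = Pi\<^sub>M {1..n} (\<lambda>i. density (letters k \<mu>) d)"
    by (rule PiM_cong) (simp_all add: dd)
  also have "\<dots> = density (Pi\<^sub>M {1..n} (\<lambda>_. letters k \<mu>)) (\<lambda>w. \<Prod>i=1..n. d (w i))"
  proof (rule PiM_density[OF sigma_finite_letters])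
    interpret D: prob_space "density (letters k \<mu>) d"
      using P.prob_space_distr[OF Xm[of 1]] dd[of 1] n by simp
    show "product_sigma_finite (\<lambda>_::nat. density (letters k \<mu>) d)"
      using D.sigma_finite_measure_axioms by (simp add: product_sigma_finite_def)
  qed simp_all
  finally have lawW: "distr P (Pi\<^sub>M {1..n} (\<lambda>_. letters k \<mu>)) W =
    density (Pi\<^sub>M {1..n} (\<lambda>_. letters k \<mu>)) (\<lambda>w. \<Prod>i=1..n. d (w i))" .
  \<comment> \<open>Blocks are extensional functions, so a tuple of blocks is recovered exactly from
    its time columns.\<close>
  have Ytr: "Y \<omega> = tr (W \<omega>)" if "\<omega> \<in> space P" for \<omega>
  proof -
    have "Y \<omega> \<in> space (Pi\<^sub>M J (B n))" using measurable_space[OF Y that] .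
    then show ?thesis
      by (auto simp: tr_def W_def X_def fun_eq_iff space_PiM PiE_iff extensional_def block_def restrict_def)
  qed
  have rm[measurable]: "(\<lambda>u. restrict u T) \<in> Pi\<^sub>M J (B n) \<rightarrow>\<^sub>M Pi\<^sub>M T (B n)"
    by (rule measurable_restrict_subset[OF T(1)])
  have fm: "(\<lambda>u. f (restrict u T) * (base_block n u * cond_prod n {1..Suc k} u)) \<in> borel_measurable (Pi\<^sub>M J (B n))"
  proof -
    have [measurable]: "base_block n \<in> borel_measurable (Pi\<^sub>M J (B n))" by (rule base_block_measurable) auto
    have [measurable]: "cond_prod n {1..Suc k} \<in> borel_measurable (Pi\<^sub>M J (B n))" by (rule cond_prod_measurable) auto
    have [measurable]: "(\<lambda>u. f (restrict u T)) \<in> borel_measurable (Pi\<^sub>M J (B n))"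
      by (rule measurable_compose[OF rm f])
    show ?thesis by measurable
  qed
  have "(\<integral>\<^sup>+\<omega>. f (restrict (Y \<omega>) T) \<partial>P) = (\<integral>\<^sup>+\<omega>. f (restrict (tr (W \<omega>)) T) \<partial>P)"
    by (intro nn_integral_cong) (simp add: Ytr)
  also have "\<dots> = (\<integral>\<^sup>+w. f (restrict (tr w) T) \<partial>distr P (Pi\<^sub>M {1..n} (\<lambda>_. letters k \<mu>)) W)"
    by (rule nn_integral_distr[symmetric]) measurable
  also have "\<dots> = (\<integral>\<^sup>+w. (\<Prod>i=1..n. d (w i)) * f (restrict (tr w) T) \<partial>Pi\<^sub>M {1..n} (\<lambda>_. letters k \<mu>))"
    unfolding lawW by (rule nn_integral_density) measurable
  also have "\<dots> = (\<integral>\<^sup>+w. f (restrict (tr w) T) * (base_block n (tr w) * cond_prod n {1..Suc k} (tr w)) \<partial>Pi\<^sub>M {1..n} (\<lambda>_. letters k \<mu>))"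
  proof (rule nn_integral_cong)
    fix w assume w: "w \<in> space (Pi\<^sub>M {1..n} (\<lambda>_. letters k \<mu>))"
    have "d (w i) = ennreal (cond_indep_density k \<mu> p (\<lambda>j. tr w j i))" if i: "i \<in> {1..n}" for i
    proof -
      have "marg {0} (w i) = marg {0} (\<lambda>j. tr w j i)"
        by (rule marg_cong) (use i in \<open>auto simp: tr_def\<close>)
      then show ?thesis using i by (simp add: d_def cond_indep_density_def tr_def)
    qed
    then have "(\<Prod>i=1..n. d (w i)) = (\<Prod>i=1..n. ennreal (cond_indep_density k \<mu> p (\<lambda>j. tr w j i)))"
      by (intro prod.cong) auto
    also have "\<dots> = base_block n (tr w) * cond_prod n {1..Suc k} (tr w)"
      by (rule prod_cond_indep_density) (rule measurable_space[OF trm w])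
    finally show "(\<Prod>i=1..n. d (w i)) * f (restrict (tr w) T) =
      f (restrict (tr w) T) * (base_block n (tr w) * cond_prod n {1..Suc k} (tr w))" by (simp add: mult.commute)
  qed
  also have "\<dots> = (\<integral>\<^sup>+u. f (restrict u T) * (base_block n u * cond_prod n {1..Suc k} u) \<partial>Pi\<^sub>M J (B n))"
    using nn_integral_transpose[OF _ _ fm[unfolded block_def[abs_def]]]
    by (simp add: block_def[abs_def] letters_J tr_def)
  also have "\<dots> = (\<integral>\<^sup>+u. \<integral>\<^sup>+v. f (restrict (merge T (J - T) (u, v)) T) *
      (base_block n (merge T (J - T) (u, v)) * cond_prod n {1..Suc k} (merge T (J - T) (u, v))) \<partial>Pi\<^sub>M (J - T) (B n) \<partial>Pi\<^sub>M T (B n))"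
  proof -
    have TJ: "T \<union> (J - T) = J" using T by auto
    show ?thesis
      using Bn.product_nn_integral_fold[of T "J - T" "\<lambda>u. f (restrict u T) * (base_block n u * cond_prod n {1..Suc k} u)"]
        fm finite_subset_J[OF T(1)] unfolding TJ by simp
  qed
  also have "\<dots> \<le> (\<integral>\<^sup>+u. f u * (base_block n u * cond_prod n (T - {0}) u) \<partial>Pi\<^sub>M T (B n))"
  proof (rule nn_integral_mono)
    fix u assume u: "u \<in> space (Pi\<^sub>M T (B n))"
    have r: "restrict (merge T (J - T) (u, v)) T = u" for v
      using u by (auto simp: space_PiM PiE_def restrict_merge extensional_restrict)
    have m: "base_block n (merge T (J - T) (u, v)) = base_block n u" for v
      by (rule base_block_cong) (use T in \<open>simp add: merge_def\<close>)
    \<comment> \<open>Since 0 lies in \<open>T\<close>, every coordinate outside \<open>T\<close>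
      contributes one conditional density, and all of them can be integrated out together.\<close>
    have dec: "{1..Suc k} = (T - {0}) \<union> (J - T)" using T by (auto simp: Suc_le_eq intro!: gr0I)
    have c: "cond_prod n {1..Suc k} (merge T (J - T) (u, v)) = cond_prod n (T - {0}) u * cond_prod n (J - T) (merge T (J - T) (u, v))" for v
    proof -
      have "cond_prod n (T - {0}) (merge T (J - T) (u, v)) = cond_prod n (T - {0}) u"
        by (rule cond_prod_cong) (use T in \<open>auto simp: merge_def\<close>)
      then show ?thesis unfolding dec using finite_subset_J[OF T(1)]
        by (subst cond_prod_union) auto
    qed
    have cm: "(\<lambda>v. cond_prod n (J - T) (merge T (J - T) (u, v))) \<in> borel_measurable (Pi\<^sub>M (J - T) (B n))"
      by (intro measurable_merge_section[OF u] cond_prod_measurable) (use dec T in auto)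
    have "(\<integral>\<^sup>+v. f (restrict (merge T (J - T) (u, v)) T) *
      (base_block n (merge T (J - T) (u, v)) * cond_prod n {1..Suc k} (merge T (J - T) (u, v))) \<partial>Pi\<^sub>M (J - T) (B n)) =
      (\<integral>\<^sup>+v. (f u * (base_block n u * cond_prod n (T - {0}) u)) * cond_prod n (J - T) (merge T (J - T) (u, v)) \<partial>Pi\<^sub>M (J - T) (B n))"
      unfolding r m c by (simp add: mult.assoc)
    also have "\<dots> = (f u * (base_block n u * cond_prod n (T - {0}) u)) * (\<integral>\<^sup>+v. cond_prod n (J - T) (merge T (J - T) (u, v)) \<partial>Pi\<^sub>M (J - T) (B n))"
      by (rule nn_integral_cmult[OF cm])
    also have "\<dots> \<le> (f u * (base_block n u * cond_prod n (T - {0}) u)) * 1"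
      by (intro mult_left_mono nn_integral_cond_prod_le_1) (use T u in auto)
    finally show "(\<integral>\<^sup>+v. f (restrict (merge T (J - T) (u, v)) T) *
      (base_block n (merge T (J - T) (u, v)) * cond_prod n {1..Suc k} (merge T (J - T) (u, v))) \<partial>Pi\<^sub>M (J - T) (B n)) \<le>
      f u * (base_block n u * cond_prod n (T - {0}) u)" by simp
  qed
  finally show ?thesis .
qed

text \<open>Where p(u_0) vanishes the left-hand factor is 0; elsewhere it cancels against the
  denominator and leaves p(u_0, u_{k+1}). This is the comparison that transfers estimates from p to
  the codebook.\<close>

lemma base_block_cond_prod_le_G:
  assumes u: "u \<in> space (Pi\<^sub>M L (B n))"
  shows "base_block n u * cond_prod n {Suc k} u \<le> nnblock n L u"
proof -
  have sp: "u j i \<in> space (\<mu> j)" if "j \<in> L" "i \<in> {1..n}" for i j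
    using space_block_column[OF u that] .
  have "base_block n u * cond_prod n {Suc k} u = (\<Prod>i=1..n. ennreal (marg {0} (\<lambda>j. u j i)) * ennreal (cnd (Suc k) (u (Suc k) i) (u 0 i)))"
  proof -
    have "(\<Prod>i=1..n. ennreal (cnd (Suc k) (u (Suc k) i) (u 0 i))) = ennreal (\<Prod>i=1..n. cnd (Suc k) (u (Suc k) i) (u 0 i))"
      by (rule prod_ennreal) (use sp in \<open>auto intro!: cond_marginal_nonneg\<close>)
    then show ?thesis by (simp add: base_block_def cond_prod_def cond_block_def prod.distrib)
  qed
  also have "\<dots> \<le> (\<Prod>i=1..n. nnmarg L (\<lambda>j. u j i))"
  proof (rule prod_mono_ennreal)
    fix i assume i: "i \<in> {1..n}"
    have c: "cnd (Suc k) (u (Suc k) i) (u 0 i) = marg L (\<lambda>j. u j i) / marg {0} (\<lambda>j. u j i)"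
      unfolding cond_marginal_def by (intro arg_cong2[where f = "(/)"] marg_cong) auto
    have nn: "marg {0} (\<lambda>j. u j i) \<ge> 0" "marg L (\<lambda>j. u j i) \<ge> 0" by (rule marg_nonneg; use i sp in auto)+
    have "ennreal (marg {0} (\<lambda>j. u j i)) * ennreal (cnd (Suc k) (u (Suc k) i) (u 0 i)) \<le> ennreal (marg L (\<lambda>j. u j i))"
      unfolding c using nn by (cases "marg {0} (\<lambda>j. u j i) = 0") (auto simp: ennreal_mult'[symmetric])
    also have "\<dots> \<le> nnmarg L (\<lambda>j. u j i)" by (rule marg_le_g) (use i sp in auto)
    finally show "ennreal (marg {0} (\<lambda>j. u j i)) * ennreal (cnd (Suc k) (u (Suc k) i) (u 0 i)) \<le> nnmarg L (\<lambda>j. u j i)" .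
  qed
  finally show ?thesis by (simp add: nnblock_def)
qed

text \<open>Folding \<open>L\<close> down to the empty set of coordinates leaves a product of total
  masses of p, each equal to 1.\<close>

lemma nn_integral_G: "(\<integral>\<^sup>+u. nnblock n L u \<partial>Pi\<^sub>M L (B n)) \<le> 1"
proof -
  interpret P: prob_space "density (letters k \<mu>) p" by (rule p_prob)
  interpret Bn: product_sigma_finite "B n" by (rule product_sigma_finite_block)
  have u0: "(\<lambda>_. undefined) \<in> space (Pi\<^sub>M {} (B n))" by (simp add: space_PiM)
  have "(\<integral>\<^sup>+u. nnblock n L u \<partial>Pi\<^sub>M L (B n)) = (\<integral>\<^sup>+u. nnblock n ({} \<union> L) (merge {} L (\<lambda>_. undefined, u)) \<partial>Pi\<^sub>M L (B n))"
    by (intro nn_integral_cong) (auto intro!: nnblock_cong simp: merge_def)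
  also have "\<dots> = nnblock n {} (\<lambda>_. undefined)" by (rule nnblock_fold[OF _ _ u0]) auto
  also have "nnmarg {} v = 1" for v
  proof -
    have "merge {} J (v, u) = u" if "u \<in> space (Pi\<^sub>M J \<mu>)" for u
      using that by (auto simp: merge_def fun_eq_iff space_PiM PiE_iff extensional_def)
    then have "nnmarg {} v = (\<integral>\<^sup>+u. ennreal (p u) \<partial>letters k \<mu>)"
      unfolding nnmarg_def letters_J Diff_empty by (intro nn_integral_cong) simp
    also have "\<dots> = 1"
      using P.emeasure_space_1 p_measurable by (simp add: emeasure_density cong: nn_integral_cong)
    finally show ?thesis .
  qed
  then have "nnblock n {} (\<lambda>_. undefined) = 1" by (simp add: nnblock_def)
  finally show ?thesis by simp
qed

end

section \<open>Pairs of tuples of codewords\<close>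

locale codebook = joint_density_ent \<mu> k p \<delta> + prob_space P
  for \<mu> :: "nat \<Rightarrow> 'a symbol measure" and k p \<delta> and P :: "'w measure" +
  fixes n :: nat and M :: "nat \<Rightarrow> nat"
    and U0 Ul :: "'w \<Rightarrow> nat \<Rightarrow> 'a symbol"
    and U :: "nat \<Rightarrow> nat \<Rightarrow> 'w \<Rightarrow> nat \<Rightarrow> 'a symbol"
  assumes n: "n \<ge> 1"
    and U0: "U0 \<in> measurable P (block n \<mu> 0)"
    and U: "\<And>j m. j \<in> {1..k} \<Longrightarrow> m \<in> {1..M j} \<Longrightarrow> U j m \<in> measurable P (block n \<mu> j)"
    and Ul: "Ul \<in> measurable P (block n \<mu> (k+1))"
    and I: "\<And>m m' Sc. m \<in> codebook_indices k M \<Longrightarrow> m' \<in> codebook_indices k M \<Longrightarrow>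
          Sc = {1..k} - {j \<in> {1..k}. m j = m' j} \<Longrightarrow>
          has_cond_density P
            (block n \<mu> 0 \<Otimes>\<^sub>M block n \<mu> (k+1)) (\<lambda>\<omega>. (U0 \<omega>, Ul \<omega>))
            ((\<Pi>\<^sub>M j\<in>{1..k}. block n \<mu> j) \<Otimes>\<^sub>M (\<Pi>\<^sub>M j\<in>Sc. block n \<mu> j))
            (\<lambda>\<omega>. (\<lambda>j\<in>{1..k}. U j (m j) \<omega>, \<lambda>j\<in>Sc. U j (m' j) \<omega>))
            (\<lambda>(u0, ulast) (u, u').
               (\<Prod>j\<in>{1..k}. cond_block k \<mu> p n j (u j) u0) *
               (\<Prod>j\<in>Sc. cond_block k \<mu> p n j (u' j) u0))"
    and II: "\<And>m. m \<in> codebook_indices k M \<Longrightarrow>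
          indep_vars (\<lambda>i. letters k \<mu>)
            (\<lambda>i \<omega>. \<lambda>j\<in>{0..k+1}. codeword_tuple k U0 U Ul m \<omega> j i) {1..n} \<and>
          (\<forall>i\<in>{1..n}. distributed P (letters k \<mu>)
            (\<lambda>\<omega>. \<lambda>j\<in>{0..k+1}. codeword_tuple k U0 U Ul m \<omega> j i)
            (\<lambda>u. ennreal (cond_indep_density k \<mu> p u)))"
begin

abbreviation "CB \<equiv> codebook_indices k M"
abbreviation "tup \<equiv> codeword_tuple k U0 U Ul"
abbreviation "A \<equiv> typset n J"

definition outer :: "'w \<Rightarrow> nat \<Rightarrow> nat \<Rightarrow> 'a symbol" where
  "outer \<omega> = (\<lambda>j\<in>L. if j = 0 then U0 \<omega> else Ul \<omega>)"

lemma CB_range: "m \<in> CB \<Longrightarrow> j \<in> {1..k} \<Longrightarrow> m j \<in> {1..M j}"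
  unfolding codebook_indices_def by (rule PiE_mem)

lemma finite_CB: "finite CB"
  unfolding codebook_indices_def by (intro finite_PiE) auto

lemma card_CB: "card CB = (\<Prod>j=1..k. M j)"
  unfolding codebook_indices_def by (subst card_PiE) auto

lemma tup_measurable[measurable]:
  assumes m: "m \<in> CB"
  shows "tup m \<in> P \<rightarrow>\<^sub>M Pi\<^sub>M J (B n)"
proof -
  have "(\<lambda>\<omega>. \<lambda>j\<in>J. if j = 0 then U0 \<omega> else if j = k + 1 then Ul \<omega> else U j (m j) \<omega>) \<in> P \<rightarrow>\<^sub>M Pi\<^sub>M J (B n)"
  proof (rule measurable_restrict)
    fix j assume j: "j \<in> J"
    consider "j = 0" | "j = k + 1" | "j \<in> {1..k}" using j by fastforce
    then show "(\<lambda>\<omega>. if j = 0 then U0 \<omega> else if j = k + 1 then Ul \<omega> else U j (m j) \<omega>) \<in> P \<rightarrow>\<^sub>M B n j"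
      by cases (use U0 Ul U[OF _ CB_range[OF m]] in auto)
  qed
  then show ?thesis unfolding codeword_tuple_def[abs_def] by simp
qed

lemma outer_measurable[measurable]: "outer \<in> P \<rightarrow>\<^sub>M Pi\<^sub>M L (B n)"
  unfolding outer_def[abs_def] by (rule measurable_restrict) (use U0 Ul in auto)

lemma restrict_tup_L: "restrict (tup m \<omega>) L = outer \<omega>"
  by (auto simp: outer_def codeword_tuple_def fun_eq_iff)

lemma tup_law_le:
  assumes m: "m \<in> CB" and T: "T \<subseteq> J" "0 \<in> T" and f: "f \<in> borel_measurable (Pi\<^sub>M T (B n))"
  shows "(\<integral>\<^sup>+\<omega>. f (restrict (tup m \<omega>) T) \<partial>P) \<le> (\<integral>\<^sup>+u. f u * (base_block n u * cond_prod n (T - {0}) u) \<partial>Pi\<^sub>M T (B n))"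
  by (rule law_le[OF prob_space_axioms n tup_measurable[OF m] _ _ T f]) (use II[OF m] in auto)

text \<open>The law of (U_0, U_{k+1}) is accessible only as the restriction of the law of a whole
  tuple, which assumption (II) provides for each index tuple; hence the codebook must be
  nonempty.\<close>

lemma emeasure_outer_not_good:
  assumes "CB \<noteq> {}"
  shows "emeasure P {\<omega> \<in> space P. outer \<omega> \<notin> good n} \<le>
    2 * (\<integral>\<^sup>+u. nnblock n J u * indicator (- typset n J) u \<partial>Pi\<^sub>M J (B n))"
proof -
  obtain m where m: "m \<in> CB" using assms by auto
  have s: "{\<omega> \<in> space P. outer \<omega> \<notin> good n} \<in> sets P" by measurable
  have "emeasure P {\<omega> \<in> space P. outer \<omega> \<notin> good n} =
    (\<integral>\<^sup>+\<omega>. indicator {\<omega> \<in> space P. outer \<omega> \<notin> good n} \<omega> \<partial>P)"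
    using s by simp
  also have "\<dots> = (\<integral>\<^sup>+\<omega>. indicator (- good n) (restrict (tup m \<omega>) L) \<partial>P)"
    unfolding restrict_tup_L by (intro nn_integral_cong) (auto simp: indicator_def)
  also have "\<dots> \<le> (\<integral>\<^sup>+u. indicator (- good n) u * (base_block n u * cond_prod n (L - {0}) u) \<partial>Pi\<^sub>M L (B n))"
    by (rule tup_law_le[OF m]) auto
  also have "\<dots> \<le> (\<integral>\<^sup>+u. nnblock n L u * indicator (- good n) u \<partial>Pi\<^sub>M L (B n))"
  proof (rule nn_integral_mono)
    fix u assume u: "u \<in> space (Pi\<^sub>M L (B n))"
    have "L - {0} = {Suc k}" by auto
    then show "indicator (- good n) u * (base_block n u * cond_prod n (L - {0}) u) \<le> nnblock n L u * indicator (- good n) u"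
      using base_block_cond_prod_le_G[OF u] by (auto simp: indicator_def)
  qed
  also note nn_integral_not_good_le
  finally show ?thesis .
qed

text \<open>The probability that fresh codewords on \<open>C\<close> complete the given coordinates
  \<open>x\<close> outside \<open>C\<close> to a typical tuple.\<close>

definition section_prob :: "nat set \<Rightarrow> (nat \<Rightarrow> nat \<Rightarrow> 'a symbol) \<Rightarrow> ennreal" where
  "section_prob C x = (\<integral>\<^sup>+v. indicator A (merge (J - C) C (x, v)) * cond_prod n C (merge (J - C) C (x, v)) \<partial>Pi\<^sub>M C (B n))"

text \<open>Given the outer blocks \<open>w\<close>, the probability that two tuples differing
  exactly on \<open>C\<close> are both typical: the first tuple is drawn in full, then its
  coordinates in \<open>C\<close> are drawn anew.\<close>

definition pair_prob :: "nat set \<Rightarrow> (nat \<Rightarrow> nat \<Rightarrow> 'a symbol) \<Rightarrow> ennreal" where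
  "pair_prob C w = (\<integral>\<^sup>+u. indicator A (merge L {1..k} (w, u)) * cond_prod n {1..k} (merge L {1..k} (w, u)) *
     section_prob C (restrict (merge L {1..k} (w, u)) (J - C)) \<partial>Pi\<^sub>M {1..k} (B n))"

text \<open>Assumption (I) in the form of a conditional expectation tested against functions
  \<open>h\<close> of the outer blocks. Taking for \<open>h\<close> an inverse power of the
  conditional mean performs the normalisation in Chebyshev's inequality, and \<open>m = m'\<close>
  gives the first moment.\<close>

lemma pair_expectation:
  assumes m: "m \<in> CB" "m' \<in> CB" and C: "C = {j \<in> {1..k}. m j \<noteq> m' j}"
    and h[measurable]: "h \<in> borel_measurable (Pi\<^sub>M L (B n))"
  shows "(\<integral>\<^sup>+\<omega>. h (outer \<omega>) * (indicator A (tup m \<omega>) * indicator A (tup m' \<omega>)) \<partial>P) =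
    (\<integral>\<^sup>+\<omega>. h (outer \<omega>) * pair_prob C (outer \<omega>) \<partial>P)"
proof -
  interpret Bn: product_sigma_finite "B n" by (rule product_sigma_finite_block)
  define N where "N = block n \<mu> 0 \<Otimes>\<^sub>M block n \<mu> (k+1)"
  define QK where "QK = Pi\<^sub>M {1..k} (B n)"
  define QC where "QC = Pi\<^sub>M C (B n)"
  define V where "V \<omega> = (U0 \<omega>, Ul \<omega>)" for \<omega>
  define wv where "wv v = (\<lambda>j\<in>L. if j = 0 then fst v else snd v)" for v :: "(nat \<Rightarrow> 'a symbol) \<times> (nat \<Rightarrow> 'a symbol)"
  define X where "X \<omega> = (\<lambda>j\<in>{1..k}. U j (m j) \<omega>, \<lambda>j\<in>C. U j (m' j) \<omega>)" for \<omega>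
  define T where "T = J - C"
  have CK: "C \<subseteq> {1..k}" "finite C" by (auto simp: C)
  have TC: "T \<union> C = J" "T \<inter> C = {}" "T \<subseteq> J" "0 \<in> T" using CK by (auto simp: T_def)
  interpret QK: sigma_finite_measure QK unfolding QK_def by (rule Bn.sigma_finite) simp
  interpret QC: sigma_finite_measure QC unfolding QC_def by (rule Bn.sigma_finite) (rule CK)
  interpret QKC: pair_sigma_finite QK QC ..
  \<comment> \<open>\<open>xx\<close> rebuilds the first tuple from the condition and its k
    codewords; \<open>yy\<close> rebuilds the second one by replacing only the codewords in
    \<open>C\<close>.\<close>
  define xx where "xx v u = merge L {1..k} (wv v, u)" for v u
  define yy where "yy v u u' = merge T C (restrict (xx v u) T, u')" for v u u'
  have wvm[measurable]: "wv \<in> N \<rightarrow>\<^sub>M Pi\<^sub>M L (B n)"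
    unfolding wv_def[abs_def] N_def by (rule measurable_restrict) auto
  have xm[measurable]: "(\<lambda>z. xx (fst z) (snd z)) \<in> N \<Otimes>\<^sub>M QK \<rightarrow>\<^sub>M Pi\<^sub>M J (B n)"
  proof -
    have "(\<lambda>z. merge L {1..k} (wv (fst z), snd z)) \<in> N \<Otimes>\<^sub>M QK \<rightarrow>\<^sub>M Pi\<^sub>M (L \<union> {1..k}) (B n)"
      unfolding QK_def by (rule measurable_compose[OF _ measurable_merge]) measurable
    then show ?thesis unfolding xx_def L_Un .
  qed
  have ym[measurable]: "(\<lambda>z. yy (fst z) (fst (snd z)) (snd (snd z))) \<in> N \<Otimes>\<^sub>M (QK \<Otimes>\<^sub>M QC) \<rightarrow>\<^sub>M Pi\<^sub>M J (B n)"
  proof -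
    have [measurable]: "(\<lambda>x. restrict x T) \<in> Pi\<^sub>M J (B n) \<rightarrow>\<^sub>M Pi\<^sub>M T (B n)"
      by (rule measurable_restrict_subset) (rule TC)
    have x': "(\<lambda>z. xx (fst z) (fst (snd z))) \<in> N \<Otimes>\<^sub>M (QK \<Otimes>\<^sub>M QC) \<rightarrow>\<^sub>M Pi\<^sub>M J (B n)"
      using measurable_compose[of "\<lambda>z. (fst z, fst (snd z))" "N \<Otimes>\<^sub>M (QK \<Otimes>\<^sub>M QC)" "N \<Otimes>\<^sub>M QK", OF _ xm] by simp
    have r': "(\<lambda>z. restrict (xx (fst z) (fst (snd z))) T) \<in> N \<Otimes>\<^sub>M (QK \<Otimes>\<^sub>M QC) \<rightarrow>\<^sub>M Pi\<^sub>M T (B n)"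
      by (rule measurable_compose[OF x']) measurable
    have s': "(\<lambda>z. snd (snd z)) \<in> N \<Otimes>\<^sub>M (QK \<Otimes>\<^sub>M QC) \<rightarrow>\<^sub>M Pi\<^sub>M C (B n)"
      unfolding QC_def by measurable
    have "(\<lambda>z. merge T C (restrict (xx (fst z) (fst (snd z))) T, snd (snd z))) \<in> N \<Otimes>\<^sub>M (QK \<Otimes>\<^sub>M QC) \<rightarrow>\<^sub>M Pi\<^sub>M (T \<union> C) (B n)"
      by (rule measurable_compose[OF measurable_Pair[OF r' s'] measurable_merge])
    then show ?thesis unfolding yy_def TC .
  qed
  have [measurable]: "cond_prod n {1..k} \<in> borel_measurable (Pi\<^sub>M J (B n))" "cond_prod n C \<in> borel_measurable (Pi\<^sub>M J (B n))"
    using CK by (auto intro!: cond_prod_measurable)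
  define F where "F z = h (wv (fst z)) * (indicator A (xx (fst z) (fst (snd z))) *
    indicator A (yy (fst z) (fst (snd z)) (snd (snd z))))" for z
  have x'm[measurable]: "(\<lambda>z. xx (fst z) (fst (snd z))) \<in> N \<Otimes>\<^sub>M (QK \<Otimes>\<^sub>M QC) \<rightarrow>\<^sub>M Pi\<^sub>M J (B n)"
    using measurable_compose[of "\<lambda>z. (fst z, fst (snd z))" "N \<Otimes>\<^sub>M (QK \<Otimes>\<^sub>M QC)" "N \<Otimes>\<^sub>M QK", OF _ xm] by simp
  have Fm: "F \<in> borel_measurable (N \<Otimes>\<^sub>M (QK \<Otimes>\<^sub>M QC))"
    unfolding F_def[abs_def] by measurable
  define f where "f = (\<lambda>(u0 :: nat \<Rightarrow> 'a symbol, ulast :: nat \<Rightarrow> 'a symbol) (u, u').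
               (\<Prod>j\<in>{1..k}. cond_block k \<mu> p n j (u j) u0) *
               (\<Prod>j\<in>C. cond_block k \<mu> p n j (u' j) u0))"
  have "C = {1..k} - {j \<in> {1..k}. m j = m' j}" by (auto simp: C)
  from I[OF m this] have dens: "has_cond_density P N V (QK \<Otimes>\<^sub>M QC) X f"
    unfolding N_def V_def[abs_def] QK_def QC_def X_def[abs_def] f_def .
  have Vm[measurable]: "V \<in> P \<rightarrow>\<^sub>M N" using dens by (simp add: has_cond_density_def)
  have wV: "wv (V \<omega>) = outer \<omega>" for \<omega> by (simp only: wv_def V_def outer_def fst_conv snd_conv)
  have t1: "xx (V \<omega>) (fst (X \<omega>)) = tup m \<omega>" for \<omega>
    by (auto simp: xx_def wV X_def outer_def codeword_tuple_def merge_def fun_eq_iff)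
  have t2: "yy (V \<omega>) (fst (X \<omega>)) (snd (X \<omega>)) = tup m' \<omega>" for \<omega>
    unfolding yy_def t1 using C
    by (auto simp: T_def X_def codeword_tuple_def merge_def fun_eq_iff)
  have "(\<integral>\<^sup>+\<omega>. h (outer \<omega>) * (indicator A (tup m \<omega>) * indicator A (tup m' \<omega>)) \<partial>P) = (\<integral>\<^sup>+\<omega>. F (V \<omega>, X \<omega>) \<partial>P)"
    by (simp add: F_def wV t1 t2)
  also have "\<dots> = (\<integral>\<^sup>+v. (\<integral>\<^sup>+x. ennreal (f v x) * F (v, x) \<partial>(QK \<Otimes>\<^sub>M QC)) \<partial>distr P N V)"
    by (rule has_cond_density_nn_integral[OF prob_space_axioms QKC.sigma_finite_measure_axioms dens Fm])
  also have "\<dots> = (\<integral>\<^sup>+v. h (wv v) * pair_prob C (wv v) \<partial>distr P N V)"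
  proof (rule nn_integral_cong)
    fix v assume "v \<in> space (distr P N V)"
    then have v: "v \<in> space N" by simp
    have w: "wv v \<in> space (Pi\<^sub>M L (B n))" using measurable_space[OF wvm v] .
    have xxs: "xx v u \<in> space (Pi\<^sub>M J (B n))" if "u \<in> space QK" for u
      using measurable_space[OF xm, of "(v, u)"] v that by (simp add: space_pair_measure)
    have yys: "yy v u u' \<in> space (Pi\<^sub>M J (B n))" if "u \<in> space QK" "u' \<in> space QC" for u u'
      using measurable_space[OF ym, of "(v, u, u')"] v that by (simp add: space_pair_measure)
    \<comment> \<open>Shared codewords are drawn once, so the second tuple contributes conditional
      densities on \<open>C\<close> only.\<close>
    have fe: "ennreal (f v (u, u')) = cond_prod n {1..k} (xx v u) * cond_prod n C (yy v u u')"
      if u: "u \<in> space QK" "u' \<in> space QC" for u u'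
    proof -
      have j1: "cond_block k \<mu> p n j (u j) (fst v) \<ge> 0" if j: "j \<in> {1..k}" for j
        by (rule cond_block_nonneg) (use j u v in \<open>auto simp: QK_def space_PiM N_def space_pair_measure\<close>)
      have j2: "cond_block k \<mu> p n j (u' j) (fst v) \<ge> 0" if j: "j \<in> C" for j
        by (rule cond_block_nonneg) (use j u v CK in \<open>auto simp: QC_def space_PiM N_def space_pair_measure\<close>)
      have x0: "xx v u 0 = fst v" and y0: "yy v u u' 0 = fst v"
        using TC CK by (auto simp: xx_def yy_def merge_def wv_def)
      have xj: "xx v u j = u j" if "j \<in> {1..k}" for j using that by (auto simp: xx_def merge_def)
      have yj: "yy v u u' j = u' j" if "j \<in> C" for j using that TC(2) by (auto simp: yy_def merge_def)
      have c1: "cond_prod n {1..k} (xx v u) = ennreal (\<Prod>j\<in>{1..k}. cond_block k \<mu> p n j (u j) (fst v))"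
        unfolding cond_prod_def x0 by (subst prod_ennreal[symmetric]) (use j1 xj in auto)
      have c2: "cond_prod n C (yy v u u') = ennreal (\<Prod>j\<in>C. cond_block k \<mu> p n j (u' j) (fst v))"
        unfolding cond_prod_def y0 by (subst prod_ennreal[symmetric]) (use j2 yj in auto)
      show ?thesis unfolding c1 c2
        by (subst ennreal_mult[symmetric]) (use j1 j2 in \<open>auto simp: f_def split_beta intro!: prod_nonneg\<close>)
    qed
    have xvm[measurable]: "xx v \<in> QK \<rightarrow>\<^sub>M Pi\<^sub>M J (B n)"
      using measurable_compose[OF measurable_Pair1'[OF v] xm] by simp
    have yvm[measurable]: "(\<lambda>x. yy v (fst x) (snd x)) \<in> QK \<Otimes>\<^sub>M QC \<rightarrow>\<^sub>M Pi\<^sub>M J (B n)"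
      using measurable_compose[OF measurable_Pair1'[OF v] ym] by simp
    define f1 where "f1 u = indicator A (xx v u) * cond_prod n {1..k} (xx v u)" for u
    define f2 where "f2 u u' = indicator A (yy v u u') * cond_prod n C (yy v u u')" for u u'
    have f1m[measurable]: "f1 \<in> borel_measurable QK" unfolding f1_def[abs_def] by measurable
    have f2m[measurable]: "(\<lambda>x. f2 (fst x) (snd x)) \<in> borel_measurable (QK \<Otimes>\<^sub>M QC)" unfolding f2_def by measurable
    have f2m': "f2 u \<in> borel_measurable QC" if "u \<in> space QK" for u
      using measurable_compose[OF measurable_Pair1'[OF that] f2m] by simp
    have "(\<integral>\<^sup>+x. ennreal (f v x) * F (v, x) \<partial>(QK \<Otimes>\<^sub>M QC)) =
      (\<integral>\<^sup>+x. h (wv v) * (f1 (fst x) * f2 (fst x) (snd x)) \<partial>(QK \<Otimes>\<^sub>M QC))"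
    proof (rule nn_integral_cong)
      fix x assume x: "x \<in> space (QK \<Otimes>\<^sub>M QC)"
      obtain u u' where uu: "x = (u, u')" by (cases x)
      then have us: "u \<in> space QK" "u' \<in> space QC" using x by (auto simp: space_pair_measure)
      show "ennreal (f v x) * F (v, x) = h (wv v) * (f1 (fst x) * f2 (fst x) (snd x))"
        unfolding uu fe[OF us] by (simp add: F_def f1_def f2_def mult_ac)
    qed
    also have "\<dots> = h (wv v) * (\<integral>\<^sup>+x. f1 (fst x) * f2 (fst x) (snd x) \<partial>(QK \<Otimes>\<^sub>M QC))"
      by (rule nn_integral_cmult) measurable
    also have "(\<integral>\<^sup>+x. f1 (fst x) * f2 (fst x) (snd x) \<partial>(QK \<Otimes>\<^sub>M QC)) = (\<integral>\<^sup>+u. \<integral>\<^sup>+u'. f1 u * f2 u u' \<partial>QC \<partial>QK)"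
      by (subst QC.nn_integral_fst[symmetric]) auto
    also have "\<dots> = (\<integral>\<^sup>+u. f1 u * (\<integral>\<^sup>+u'. f2 u u' \<partial>QC) \<partial>QK)"
      by (intro nn_integral_cong nn_integral_cmult f2m')
    also have "\<dots> = pair_prob C (wv v)"
      unfolding pair_prob_def section_prob_def f1_def f2_def xx_def yy_def T_def QK_def QC_def by simp
    finally show "(\<integral>\<^sup>+x. ennreal (f v x) * F (v, x) \<partial>(QK \<Otimes>\<^sub>M QC)) = h (wv v) * pair_prob C (wv v)" .
  qed
  also have "\<dots> = (\<integral>\<^sup>+\<omega>. h (outer \<omega>) * pair_prob C (outer \<omega>) \<partial>P)"
  proof -
    have "section_prob C \<in> borel_measurable (Pi\<^sub>M T (B n))"
    proof -
      have "(\<lambda>x. indicator A x * cond_prod n C x) \<in> borel_measurable (Pi\<^sub>M (T \<union> C) (B n))"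
        unfolding TC by measurable
      from measurable_compose[OF measurable_merge this]
      have "(\<lambda>z. indicator A (merge T C z) * cond_prod n C (merge T C z)) \<in> borel_measurable (Pi\<^sub>M T (B n) \<Otimes>\<^sub>M QC)"
        by (simp add: QC_def)
      then show ?thesis unfolding section_prob_def[abs_def] T_def[symmetric] QC_def[symmetric]
        by (intro QC.borel_measurable_nn_integral) (simp add: split_beta)
    qed
    then have "(\<lambda>x. section_prob C (restrict x T)) \<in> borel_measurable (Pi\<^sub>M J (B n))"
      by (rule measurable_compose[OF measurable_restrict_subset[OF TC(3)]])
    then have "(\<lambda>x. indicator A x * cond_prod n {1..k} x * section_prob C (restrict x T)) \<in> borel_measurable (Pi\<^sub>M J (B n))"
      by measurable
    from merge_measurable_L[OF this]
    have "pair_prob C \<in> borel_measurable (Pi\<^sub>M L (B n))"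
      unfolding pair_prob_def[abs_def] T_def .
    then have "(\<lambda>v. h (wv v) * pair_prob C (wv v)) \<in> borel_measurable N" by measurable
    then show ?thesis by (subst nn_integral_distr[OF Vm]) (simp_all add: wV)
  qed
  finally show ?thesis .
qed

text \<open>The case of identical index tuples: nothing is drawn anew, the integral over the empty
  product is evaluation, and the squared indicator is the indicator itself.\<close>

lemma pair_prob_empty: "w \<in> space (Pi\<^sub>M L (B n)) \<Longrightarrow> pair_prob {} w = hit_prob n w"
proof -
  assume w: "w \<in> space (Pi\<^sub>M L (B n))"
  interpret Bn: product_sigma_finite "B n" by (rule product_sigma_finite_block)
  have "section_prob {} (restrict (merge L {1..k} (w, u)) (J - {})) = indicator A (merge L {1..k} (w, u))"
    if "u \<in> space (Pi\<^sub>M {1..k} (B n))" for u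
  proof -
    have "merge L {1..k} (w, u) \<in> space (Pi\<^sub>M (L \<union> {1..k}) (B n))" by (rule merge_space_block[OF w that])
    then have "merge J {} (restrict (merge L {1..k} (w, u)) J, \<lambda>_. undefined) = merge L {1..k} (w, u)"
      unfolding L_Un by (auto simp: space_PiM PiE_iff extensional_def fun_eq_iff) (auto simp: merge_def)
    then show ?thesis by (simp add: section_prob_def cond_prod_def Bn.nn_integral_empty)
  qed
  then show ?thesis
    unfolding pair_prob_def hit_prob_def by (intro nn_integral_cong) (auto simp: indicator_def)
qed

text \<open>Conditional independence: when all codewords are drawn anew, only \<open>w\<close> is
  shared and \<open>section_prob\<close> is the constant \<open>hit_prob n w\<close>.\<close>

lemma pair_prob_full: "w \<in> space (Pi\<^sub>M L (B n)) \<Longrightarrow> pair_prob {1..k} w = hit_prob n w * hit_prob n w"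
proof -
  assume w: "w \<in> space (Pi\<^sub>M L (B n))"
  have JK: "J - {1..k} = L" by auto
  have "restrict (merge L {1..k} (w, u)) (J - {1..k}) = w" for u
    using w unfolding JK by (auto simp: merge_def space_PiM PiE_iff extensional_def fun_eq_iff)
  then have r: "section_prob {1..k} (restrict (merge L {1..k} (w, u)) (J - {1..k})) = hit_prob n w" for u
    unfolding section_prob_def hit_prob_def JK by simp
  show ?thesis
    unfolding pair_prob_def r
    by (subst nn_integral_multc)
       (rule measurable_merge_section[OF w, where f = "\<lambda>x. indicator A x * cond_prod n {1..k} x"],
        simp only: L_Un, measurable, simp add: hit_prob_def)
qed

definition section_bound :: "nat set \<Rightarrow> real" where
  "section_bound C = exp (- (real n * (rate (J - C) C - 2 * (real (card C) + 1) * \<delta>)))"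

text \<open>The bound on sections is uniform in the shared coordinates, so it leaves the integral,
  and the first tuple contributes one factor \<open>hit_prob n w\<close>.\<close>

lemma pair_prob_le:
  assumes C: "C \<subseteq> {1..k}" and w: "w \<in> space (Pi\<^sub>M L (B n))"
  shows "pair_prob C w \<le> hit_prob n w * ennreal (section_bound C)"
proof -
  have JC: "J - C \<union> C = J" "(J - C) \<inter> C = {}" "0 \<in> J - C" using C by auto
  have "pair_prob C w \<le> (\<integral>\<^sup>+u. (indicator A (merge L {1..k} (w, u)) * cond_prod n {1..k} (merge L {1..k} (w, u))) *
     ennreal (section_bound C) \<partial>Pi\<^sub>M {1..k} (B n))"
    unfolding pair_prob_def
  proof (intro nn_integral_mono mult_left_mono)
    fix u assume u: "u \<in> space (Pi\<^sub>M {1..k} (B n))"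
    have "merge L {1..k} (w, u) \<in> space (Pi\<^sub>M J (B n))"
      using merge_space_block[OF w u] unfolding L_Un .
    then have "restrict (merge L {1..k} (w, u)) (J - C) \<in> space (Pi\<^sub>M (J - C) (B n))"
      by (auto simp: space_PiM)
    from section_upper_bound[OF JC(2,3) _ this n]
    show "section_prob C (restrict (merge L {1..k} (w, u)) (J - C)) \<le> ennreal (section_bound C)"
      unfolding section_prob_def section_bound_def JC by simp
  qed simp
  also have "\<dots> = hit_prob n w * ennreal (section_bound C)"
    unfolding hit_prob_def
    by (rule nn_integral_multc, rule measurable_merge_section[OF w, where f = "\<lambda>x. indicator A x * cond_prod n {1..k} x"])
       (simp only: L_Un, measurable)
  finally show ?thesis .
qed

section \<open>The second moment\<close>

definition differ :: "(nat \<Rightarrow> nat) \<Rightarrow> (nat \<Rightarrow> nat) \<Rightarrow> nat set" where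
  "differ m m' = {j \<in> {1..k}. m j \<noteq> m' j}"

text \<open>Outside \<open>D\<close> such an \<open>m'\<close> coincides with \<open>m\<close>, so
  restriction to \<open>D\<close> is injective.\<close>

lemma card_differ_le:
  assumes m: "m \<in> CB" and D: "D \<subseteq> {1..k}"
  shows "card {m' \<in> CB. differ m m' = D} \<le> (\<Prod>j\<in>D. M j)"
proof -
  have fin: "finite D" using D finite_subset by auto
  have "card {m' \<in> CB. differ m m' = D} \<le> card (Pi\<^sub>E D (\<lambda>j. {1..M j}))"
  proof (rule card_inj_on_le)
    show "inj_on (\<lambda>m'. restrict m' D) {m' \<in> CB. differ m m' = D}"
    proof (rule inj_onI)
      fix a b assume a: "a \<in> {m' \<in> CB. differ m m' = D}" and b: "b \<in> {m' \<in> CB. differ m m' = D}"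
        and r: "restrict a D = restrict b D"
      show "a = b"
      proof (rule PiE_ext)
        show "a \<in> (\<Pi>\<^sub>E j\<in>{1..k}. {1..M j})" "b \<in> (\<Pi>\<^sub>E j\<in>{1..k}. {1..M j})"
          using a b by (auto simp: codebook_indices_def)
        fix j assume j: "j \<in> {1..k}"
        show "a j = b j"
        proof (cases "j \<in> D")
          case True
          then show ?thesis using fun_cong[OF r, of j] by simp
        next
          case False
          then have "m j = a j" "m j = b j" using a b j by (auto simp: differ_def)
          then show ?thesis by simp
        qed
      qed
    qed
    show "(\<lambda>m'. restrict m' D) ` {m' \<in> CB. differ m m' = D} \<subseteq> Pi\<^sub>E D (\<lambda>j. {1..M j})"
    proof (intro image_subsetI restrict_PiE_iff[THEN iffD2] ballI)
      fix m' j assume "m' \<in> {m' \<in> CB. differ m m' = D}" "j \<in> D"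
      then show "m' j \<in> {1..M j}" using CB_range[of m' j] D by auto
    qed
    show "finite (Pi\<^sub>E D (\<lambda>j. {1..M j}))" using fin by (intro finite_PiE) auto
  qed
  also have "\<dots> = (\<Prod>j\<in>D. M j)" using fin by (simp add: card_PiE)
  finally show ?thesis .
qed

text \<open>The normalised variance: \<open>S\<close> is the nonempty set on which two index tuples
  agree, and \<open>c\<close> is a lower bound for the hitting probability.\<close>

definition pair_bound :: "real \<Rightarrow> real" where
  "pair_bound c = (\<Sum>S\<in>Pow {1..k} - {{}}. section_bound ({1..k} - S) / (c * (\<Prod>j\<in>S. real (M j))))"

text \<open>For fixed \<open>m\<close> at most the product of the M_j over \<open>D\<close> tuples
  differ from it exactly on \<open>D\<close>; division by N^2 leaves 1/N times the reciprocal
  product over the complement of \<open>D\<close>. The term \<open>a / N\<^sup>2\<close> is granted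
  to every pair, which costs \<open>a\<close> in total.\<close>

lemma sum_differ_le:
  assumes ne: "CB \<noteq> {}" and c: "c > 0" and a: "a \<ge> 0"
  defines "N \<equiv> real (card CB)"
  shows "(\<Sum>m\<in>CB. \<Sum>m'\<in>CB. a / N\<^sup>2 + (\<Sum>D\<in>Pow {1..k} - {{1..k}}. if differ m m' = D then section_bound D / (c * N\<^sup>2) else 0))
    \<le> a + pair_bound c"
proof -
  have N: "N > 0" using ne finite_CB by (simp add: N_def card_gt_0_iff)
  have M: "real (M j) > 0" if "j \<in> {1..k}" for j
    using ne CB_range[OF _ that] by fastforce
  have Nprod: "N = (\<Prod>j\<in>D. real (M j)) * (\<Prod>j\<in>{1..k} - D. real (M j))" if "D \<subseteq> {1..k}" for D
    using prod.subset_diff[OF that, of "\<lambda>j. real (M j)"] by (simp add: N_def card_CB mult.commute)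
  define DD where "DD = Pow {1..k} - {{1..k::nat}}"
  have E0: "section_bound D \<ge> 0" for D by (simp add: section_bound_def)
  have inner: "(\<Sum>m'\<in>CB. a / N\<^sup>2 + (\<Sum>D\<in>DD. if differ m m' = D then section_bound D / (c * N\<^sup>2) else 0))
      \<le> (a + pair_bound c) / N" if m: "m \<in> CB" for m
  proof -
    have "(\<Sum>m'\<in>CB. a / N\<^sup>2 + (\<Sum>D\<in>DD. if differ m m' = D then section_bound D / (c * N\<^sup>2) else 0)) =
      N * (a / N\<^sup>2) + (\<Sum>D\<in>DD. \<Sum>m'\<in>CB. if differ m m' = D then section_bound D / (c * N\<^sup>2) else 0)"
      unfolding sum.distrib by (subst sum.swap) (simp add: N_def)
    also have "(\<Sum>D\<in>DD. \<Sum>m'\<in>CB. if differ m m' = D then section_bound D / (c * N\<^sup>2) else 0) =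
      (\<Sum>D\<in>DD. real (card {m' \<in> CB. differ m m' = D}) * (section_bound D / (c * N\<^sup>2)))"
      using finite_CB by (simp add: sum.If_cases Int_def)
    also have "\<dots> \<le> (\<Sum>D\<in>DD. (\<Prod>j\<in>D. real (M j)) * (section_bound D / (c * N\<^sup>2)))"
    proof (intro sum_mono mult_right_mono)
      fix D assume "D \<in> DD"
      then have "card {m' \<in> CB. differ m m' = D} \<le> (\<Prod>j\<in>D. M j)"
        by (intro card_differ_le[OF m]) (auto simp: DD_def)
      then show "real (card {m' \<in> CB. differ m m' = D}) \<le> (\<Prod>j\<in>D. real (M j))"
        by (metis of_nat_le_iff of_nat_prod)
    qed (use c E0 in auto)
    also have "\<dots> = (\<Sum>D\<in>DD. section_bound D / (c * (\<Prod>j\<in>{1..k} - D. real (M j))) / N)"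
    proof (rule sum.cong[OF refl])
      fix D assume "D \<in> DD"
      then have D: "D \<subseteq> {1..k}" by (auto simp: DD_def)
      have P: "(\<Prod>j\<in>D. real (M j)) > 0" "(\<Prod>j\<in>{1..k} - D. real (M j)) > 0"
        using D M by (auto intro!: prod_pos)
      define x y where "x = (\<Prod>j\<in>D. real (M j))" and "y = (\<Prod>j\<in>{1..k} - D. real (M j))"
      have "x * (section_bound D / (c * (x * y)\<^sup>2)) = section_bound D / (c * y) / (x * y)"
        using P c by (simp add: x_def[symmetric] y_def[symmetric] power2_eq_square)
      then show "(\<Prod>j\<in>D. real (M j)) * (section_bound D / (c * N\<^sup>2)) = section_bound D / (c * (\<Prod>j\<in>{1..k} - D. real (M j))) / N"
        unfolding Nprod[OF D] x_def y_def .
    qed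
    also have "\<dots> = (\<Sum>D\<in>DD. section_bound D / (c * (\<Prod>j\<in>{1..k} - D. real (M j)))) / N"
      by (simp add: sum_divide_distrib)
    \<comment> \<open>Complementation exchanges the difference sets other than \<open>{1..k}\<close>
      with the nonempty agreement sets.\<close>
    also have "(\<Sum>D\<in>DD. section_bound D / (c * (\<Prod>j\<in>{1..k} - D. real (M j)))) = pair_bound c"
      unfolding pair_bound_def
      by (rule sum.reindex_bij_witness[of _ "\<lambda>S. {1..k} - S" "\<lambda>D. {1..k} - D"])
         (auto simp: DD_def double_diff)
    also have "N * (a / N\<^sup>2) + pair_bound c / N = (a + pair_bound c) / N"
      using N by (simp add: power2_eq_square field_simps)
    finally show ?thesis by simp
  qed
  have "(\<Sum>m\<in>CB. \<Sum>m'\<in>CB. a / N\<^sup>2 + (\<Sum>D\<in>DD. if differ m m' = D then section_bound D / (c * N\<^sup>2) else 0))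
    \<le> (\<Sum>m\<in>CB. (a + pair_bound c) / N)"
    by (intro sum_mono inner)
  also have "\<dots> = a + pair_bound c" using N by (simp add: N_def)
  finally show ?thesis by (simp add: DD_def)
qed

text \<open>Chebyshev's inequality for the number \<open>X\<close> of typical tuples, in the form
  \<open>1{X = 0} + 2 t X \<le> 1 + (t X)\<^sup>2\<close> where \<open>1 / t\<close> is the conditional mean of \<open>X\<close>; this way no
  subtraction of \<^typ>\<open>ennreal\<close> values occurs.\<close>

lemma second_moment:
  assumes ne: "CB \<noteq> {}" and c: "c > 0" and lower: "\<And>w. w \<in> good n \<Longrightarrow> ennreal c \<le> hit_prob n w"
  shows "prob {\<omega> \<in> space P. outer \<omega> \<in> good n \<and> (\<forall>m\<in>CB. tup m \<omega> \<notin> A)} \<le> pair_bound c"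
proof -
  define N where "N = real (card CB)"
  have N: "N > 0" using ne finite_CB by (simp add: N_def card_gt_0_iff)
  define r where "r w = enn2real (hit_prob n w)" for w
  have qr: "hit_prob n w = ennreal (r w)" if "w \<in> space (Pi\<^sub>M L (B n))" for w
    using hit_prob_le_1[OF that] by (cases "hit_prob n w") (auto simp: r_def top_unique)
  have r0: "r w \<ge> 0" for w by (simp add: r_def)
  have good_space: "w \<in> space (Pi\<^sub>M L (B n))" if "w \<in> good n" for w using that by (simp add: good_def)
  have rc: "c \<le> r w" "r w > 0" if "w \<in> good n" for w
  proof -
    show "c \<le> r w" using lower[OF that] qr[OF good_space[OF that]] r0[of w] by (simp add: ennreal_le_iff)
    then show "r w > 0" using c by simp
  qed
  have rm[measurable]: "r \<in> borel_measurable (Pi\<^sub>M L (B n))" unfolding r_def[abs_def] by measurable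
  \<comment> \<open>Given outer blocks \<open>w\<close>, the number of typical tuples has mean
    \<open>N * r w\<close>. These weights are the inverse mean and its square on good
    \<open>w\<close>, and 0 elsewhere.\<close>
  define h1 h2 where "h1 w = indicator (good n) w * ennreal (1 / (N * r w))"
    and "h2 w = indicator (good n) w * ennreal ((1 / (N * r w))\<^sup>2)" for w
  have hm[measurable]: "h1 \<in> borel_measurable (Pi\<^sub>M L (B n))" "h2 \<in> borel_measurable (Pi\<^sub>M L (B n))"
    unfolding h1_def[abs_def] h2_def[abs_def] by measurable
  define Z where "Z = {\<omega> \<in> space P. outer \<omega> \<in> good n \<and> (\<forall>m\<in>CB. tup m \<omega> \<notin> A)}"
  have tupA[measurable]: "{\<omega> \<in> space P. tup m \<omega> \<in> A} \<in> sets P" if "m \<in> CB" for m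
    using measurable_sets_Collect[OF tup_measurable[OF that]] typset_J_sets
    by (simp add: measurable_sets_Collect[OF tup_measurable[OF that], of "\<lambda>x. x \<in> A"])
  have [measurable]: "(\<lambda>\<omega>. indicator A (tup m \<omega>) :: ennreal) \<in> borel_measurable P" if "m \<in> CB" for m
    by (rule measurable_compose[OF tup_measurable[OF that]]) measurable
  have Zs[measurable]: "Z \<in> sets P"
  proof -
    have "Z = {\<omega> \<in> space P. outer \<omega> \<in> good n} - (\<Union>m\<in>CB. {\<omega> \<in> space P. tup m \<omega> \<in> A})"
      by (auto simp: Z_def)
    moreover have "(\<Union>m\<in>CB. {\<omega> \<in> space P. tup m \<omega> \<in> A}) \<in> sets P"
      using finite_CB tupA by (rule sets.finite_UN)
    ultimately show ?thesis by auto
  qed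
  define X where "X \<omega> = (\<Sum>m\<in>CB. indicator A (tup m \<omega>) :: ennreal)" for \<omega>
  have Xm[measurable]: "X \<in> borel_measurable P" unfolding X_def[abs_def] by measurable
  define gr where "gr = prob {\<omega> \<in> space P. outer \<omega> \<in> good n}"
  have gs: "{\<omega> \<in> space P. outer \<omega> \<in> good n} \<in> sets P" by measurable
  have Ig: "(\<integral>\<^sup>+\<omega>. indicator (good n) (outer \<omega>) \<partial>P) = ennreal gr"
  proof -
    have "(\<integral>\<^sup>+\<omega>. indicator (good n) (outer \<omega>) \<partial>P) = (\<integral>\<^sup>+\<omega>. indicator {\<omega> \<in> space P. outer \<omega> \<in> good n} \<omega> \<partial>P)"
      by (intro nn_integral_cong) (auto simp: indicator_def)
    then show ?thesis using gs by (simp add: gr_def emeasure_eq_measure)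
  qed
  have outer_space: "outer \<omega> \<in> space (Pi\<^sub>M L (B n))" if "\<omega> \<in> space P" for \<omega>
    using measurable_space[OF outer_measurable that] .
  have pointwise: "indicator Z \<omega> + 2 * (h1 (outer \<omega>) * X \<omega>) \<le> indicator (good n) (outer \<omega>) + h2 (outer \<omega>) * (X \<omega> * X \<omega>)"
    if \<omega>: "\<omega> \<in> space P" for \<omega>
  proof (cases "outer \<omega> \<in> good n")
    case False
    then show ?thesis by (simp add: Z_def h1_def)
  next
    case nnmarg: True
    define x where "x = real (card {m \<in> CB. tup m \<omega> \<in> A})"
    have Xx: "X \<omega> = ennreal x"
      using finite_CB by (simp add: X_def x_def indicator_def of_bool_def sum.If_cases Int_def ennreal_of_nat_eq_real_of_nat)
    define z where "z = (if \<omega> \<in> Z then 1 else 0 :: real)"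
    have zx: "x = 0" if "z = 1"
    proof -
      have "{m \<in> CB. tup m \<omega> \<in> A} = {}" using that by (auto simp: z_def Z_def split: if_splits)
      then show ?thesis by (simp only: x_def card.empty of_nat_0)
    qed
    have z01: "z = 0 \<or> z = 1" by (auto simp: z_def)
    have Zz: "indicator Z \<omega> = ennreal z" by (simp add: z_def indicator_def)
    define t where "t = 1 / (N * r (outer \<omega>))"
    have t: "t \<ge> 0" using N r0 by (simp add: t_def)
    have x0: "x \<ge> 0" by (simp add: x_def)
    \<comment> \<open>If z = 1 then x = 0; otherwise this is the nonnegativity of (1 - t
      x)^2.\<close>
    have "z + 2 * (t * x) \<le> 1 + t\<^sup>2 * (x * x)"
    proof (cases "z = 1")
      case True
      then show ?thesis using zx by simp
    next
      case False
      then have "z = 0" using z01 by simp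
      then show ?thesis using sum_squares_bound[of 1 "t * x"] by (simp add: power2_eq_square algebra_simps)
    qed
    then have "ennreal (z + 2 * (t * x)) \<le> ennreal (1 + t\<^sup>2 * (x * x))" by (rule ennreal_leI)
    moreover have "indicator Z \<omega> + 2 * (h1 (outer \<omega>) * X \<omega>) = ennreal (z + 2 * (t * x))"
      using nnmarg t x0 z01 by (auto simp: Zz Xx h1_def t_def[symmetric] ennreal_plus ennreal_mult)
    moreover have "indicator (good n) (outer \<omega>) + h2 (outer \<omega>) * (X \<omega> * X \<omega>) = ennreal (1 + t\<^sup>2 * (x * x))"
      using nnmarg t x0 by (simp add: Xx h2_def t_def[symmetric] ennreal_plus ennreal_mult)
    ultimately show ?thesis by simp
  qed
  have Xint: "(\<integral>\<^sup>+\<omega>. h1 (outer \<omega>) * X \<omega> \<partial>P) = ennreal gr"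
  proof -
    have "(\<integral>\<^sup>+\<omega>. h1 (outer \<omega>) * X \<omega> \<partial>P) = (\<Sum>m\<in>CB. \<integral>\<^sup>+\<omega>. h1 (outer \<omega>) * indicator A (tup m \<omega>) \<partial>P)"
      unfolding X_def sum_distrib_left by (rule nn_integral_sum) measurable
    also have "\<dots> = (\<Sum>m\<in>CB. ennreal (1 / N) * ennreal gr)"
    proof (rule sum.cong[OF refl])
      fix m assume m: "m \<in> CB"
      \<comment> \<open>Squaring the indicator turns the first moment into the diagonal case of
        \<open>pair_expectation\<close>.\<close>
      have "(\<integral>\<^sup>+\<omega>. h1 (outer \<omega>) * indicator A (tup m \<omega>) \<partial>P) =
        (\<integral>\<^sup>+\<omega>. h1 (outer \<omega>) * (indicator A (tup m \<omega>) * indicator A (tup m \<omega>)) \<partial>P)"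
        by (intro nn_integral_cong) (auto simp: indicator_def)
      also have "\<dots> = (\<integral>\<^sup>+\<omega>. h1 (outer \<omega>) * pair_prob {} (outer \<omega>) \<partial>P)"
        by (rule pair_expectation[OF m m]) auto
      also have "\<dots> = (\<integral>\<^sup>+\<omega>. ennreal (1 / N) * indicator (good n) (outer \<omega>) \<partial>P)"
      proof (rule nn_integral_cong)
        fix \<omega> assume "\<omega> \<in> space P"
        note s = outer_space[OF this]
        show "h1 (outer \<omega>) * pair_prob {} (outer \<omega>) = ennreal (1 / N) * indicator (good n) (outer \<omega>)"
          using N rc(2)[of "outer \<omega>"]
          by (cases "outer \<omega> \<in> good n") (auto simp: pair_prob_empty[OF s] qr[OF s] h1_def ennreal_mult[symmetric])
      qed
      also have "\<dots> = ennreal (1 / N) * ennreal gr"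
        unfolding Ig[symmetric] by (rule nn_integral_cmult) measurable
      finally show "(\<integral>\<^sup>+\<omega>. h1 (outer \<omega>) * indicator A (tup m \<omega>) \<partial>P) = ennreal (1 / N) * ennreal gr" .
    qed
    also have "\<dots> = ennreal N * (ennreal (1 / N) * ennreal gr)"
      by (simp add: N_def ennreal_of_nat_eq_real_of_nat)
    also have "\<dots> = ennreal gr" using N by (simp add: ennreal_mult[symmetric] gr_def)
    finally show ?thesis .
  qed
  \<comment> \<open>For a pair that differs everywhere only the first term is needed. Otherwise
    exactly one summand is active, the one for the actual difference set.\<close>
  define b where "b m m' = gr / N\<^sup>2 + (\<Sum>D\<in>Pow {1..k} - {{1..k}}. if differ m m' = D then section_bound D / (c * N\<^sup>2) else 0)" for m m'
  have b0: "b m m' \<ge> 0" for m m'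
    using c by (auto simp: b_def gr_def section_bound_def intro!: add_nonneg_nonneg sum_nonneg)
  have pair: "(\<integral>\<^sup>+\<omega>. h2 (outer \<omega>) * (indicator A (tup m \<omega>) * indicator A (tup m' \<omega>)) \<partial>P) \<le> ennreal (b m m')"
    if m: "m \<in> CB" "m' \<in> CB" for m m'
  proof -
    define C where "C = differ m m'"
    have e: "(\<integral>\<^sup>+\<omega>. h2 (outer \<omega>) * (indicator A (tup m \<omega>) * indicator A (tup m' \<omega>)) \<partial>P) =
      (\<integral>\<^sup>+\<omega>. h2 (outer \<omega>) * pair_prob C (outer \<omega>) \<partial>P)"
      by (rule pair_expectation[OF m]) (auto simp: C_def differ_def)
    have CK: "C \<subseteq> {1..k}" by (auto simp: C_def differ_def)
    show ?thesis
    proof (cases "C = {1..k}")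
      case True
      have "(\<integral>\<^sup>+\<omega>. h2 (outer \<omega>) * pair_prob C (outer \<omega>) \<partial>P) =
        (\<integral>\<^sup>+\<omega>. ennreal (1 / N\<^sup>2) * indicator (good n) (outer \<omega>) \<partial>P)"
      proof (rule nn_integral_cong)
        fix \<omega> assume "\<omega> \<in> space P"
        note s = outer_space[OF this]
        show "h2 (outer \<omega>) * pair_prob C (outer \<omega>) = ennreal (1 / N\<^sup>2) * indicator (good n) (outer \<omega>)"
          using N rc(2)[of "outer \<omega>"] unfolding True pair_prob_full[OF s] qr[OF s]
          by (cases "outer \<omega> \<in> good n")
             (auto simp: h2_def ennreal_mult[symmetric] power2_eq_square)
      qed
      also have "\<dots> = ennreal (1 / N\<^sup>2) * ennreal gr"
        unfolding Ig[symmetric] by (rule nn_integral_cmult) measurable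
      also have "\<dots> = ennreal (gr / N\<^sup>2)" using N by (simp add: ennreal_mult[symmetric] gr_def)
      also have "\<dots> \<le> ennreal (b m m')"
        using c by (intro ennreal_leI) (auto simp: b_def section_bound_def intro!: sum_nonneg)
      finally show ?thesis using e by simp
    next
      case False
      have "(\<integral>\<^sup>+\<omega>. h2 (outer \<omega>) * pair_prob C (outer \<omega>) \<partial>P) \<le> (\<integral>\<^sup>+\<omega>. ennreal (section_bound C / (c * N\<^sup>2)) \<partial>P)"
      proof (rule nn_integral_mono)
        fix \<omega> assume "\<omega> \<in> space P"
        note s = outer_space[OF this]
        show "h2 (outer \<omega>) * pair_prob C (outer \<omega>) \<le> ennreal (section_bound C / (c * N\<^sup>2))"
        proof (cases "outer \<omega> \<in> good n")
          case True
          define \<rho> where "\<rho> = r (outer \<omega>)"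
          have \<rho>: "\<rho> > 0" "c \<le> \<rho>" using rc[OF True] by (auto simp: \<rho>_def)
          have E0: "section_bound C \<ge> 0" by (simp add: section_bound_def)
          \<comment> \<open>One of the two factors 1/\<rho> cancels against the hitting probability
            in the pair bound; the other is at most 1/c.\<close>
          have "h2 (outer \<omega>) * pair_prob C (outer \<omega>) \<le> h2 (outer \<omega>) * (hit_prob n (outer \<omega>) * ennreal (section_bound C))"
            by (intro mult_left_mono pair_prob_le[OF CK s]) simp
          also have "\<dots> = ennreal ((1 / (N * \<rho>))\<^sup>2 * (\<rho> * section_bound C))"
            using True \<rho> E0 N by (simp add: h2_def qr[OF s] \<rho>_def[symmetric] ennreal_mult[symmetric])
          also have "(1 / (N * \<rho>))\<^sup>2 * (\<rho> * section_bound C) = section_bound C / (\<rho> * N\<^sup>2)"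
            using \<rho> N by (simp add: power2_eq_square field_simps)
          also have "ennreal \<dots> \<le> ennreal (section_bound C / (c * N\<^sup>2))"
            using \<rho> N E0 c by (intro ennreal_leI divide_left_mono mult_right_mono mult_pos_pos) auto
          finally show ?thesis .
        qed (simp add: h2_def)
      qed
      also have "\<dots> = ennreal (section_bound C / (c * N\<^sup>2))" by (simp add: emeasure_space_1)
      also have "\<dots> \<le> ennreal (b m m')"
      proof (rule ennreal_leI)
        have "section_bound C / (c * N\<^sup>2) = (\<Sum>D\<in>Pow {1..k} - {{1..k}}. if differ m m' = D then section_bound D / (c * N\<^sup>2) else 0)"
          using False CK by (subst sum.delta') (auto simp: C_def)
        also have "\<dots> \<le> b m m'" by (simp add: b_def gr_def)
        finally show "section_bound C / (c * N\<^sup>2) \<le> b m m'" .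
      qed
      finally show ?thesis using e by simp
    qed
  qed
  have X2: "(\<integral>\<^sup>+\<omega>. h2 (outer \<omega>) * (X \<omega> * X \<omega>) \<partial>P) \<le> ennreal (gr + pair_bound c)"
  proof -
    have "(\<integral>\<^sup>+\<omega>. h2 (outer \<omega>) * (X \<omega> * X \<omega>) \<partial>P) =
      (\<integral>\<^sup>+\<omega>. (\<Sum>m\<in>CB. \<Sum>m'\<in>CB. h2 (outer \<omega>) * (indicator A (tup m \<omega>) * indicator A (tup m' \<omega>))) \<partial>P)"
      unfolding X_def sum_product unfolding sum_distrib_left ..
    also have "\<dots> = (\<Sum>m\<in>CB. \<integral>\<^sup>+\<omega>. (\<Sum>m'\<in>CB. h2 (outer \<omega>) * (indicator A (tup m \<omega>) * indicator A (tup m' \<omega>))) \<partial>P)"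
      by (rule nn_integral_sum) measurable
    also have "\<dots> = (\<Sum>m\<in>CB. \<Sum>m'\<in>CB. \<integral>\<^sup>+\<omega>. h2 (outer \<omega>) * (indicator A (tup m \<omega>) * indicator A (tup m' \<omega>)) \<partial>P)"
      by (intro sum.cong refl nn_integral_sum) measurable
    also have "\<dots> \<le> (\<Sum>m\<in>CB. \<Sum>m'\<in>CB. ennreal (b m m'))"
      by (intro sum_mono pair)
    also have "\<dots> = ennreal (\<Sum>m\<in>CB. \<Sum>m'\<in>CB. b m m')"
      using b0 by (simp add: sum_ennreal sum_nonneg)
    also have "\<dots> \<le> ennreal (gr + pair_bound c)"
      unfolding b_def N_def by (intro ennreal_leI sum_differ_le[OF ne c]) (simp add: gr_def)
    finally show ?thesis .
  qed
  have pb: "pair_bound c \<ge> 0" using c by (auto simp: pair_bound_def section_bound_def intro!: sum_nonneg divide_nonneg_nonneg mult_nonneg_nonneg prod_nonneg)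
  have gr0: "gr \<ge> 0" by (simp add: gr_def)
  have e1: "ennreal (prob Z) + 2 * ennreal gr = ennreal (prob Z + 2 * gr)"
    using gr0 by (simp add: ennreal_plus ennreal_mult)
  have e2: "ennreal gr + ennreal (gr + pair_bound c) = ennreal (gr + (gr + pair_bound c))"
    by (rule ennreal_plus[symmetric]) (use gr0 pb in auto)
  \<comment> \<open>Integrating the pointwise inequality: the first moment gives 2 \<open>gr\<close>
    on the left, the constant and the second moment give 2 \<open>gr\<close> plus
    \<open>pair_bound c\<close> on the right, and \<open>gr\<close> cancels.\<close>
  have "ennreal (prob Z) + 2 * ennreal gr = (\<integral>\<^sup>+\<omega>. indicator Z \<omega> + 2 * (h1 (outer \<omega>) * X \<omega>) \<partial>P)"
    by (subst nn_integral_add) (auto simp: Xint nn_integral_cmult emeasure_eq_measure)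
  also have "\<dots> \<le> (\<integral>\<^sup>+\<omega>. indicator (good n) (outer \<omega>) + h2 (outer \<omega>) * (X \<omega> * X \<omega>) \<partial>P)"
    by (intro nn_integral_mono pointwise)
  also have "\<dots> = ennreal gr + (\<integral>\<^sup>+\<omega>. h2 (outer \<omega>) * (X \<omega> * X \<omega>) \<partial>P)"
    by (subst nn_integral_add) (auto simp: Ig)
  also have "\<dots> \<le> ennreal gr + ennreal (gr + pair_bound c)"
    by (intro add_left_mono X2)
  finally have "ennreal (prob Z + 2 * gr) \<le> ennreal (gr + (gr + pair_bound c))"
    unfolding e1 e2 .
  then have "prob Z + 2 * gr \<le> gr + (gr + pair_bound c)"
    using gr0 pb by (subst (asm) ennreal_le_iff) auto
  then show ?thesis by (simp add: Z_def)
qed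

section \<open>Bounds at a fixed block length\<close>

lemma covering_sets: "{\<omega> \<in> space P. \<exists>m\<in>CB. tup m \<omega> \<in> A} \<in> sets P"
proof -
  have "{\<omega> \<in> space P. \<exists>m\<in>CB. tup m \<omega> \<in> A} = (\<Union>m\<in>CB. tup m -` A \<inter> space P)" by auto
  also have "\<dots> \<in> sets P"
    using finite_CB measurable_sets[OF tup_measurable typset_J_sets] by (rule sets.finite_UN)
  finally show ?thesis .
qed

text \<open>Failure means that the outer blocks are not good, which costs atypical mass under p, or
  that they are good and no tuple hits. The latter is the second-moment estimate, with
  \<open>c\<close> the lower bound for good conditions and exp(n R_j) in place of M_j.\<close>

lemma direct_bound:
  assumes R: "\<And>j. j \<in> {1..k} \<Longrightarrow> exp (real n * R j) \<le> real (M j)"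
  shows "ennreal (1 - covering_prob P k M A U0 U Ul) \<le>
    2 * (\<integral>\<^sup>+u. nnblock n J u * indicator (- typset n J) u \<partial>Pi\<^sub>M J (B n)) +
    ennreal (\<Sum>S\<in>Pow {1..k} - {{}}. 2 * exp (- (real n * ((\<Sum>j\<in>S. R j) + rate (J - ({1..k} - S)) ({1..k} - S)
      - 2 * (real (card ({1..k} - S)) + 1) * \<delta> - rate L {1..k} - 2 * (real k + 1) * \<delta>))))"
    (is "_ \<le> ?a + ennreal ?b")
proof -
  define c where "c = exp (- (real n * (rate L {1..k} + 2 * (real k + 1) * \<delta>))) / 2"
  have c: "c > 0" by (simp add: c_def)
  \<comment> \<open>M_j is an integer bounded below by a positive number, so the codebook is
    nonempty even for negative R_j.\<close>
  have Mpos: "M j \<ge> 1" if "j \<in> {1..k}" for j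
    using order_less_le_trans[OF exp_gt_zero R[OF that]] by simp
  then have "(\<lambda>j\<in>{1..k}. 1) \<in> CB" by (auto simp: codebook_indices_def)
  then have ne: "CB \<noteq> {}" by auto
  define Z where "Z = {\<omega> \<in> space P. outer \<omega> \<in> good n \<and> (\<forall>m\<in>CB. tup m \<omega> \<notin> A)}"
  define Y where "Y = {\<omega> \<in> space P. outer \<omega> \<notin> good n}"
  have Cs: "{\<omega> \<in> space P. \<exists>m\<in>CB. tup m \<omega> \<in> A} \<in> sets P" by (rule covering_sets)
  have Ys: "Y \<in> sets P" unfolding Y_def by measurable
  have Zs: "Z \<in> sets P"
  proof -
    have "Z = (space P - Y) - {\<omega> \<in> space P. \<exists>m\<in>CB. tup m \<omega> \<in> A}" by (auto simp: Z_def Y_def)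
    then show ?thesis using Ys Cs by auto
  qed
  have "1 - covering_prob P k M A U0 U Ul = prob (space P - {\<omega> \<in> space P. \<exists>m\<in>CB. tup m \<omega> \<in> A})"
    unfolding covering_prob_def by (rule prob_compl[OF Cs, symmetric])
  also have "space P - {\<omega> \<in> space P. \<exists>m\<in>CB. tup m \<omega> \<in> A} \<subseteq> Y \<union> Z" by (auto simp: Y_def Z_def)
  then have "prob (space P - {\<omega> \<in> space P. \<exists>m\<in>CB. tup m \<omega> \<in> A}) \<le> prob (Y \<union> Z)"
    using Ys Zs by (intro finite_measure_mono) auto
  also have "prob (Y \<union> Z) \<le> prob Y + prob Z" by (rule measure_Un_le[OF Ys Zs])
  finally have "ennreal (1 - covering_prob P k M A U0 U Ul) \<le> ennreal (prob Y) + ennreal (prob Z)"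
    by (simp flip: ennreal_plus add: ennreal_leI)
  moreover have "ennreal (prob Y) \<le> ?a"
    using emeasure_outer_not_good[OF ne] by (simp add: Y_def emeasure_eq_measure)
  moreover have "prob Z \<le> pair_bound c"
    unfolding Z_def by (rule second_moment[OF ne c]) (unfold c_def, rule hit_prob_lower_bound[OF _ n])
  moreover have "pair_bound c \<le> ?b"
    unfolding pair_bound_def
  proof (rule sum_mono)
    fix S assume S: "S \<in> Pow {1..k} - {{}}"
    then have SK: "S \<subseteq> {1..k}" "finite S" by (auto intro: finite_subset)
    define x where "x = exp (real n * (\<Sum>j\<in>S. R j))"
    have "x = (\<Prod>j\<in>S. exp (real n * R j))"
      using SK by (simp add: x_def sum_distrib_left exp_sum)
    also have "\<dots> \<le> (\<Prod>j\<in>S. real (M j))"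
      using SK R by (intro prod_mono) auto
    finally have x: "x \<le> (\<Prod>j\<in>S. real (M j))" "x > 0" by (auto simp: x_def)
    have "section_bound ({1..k} - S) / (c * (\<Prod>j\<in>S. real (M j))) \<le> section_bound ({1..k} - S) / (c * x)"
      using x c by (intro divide_left_mono mult_left_mono mult_pos_pos) (auto simp: section_bound_def)
    also have "\<dots> = 2 * exp (- (real n * ((\<Sum>j\<in>S. R j) + rate (J - ({1..k} - S)) ({1..k} - S)
      - 2 * (real (card ({1..k} - S)) + 1) * \<delta> - rate L {1..k} - 2 * (real k + 1) * \<delta>)))"
    proof -
      have ex: "exp (- a) / (exp (- b) / 2 * exp y) = 2 * exp (- (a + y - b))" for a b y :: real
        by (simp add: exp_diff exp_minus exp_add field_simps)
      show ?thesis
        unfolding section_bound_def c_def x_def ex by (simp add: algebra_simps)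
    qed
    finally show "section_bound ({1..k} - S) / (c * (\<Prod>j\<in>S. real (M j))) \<le> 2 * exp (- (real n * ((\<Sum>j\<in>S. R j) + rate (J - ({1..k} - S)) ({1..k} - S)
      - 2 * (real (card ({1..k} - S)) + 1) * \<delta> - rate L {1..k} - 2 * (real k + 1) * \<delta>)))" .
  qed
  ultimately show ?thesis
    by (meson add_mono ennreal_leI order_trans)
qed

text \<open>Integrating over the codewords in \<open>S\<close> first gives a section bound uniform
  in the outer blocks; the density of the outer blocks is then dominated by
  \<open>nnblock n L\<close>, of total mass at most 1.\<close>

lemma subtuple_typical_bound:
  assumes m: "m \<in> CB" and S: "S \<subseteq> {1..k}"
  shows "emeasure P {\<omega> \<in> space P. restrict (tup m \<omega>) (L \<union> S) \<in> typset n (L \<union> S)} \<le>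
    ennreal (exp (- (real n * (rate L S - 2 * (real (card S) + 1) * \<delta>))))" (is "_ \<le> ennreal ?E")
proof -
  interpret Bn: product_sigma_finite "B n" by (rule product_sigma_finite_block)
  have T: "L \<union> S \<subseteq> J" "0 \<in> L \<union> S" "L \<inter> S = {}" "finite S"
    using S finite_subset by auto
  note ts[measurable] = typset_sets[OF T(1), of n]
  have rm[measurable]: "(\<lambda>\<omega>. restrict (tup m \<omega>) (L \<union> S)) \<in> P \<rightarrow>\<^sub>M Pi\<^sub>M (L \<union> S) (B n)"
    by (rule measurable_compose[OF tup_measurable[OF m] measurable_restrict_subset[OF T(1)]])
  have s: "{\<omega> \<in> space P. restrict (tup m \<omega>) (L \<union> S) \<in> typset n (L \<union> S)} \<in> sets P"
    using measurable_sets[OF rm ts] by (simp add: vimage_def Int_def conj_commute)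
  have [measurable]: "base_block n \<in> borel_measurable (Pi\<^sub>M (L \<union> S) (B n))"
    "cond_prod n (L \<union> S - {0}) \<in> borel_measurable (Pi\<^sub>M (L \<union> S) (B n))"
    "cond_prod n S \<in> borel_measurable (Pi\<^sub>M (L \<union> S) (B n))"
    by (rule base_block_measurable cond_prod_measurable; use S T in fastforce)+
  have Gm: "nnblock n L \<in> borel_measurable (Pi\<^sub>M L (B n))" by (rule nnblock_measurable) auto
  have "emeasure P {\<omega> \<in> space P. restrict (tup m \<omega>) (L \<union> S) \<in> typset n (L \<union> S)} =
    (\<integral>\<^sup>+\<omega>. indicator {\<omega> \<in> space P. restrict (tup m \<omega>) (L \<union> S) \<in> typset n (L \<union> S)} \<omega> \<partial>P)"
    using s by simp
  also have "\<dots> = (\<integral>\<^sup>+\<omega>. indicator (typset n (L \<union> S)) (restrict (tup m \<omega>) (L \<union> S)) \<partial>P)"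
    by (intro nn_integral_cong) (auto simp: indicator_def)
  also have "\<dots> \<le> (\<integral>\<^sup>+u. indicator (typset n (L \<union> S)) u * (base_block n u * cond_prod n (L \<union> S - {0}) u) \<partial>Pi\<^sub>M (L \<union> S) (B n))"
    by (rule tup_law_le[OF m T(1,2)]) measurable
  also have "\<dots> = (\<integral>\<^sup>+w. \<integral>\<^sup>+u. indicator (typset n (L \<union> S)) (merge L S (w, u)) *
      (base_block n (merge L S (w, u)) * cond_prod n (L \<union> S - {0}) (merge L S (w, u))) \<partial>Pi\<^sub>M S (B n) \<partial>Pi\<^sub>M L (B n))"
    by (rule Bn.product_nn_integral_fold[OF T(3) _ T(4)]) (simp, measurable)
  also have "\<dots> \<le> (\<integral>\<^sup>+w. nnblock n L w * ennreal ?E \<partial>Pi\<^sub>M L (B n))"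
  proof (rule nn_integral_mono)
    fix w assume w: "w \<in> space (Pi\<^sub>M L (B n))"
    have dec: "L \<union> S - {0} = {Suc k} \<union> S" "{Suc k} \<inter> S = {}" using S by auto
    have e: "base_block n (merge L S (w, u)) * cond_prod n (L \<union> S - {0}) (merge L S (w, u)) =
      (base_block n w * cond_prod n {Suc k} w) * cond_prod n S (merge L S (w, u))" for u
    proof -
      have "base_block n (merge L S (w, u)) = base_block n w" by (rule base_block_cong) (simp add: merge_def)
      moreover have "cond_prod n {Suc k} (merge L S (w, u)) = cond_prod n {Suc k} w"
        by (rule cond_prod_cong) (auto simp: merge_def)
      ultimately show ?thesis
        unfolding dec(1) using cond_prod_union[OF _ T(4) dec(2)] by (simp add: mult.assoc)
    qed
    have "(\<integral>\<^sup>+u. indicator (typset n (L \<union> S)) (merge L S (w, u)) *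
      (base_block n (merge L S (w, u)) * cond_prod n (L \<union> S - {0}) (merge L S (w, u))) \<partial>Pi\<^sub>M S (B n)) =
      (\<integral>\<^sup>+u. (base_block n w * cond_prod n {Suc k} w) * (indicator (typset n (L \<union> S)) (merge L S (w, u)) * cond_prod n S (merge L S (w, u))) \<partial>Pi\<^sub>M S (B n))"
      unfolding e by (intro nn_integral_cong) (simp add: mult_ac)
    also have "\<dots> = (base_block n w * cond_prod n {Suc k} w) *
      (\<integral>\<^sup>+u. indicator (typset n (L \<union> S)) (merge L S (w, u)) * cond_prod n S (merge L S (w, u)) \<partial>Pi\<^sub>M S (B n))"
      by (intro nn_integral_cmult measurable_merge_section[OF w, where f = "\<lambda>x. indicator (typset n (L \<union> S)) x * cond_prod n S x"]) measurable
    also have "\<dots> \<le> nnblock n L w * ennreal ?E"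
      by (intro mult_mono base_block_cond_prod_le_G[OF w] section_upper_bound[OF T(3) _ T(1) w n]) auto
    finally show "(\<integral>\<^sup>+u. indicator (typset n (L \<union> S)) (merge L S (w, u)) *
      (base_block n (merge L S (w, u)) * cond_prod n (L \<union> S - {0}) (merge L S (w, u))) \<partial>Pi\<^sub>M S (B n)) \<le> nnblock n L w * ennreal ?E" .
  qed
  also have "\<dots> = (\<integral>\<^sup>+w. nnblock n L w \<partial>Pi\<^sub>M L (B n)) * ennreal ?E"
    by (rule nn_integral_multc[OF Gm])
  also have "\<dots> \<le> 1 * ennreal ?E" by (intro mult_right_mono nn_integral_G) simp
  finally show ?thesis by simp
qed

text \<open>A typical tuple has a typical restriction to \<open>L \<union> S\<close>, and this
  restriction depends only on the indices in \<open>S\<close>. The union bound therefore runs over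
  these indices alone and costs only the product of the M_j over \<open>S\<close>.\<close>

lemma converse_bound:
  assumes S: "S \<subseteq> {1..k}"
  shows "covering_prob P k M A U0 U Ul \<le>
    (\<Prod>j\<in>S. real (M j)) * exp (- (real n * (rate L S - 2 * (real (card S) + 1) * \<delta>)))"
    (is "_ \<le> _ * ?E")
proof (cases "CB = {}")
  case True
  then show ?thesis by (simp add: covering_prob_def prod_nonneg)
next
  case False
  then have M: "M j \<ge> 1" if "j \<in> {1..k}" for j
    using CB_range[OF _ that] by fastforce
  have T: "L \<union> S \<subseteq> J" "finite S" using S finite_subset by auto
  define I where "I = (\<Pi>\<^sub>E j\<in>S. {1..M j})"
  \<comment> \<open>Indices outside \<open>S\<close> are filled with 1, which is admissible because
    a nonempty codebook has every M_j at least 1.\<close>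
  define ext where "ext s = (\<lambda>j\<in>{1..k}. if j \<in> S then s j else 1 :: nat)" for s
  have finI: "finite I" unfolding I_def using T by (intro finite_PiE) auto
  have ext: "ext s \<in> CB" if "s \<in> I" for s
    unfolding codebook_indices_def ext_def
    by (rule restrict_PiE_iff[THEN iffD2]) (use that M S in \<open>auto simp: I_def PiE_iff\<close>)
  define D where "D s = {\<omega> \<in> space P. restrict (tup (ext s) \<omega>) (L \<union> S) \<in> typset n (L \<union> S)}" for s
  have Ds: "D s \<in> sets P" if "s \<in> I" for s
  proof -
    have rm: "(\<lambda>\<omega>. restrict (tup (ext s) \<omega>) (L \<union> S)) \<in> P \<rightarrow>\<^sub>M Pi\<^sub>M (L \<union> S) (B n)"
      by (rule measurable_compose[OF tup_measurable[OF ext[OF that]] measurable_restrict_subset[OF T(1)]])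
    show ?thesis unfolding D_def
      using measurable_sets[OF rm typset_sets[OF T(1)]] by (simp add: vimage_def Int_def conj_commute)
  qed
  have "{\<omega> \<in> space P. \<exists>m\<in>CB. tup m \<omega> \<in> A} \<subseteq> (\<Union>s\<in>I. D s)"
  proof
    fix \<omega> assume "\<omega> \<in> {\<omega> \<in> space P. \<exists>m\<in>CB. tup m \<omega> \<in> A}"
    then obtain m where \<omega>: "\<omega> \<in> space P" and m: "m \<in> CB" and A: "tup m \<omega> \<in> A" by auto
    have "restrict m S \<in> I" using CB_range[OF m] S by (auto simp: I_def)
    moreover have "restrict (tup (ext (restrict m S)) \<omega>) (L \<union> S) = restrict (tup m \<omega>) (L \<union> S)"
      using S by (auto simp: codeword_tuple_def ext_def fun_eq_iff)
    then have "\<omega> \<in> D (restrict m S)"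
      unfolding D_def using typset_restrict[OF A T(1)] \<omega> by simp
    ultimately show "\<omega> \<in> (\<Union>s\<in>I. D s)" by auto
  qed
  then have "covering_prob P k M A U0 U Ul \<le> prob (\<Union>s\<in>I. D s)"
    unfolding covering_prob_def using finI Ds by (intro finite_measure_mono sets.finite_UN) auto
  also have "\<dots> \<le> (\<Sum>s\<in>I. prob (D s))"
    using finI Ds by (intro finite_measure_subadditive_finite) auto
  also have "\<dots> \<le> (\<Sum>s\<in>I. ?E)"
  proof (rule sum_mono)
    fix s assume "s \<in> I"
    from subtuple_typical_bound[OF ext[OF this] S]
    have "ennreal (prob (D s)) \<le> ennreal ?E"
      unfolding D_def emeasure_eq_measure .
    then show "prob (D s) \<le> ?E" by (subst (asm) ennreal_le_iff) auto
  qed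
  also have "\<dots> = (\<Prod>j\<in>S. real (M j)) * ?E"
    using T by (simp add: I_def card_PiE)
  finally show ?thesis .
qed

end

section \<open>The covering lemma\<close>

lemma is_alphabet_sigma_finite:
  assumes "is_alphabet M"
  shows "sigma_finite_measure M"
proof -
  consider A where "countable A" "M = count_space (Inl ` A)"
    | d where "M = embed_measure (\<Pi>\<^sub>M i\<in>{..<d}. lborel) Inr"
    using assms by (auto simp: is_alphabet_def)
  then show ?thesis
  proof cases
    case 1
    then show ?thesis by (auto intro: sigma_finite_measure_count_space_countable)
  next
    case (2 d)
    interpret product_sigma_finite "\<lambda>_::nat. lborel :: real measure" ..
    have "sigma_finite_measure (\<Pi>\<^sub>M i\<in>{..<d}. lborel :: real measure)" by (rule sigma_finite) simp
    then show ?thesis unfolding 2 by (rule sigma_finite_embed_measure) simp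
  qed
qed

text \<open>The alphabets enter the argument through sigma-finiteness of their reference measures,
  so discrete and continuous coordinates are treated together.\<close>

lemma covering_sigma_finite:
  fixes k :: nat
    and \<mu> :: "nat \<Rightarrow> 'a symbol measure"
    and p :: "(nat \<Rightarrow> 'a symbol) \<Rightarrow> real"
    and \<delta> :: real
    and R :: "nat \<Rightarrow> real"
    and M :: "nat \<Rightarrow> nat \<Rightarrow> nat"
    and \<Omega> :: "nat \<Rightarrow> 'w measure"
    and U0 Ulast :: "nat \<Rightarrow> 'w \<Rightarrow> nat \<Rightarrow> 'a symbol"
    and U :: "nat \<Rightarrow> nat \<Rightarrow> nat \<Rightarrow> 'w \<Rightarrow> nat \<Rightarrow> 'a symbol"
  assumes sigma: "product_sigma_finite \<mu>"
    and p_measurable: "p \<in> borel_measurable (letters k \<mu>)"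
    and p_nonneg: "\<And>u. u \<in> space (letters k \<mu>) \<Longrightarrow> p u \<ge> 0"
    and p_prob: "prob_space (density (letters k \<mu>) p)"
    and finite_ent: "\<And>T. T \<noteq> {} \<Longrightarrow> T \<subseteq> {0..k+1} \<Longrightarrow>
          integrable (density (letters k \<mu>) p) (\<lambda>u. ln (marginal k \<mu> p T u))"
    and \<delta>: "\<delta> > 0"
    and prob: "\<And>n. n \<ge> 1 \<Longrightarrow> prob_space (\<Omega> n)"
    and U0: "\<And>n. n \<ge> 1 \<Longrightarrow> U0 n \<in> measurable (\<Omega> n) (block n \<mu> 0)"
    and U: "\<And>n j m. n \<ge> 1 \<Longrightarrow> j \<in> {1..k} \<Longrightarrow> m \<in> {1..M n j} \<Longrightarrow>
          U n j m \<in> measurable (\<Omega> n) (block n \<mu> j)"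
    and Ulast: "\<And>n. n \<ge> 1 \<Longrightarrow> Ulast n \<in> measurable (\<Omega> n) (block n \<mu> (k+1))"
    and I: "\<And>n m m' Sc. n \<ge> 1 \<Longrightarrow>
          m \<in> codebook_indices k (M n) \<Longrightarrow> m' \<in> codebook_indices k (M n) \<Longrightarrow>
          Sc = {1..k} - {j \<in> {1..k}. m j = m' j} \<Longrightarrow>
          has_cond_density (\<Omega> n)
            (block n \<mu> 0 \<Otimes>\<^sub>M block n \<mu> (k+1)) (\<lambda>\<omega>. (U0 n \<omega>, Ulast n \<omega>))
            ((\<Pi>\<^sub>M j\<in>{1..k}. block n \<mu> j) \<Otimes>\<^sub>M (\<Pi>\<^sub>M j\<in>Sc. block n \<mu> j))
            (\<lambda>\<omega>. (\<lambda>j\<in>{1..k}. U n j (m j) \<omega>, \<lambda>j\<in>Sc. U n j (m' j) \<omega>))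
            (\<lambda>(u0, ulast) (u, u').
               (\<Prod>j\<in>{1..k}. cond_block k \<mu> p n j (u j) u0) *
               (\<Prod>j\<in>Sc. cond_block k \<mu> p n j (u' j) u0))"
    and II: "\<And>n m. n \<ge> 1 \<Longrightarrow> m \<in> codebook_indices k (M n) \<Longrightarrow>
          prob_space.indep_vars (\<Omega> n) (\<lambda>i. letters k \<mu>)
            (\<lambda>i \<omega>. \<lambda>j\<in>{0..k+1}. codeword_tuple k (U0 n) (U n) (Ulast n) m \<omega> j i) {1..n} \<and>
          (\<forall>i\<in>{1..n}. distributed (\<Omega> n) (letters k \<mu>)
            (\<lambda>\<omega>. \<lambda>j\<in>{0..k+1}. codeword_tuple k (U0 n) (U n) (Ulast n) m \<omega> j i)
            (\<lambda>u. ennreal (cond_indep_density k \<mu> p u)))"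
  shows
    "((\<forall>n\<ge>1. \<forall>j\<in>{1..k}. real (M n j) \<ge> exp (real n * R j)) \<longrightarrow>
      (\<forall>S. S \<noteq> {} \<and> S \<subseteq> {1..k} \<longrightarrow>
          (\<Sum>j\<in>S. R j) >
            (\<Sum>j\<in>S. cond_ent k \<mu> p {j} {0}) - cond_ent k \<mu> p S {0, k+1}
              + (8 * real k - 2 * real (card S) + 10) * \<delta>) \<longrightarrow>
      (\<lambda>n. covering_prob (\<Omega> n) k (M n) (typical_set k \<mu> p \<delta> n) (U0 n) (U n) (Ulast n))
        \<longlonglongrightarrow> 1)
     \<and>
     ((\<forall>n\<ge>1. \<forall>j\<in>{1..k}. real (M n j) \<le> exp (real n * R j)) \<longrightarrow>
      (\<lambda>n. covering_prob (\<Omega> n) k (M n) (typical_set k \<mu> p \<delta> n) (U0 n) (U n) (Ulast n))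
        \<longlonglongrightarrow> 1 \<longrightarrow>
      (\<forall>S. S \<noteq> {} \<and> S \<subseteq> {1..k} \<longrightarrow>
          (\<Sum>j\<in>S. R j) \<ge>
            (\<Sum>j\<in>S. cond_ent k \<mu> p {j} {0}) - cond_ent k \<mu> p S {0, k+1}
              - 2 * (real (card S) + 1) * \<delta>))"
proof -
  interpret joint_density_ent \<mu> k p \<delta>
    by (intro joint_density_ent.intro joint_density.intro joint_density_axioms.intro
        joint_density_ent_axioms.intro sigma p_measurable p_nonneg p_prob finite_ent \<delta>)
  have cb: "codebook \<mu> k p \<delta> (\<Omega> n) n (M n) (U0 n) (Ulast n) (U n)" if n: "n \<ge> 1" for n
  proof -
    interpret prob_space "\<Omega> n" by (rule prob[OF n])
    show ?thesis
      by (intro codebook.intro codebook_axioms.intro joint_density_ent_axioms prob[OF n] n U0 U Ulast I II)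
  qed
  define cp where "cp n = covering_prob (\<Omega> n) k (M n) (typical_set k \<mu> p \<delta> n) (U0 n) (U n) (Ulast n)" for n
  have cp_le_1: "cp n \<le> 1" if "n \<ge> 1" for n
  proof -
    interpret prob_space "\<Omega> n" by (rule prob[OF that])
    show ?thesis by (simp add: cp_def covering_prob_def)
  qed
  have direct: "cp \<longlonglongrightarrow> 1"
    if Mge: "\<forall>n\<ge>1. \<forall>j\<in>{1..k}. real (M n j) \<ge> exp (real n * R j)"
      and rates: "\<forall>S. S \<noteq> {} \<and> S \<subseteq> {1..k} \<longrightarrow>
          (\<Sum>j\<in>S. R j) >
            (\<Sum>j\<in>S. cond_ent k \<mu> p {j} {0}) - cond_ent k \<mu> p S {0, k+1}
              + (8 * real k - 2 * real (card S) + 10) * \<delta>"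
  proof -
    \<comment> \<open>The decay exponent of the variance term belonging to agreement set
      \<open>S\<close> in \<open>direct_bound\<close>.\<close>
    define \<gamma> where "\<gamma> S = (\<Sum>j\<in>S. R j) + rate (J - ({1..k} - S)) ({1..k} - S)
      - 2 * (real (card ({1..k} - S)) + 1) * \<delta> - rate L {1..k} - 2 * (real k + 1) * \<delta>" for S
    have \<gamma>: "\<gamma> S > 0" if S: "S \<in> Pow {1..k} - {{}}" for S
    proof -
      have SK: "S \<subseteq> {1..k}" "S \<noteq> {}" "finite S" using S by (auto intro: finite_subset)
      have sets: "J - ({1..k} - S) = S \<union> L" "J - ({1..k} - S) \<union> ({1..k} - S) = J" using SK by auto
      have cs: "real (card S) \<le> real k" using card_mono[OF _ SK(1)] by simp
      have cd: "real (card ({1..k} - S)) = real k - real (card S)"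
        using SK cs by (simp add: card_Diff_subset of_nat_diff)
      have sm: "(\<Sum>j=1..k. cond_ent k \<mu> p {j} {0}) =
        (\<Sum>j\<in>{1..k} - S. cond_ent k \<mu> p {j} {0}) + (\<Sum>j\<in>S. cond_ent k \<mu> p {j} {0})"
        by (rule sum.subset_diff[OF SK(1)]) simp
      have ce: "cond_ent k \<mu> p S {0, k+1} = H (S \<union> L) - H L" by (simp add: cond_ent_def)
      \<comment> \<open>The terms H(J) and the conditional entropies outside \<open>S\<close>
        cancel, leaving H(U_S|U_0,U_{k+1}). The loss (4 k - 2 |S| + 4) \<delta> adds 2 (k - |S| + 1)
        \<delta> from the section bound and 2 (k + 1) \<delta> from the hitting probability.\<close>
      have "\<gamma> S = (\<Sum>j\<in>S. R j) - ((\<Sum>j\<in>S. cond_ent k \<mu> p {j} {0}) - cond_ent k \<mu> p S {0, k+1})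
        - (4 * real k - 2 * real (card S) + 4) * \<delta>"
        unfolding \<gamma>_def rate_def sets(2) L_Un(1) cd sm ce unfolding sets(1) by (simp add: algebra_simps)
      moreover have "(4 * real k - 2 * real (card S) + 4) * \<delta> \<le> (8 * real k - 2 * real (card S) + 10) * \<delta>"
        using \<delta> by (intro mult_right_mono) auto
      ultimately show ?thesis using rates[rule_format, of S] SK by simp
    qed
    define e where "e n = 2 * (\<integral>\<^sup>+u. nnblock n J u * indicator (- typset n J) u \<partial>Pi\<^sub>M J (B n)) +
      ennreal (\<Sum>S\<in>Pow {1..k} - {{}}. 2 * exp (- (real n * \<gamma> S)))" for n
    have "(\<lambda>n. \<Sum>S\<in>Pow {1..k} - {{}}. 2 * exp (- (real n * \<gamma> S))) \<longlonglongrightarrow> (\<Sum>S\<in>Pow {1..k} - {{}}. 0)"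
    proof (rule tendsto_sum)
      fix S assume "S \<in> Pow {1..k} - {{}}"
      from \<gamma>[OF this] show "(\<lambda>n. 2 * exp (- (real n * \<gamma> S))) \<longlonglongrightarrow> 0" by real_asymp
    qed
    then have "(\<lambda>n. ennreal (\<Sum>S\<in>Pow {1..k} - {{}}. 2 * exp (- (real n * \<gamma> S)))) \<longlonglongrightarrow> 0"
      using tendsto_ennrealI by fastforce
    moreover have "(\<lambda>n. 2 * (\<integral>\<^sup>+u. nnblock n J u * indicator (- typset n J) u \<partial>Pi\<^sub>M J (B n))) \<longlonglongrightarrow> 2 * 0"
      by (intro tendsto_mult_ennreal tendsto_const nn_integral_atypical_tendsto_0) auto
    ultimately have e0: "e \<longlonglongrightarrow> 0"
      unfolding e_def[abs_def] using tendsto_add by fastforce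
    have "\<forall>\<^sub>F n in sequentially. ennreal (1 - cp n) \<le> e n"
    \<comment> \<open>Nothing is assumed at block length 0, so the estimates start at 1.\<close>
    proof (rule eventually_sequentiallyI[of 1])
      fix n :: nat assume n: "1 \<le> n"
      show "ennreal (1 - cp n) \<le> e n"
        unfolding cp_def e_def \<gamma>_def typical_set_eq
        by (rule codebook.direct_bound[OF cb[OF n]]) (use Mge n in auto)
    qed
    then have "(\<lambda>n. ennreal (1 - cp n)) \<longlonglongrightarrow> 0"
      using tendsto_sandwich[OF _ _ tendsto_const e0] by simp
    then have "(\<lambda>n. 1 - cp n) \<longlonglongrightarrow> 0"
      by (intro tendsto_ennrealD) (use cp_le_1 in \<open>auto intro!: eventually_sequentiallyI[of 1]\<close>)
    from tendsto_diff[OF tendsto_const[of 1] this] show ?thesis by simp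
  qed
  have converse: "(\<Sum>j\<in>S. R j) \<ge>
            (\<Sum>j\<in>S. cond_ent k \<mu> p {j} {0}) - cond_ent k \<mu> p S {0, k+1}
              - 2 * (real (card S) + 1) * \<delta>"
    if Mle: "\<forall>n\<ge>1. \<forall>j\<in>{1..k}. real (M n j) \<le> exp (real n * R j)" and lim: "cp \<longlonglongrightarrow> 1"
      and S: "S \<noteq> {}" "S \<subseteq> {1..k}" for S
  proof (rule ccontr)
    assume less: "\<not> ?thesis"
    \<comment> \<open>If the inequality fails, this gap is positive and the covering probability
      decays like exp(- n d), which contradicts the limit 1.\<close>
    define d where "d = rate L S - 2 * (real (card S) + 1) * \<delta> - (\<Sum>j\<in>S. R j)"
    have fin: "finite S" using S finite_subset by auto
    have ce: "cond_ent k \<mu> p S {0, k+1} = H (L \<union> S) - H L" by (simp add: cond_ent_def Un_commute)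
    have d: "d > 0" using less unfolding d_def rate_def ce by simp
    have "cp n \<le> exp (- (real n * d))" if n: "n \<ge> 1" for n
    proof -
      have "cp n \<le> (\<Prod>j\<in>S. real (M n j)) * exp (- (real n * (rate L S - 2 * (real (card S) + 1) * \<delta>)))"
        unfolding cp_def typical_set_eq by (rule codebook.converse_bound[OF cb[OF n] S(2)])
      also have "\<dots> \<le> (\<Prod>j\<in>S. exp (real n * R j)) * exp (- (real n * (rate L S - 2 * (real (card S) + 1) * \<delta>)))"
        using Mle n S by (intro mult_right_mono prod_mono) auto
      also have "\<dots> = exp (- (real n * d))"
        using fin by (simp add: d_def exp_sum[symmetric] exp_add[symmetric] sum_distrib_left[symmetric] algebra_simps)
      finally show ?thesis .
    qed
    then have "\<forall>\<^sub>F n in sequentially. cp n \<le> exp (- (real n * d))"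
      by (auto intro: eventually_sequentiallyI[of 1])
    moreover have "(\<lambda>n. exp (- (real n * d))) \<longlonglongrightarrow> 0" using d by real_asymp
    ultimately have "(1::real) \<le> 0"
      using tendsto_le[OF sequentially_bot _ lim] by blast
    then show False by simp
  qed
  show ?thesis
    using direct converse unfolding cp_def[abs_def] by blast
qed

theorem theorem1:
  fixes k :: nat
    and \<mu> :: "nat \<Rightarrow> 'a symbol measure"
    and p :: "(nat \<Rightarrow> 'a symbol) \<Rightarrow> real"
    and \<delta> :: real
    and R :: "nat \<Rightarrow> real"
    and M :: "nat \<Rightarrow> nat \<Rightarrow> nat"
    and \<Omega> :: "nat \<Rightarrow> 'w measure"
    and U0 Ulast :: "nat \<Rightarrow> 'w \<Rightarrow> nat \<Rightarrow> 'a symbol"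
    and U :: "nat \<Rightarrow> nat \<Rightarrow> nat \<Rightarrow> 'w \<Rightarrow> nat \<Rightarrow> 'a symbol"
  assumes k: "k \<ge> 1"
    and alphabets: "\<And>j. j \<in> {0..k+1} \<Longrightarrow> is_alphabet (\<mu> j)"
    and p_measurable: "p \<in> borel_measurable (letters k \<mu>)"
    and p_nonneg: "\<And>u. u \<in> space (letters k \<mu>) \<Longrightarrow> p u \<ge> 0"
    and p_prob: "prob_space (density (letters k \<mu>) p)"
    and finite_ent: "\<And>T. T \<noteq> {} \<Longrightarrow> T \<subseteq> {0..k+1} \<Longrightarrow>
          integrable (density (letters k \<mu>) p) (\<lambda>u. ln (marginal k \<mu> p T u))"
    and \<delta>: "\<delta> > 0"
    and prob: "\<And>n. n \<ge> 1 \<Longrightarrow> prob_space (\<Omega> n)"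
    and U0: "\<And>n. n \<ge> 1 \<Longrightarrow> U0 n \<in> measurable (\<Omega> n) (block n \<mu> 0)"
    and U: "\<And>n j m. n \<ge> 1 \<Longrightarrow> j \<in> {1..k} \<Longrightarrow> m \<in> {1..M n j} \<Longrightarrow>
          U n j m \<in> measurable (\<Omega> n) (block n \<mu> j)"
    and Ulast: "\<And>n. n \<ge> 1 \<Longrightarrow> Ulast n \<in> measurable (\<Omega> n) (block n \<mu> (k+1))"
    and I: "\<And>n m m' Sc. n \<ge> 1 \<Longrightarrow>
          m \<in> codebook_indices k (M n) \<Longrightarrow> m' \<in> codebook_indices k (M n) \<Longrightarrow>
          Sc = {1..k} - {j \<in> {1..k}. m j = m' j} \<Longrightarrow>
          has_cond_density (\<Omega> n)
            (block n \<mu> 0 \<Otimes>\<^sub>M block n \<mu> (k+1)) (\<lambda>\<omega>. (U0 n \<omega>, Ulast n \<omega>))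
            ((\<Pi>\<^sub>M j\<in>{1..k}. block n \<mu> j) \<Otimes>\<^sub>M (\<Pi>\<^sub>M j\<in>Sc. block n \<mu> j))
            (\<lambda>\<omega>. (\<lambda>j\<in>{1..k}. U n j (m j) \<omega>, \<lambda>j\<in>Sc. U n j (m' j) \<omega>))
            (\<lambda>(u0, ulast) (u, u').
               (\<Prod>j\<in>{1..k}. cond_block k \<mu> p n j (u j) u0) *
               (\<Prod>j\<in>Sc. cond_block k \<mu> p n j (u' j) u0))"
    and II: "\<And>n m. n \<ge> 1 \<Longrightarrow> m \<in> codebook_indices k (M n) \<Longrightarrow>
          prob_space.indep_vars (\<Omega> n) (\<lambda>i. letters k \<mu>)
            (\<lambda>i \<omega>. \<lambda>j\<in>{0..k+1}. codeword_tuple k (U0 n) (U n) (Ulast n) m \<omega> j i) {1..n} \<and>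
          (\<forall>i\<in>{1..n}. distributed (\<Omega> n) (letters k \<mu>)
            (\<lambda>\<omega>. \<lambda>j\<in>{0..k+1}. codeword_tuple k (U0 n) (U n) (Ulast n) m \<omega> j i)
            (\<lambda>u. ennreal (cond_indep_density k \<mu> p u)))"
  shows
    "((\<forall>n\<ge>1. \<forall>j\<in>{1..k}. real (M n j) \<ge> exp (real n * R j)) \<longrightarrow>
      (\<forall>S. S \<noteq> {} \<and> S \<subseteq> {1..k} \<longrightarrow>
          (\<Sum>j\<in>S. R j) >
            (\<Sum>j\<in>S. cond_ent k \<mu> p {j} {0}) - cond_ent k \<mu> p S {0, k+1}
              + (8 * real k - 2 * real (card S) + 10) * \<delta>) \<longrightarrow>
      (\<lambda>n. covering_prob (\<Omega> n) k (M n) (typical_set k \<mu> p \<delta> n) (U0 n) (U n) (Ulast n))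
        \<longlonglongrightarrow> 1)
     \<and>
     ((\<forall>n\<ge>1. \<forall>j\<in>{1..k}. real (M n j) \<le> exp (real n * R j)) \<longrightarrow>
      (\<lambda>n. covering_prob (\<Omega> n) k (M n) (typical_set k \<mu> p \<delta> n) (U0 n) (U n) (Ulast n))
        \<longlonglongrightarrow> 1 \<longrightarrow>
      (\<forall>S. S \<noteq> {} \<and> S \<subseteq> {1..k} \<longrightarrow>
          (\<Sum>j\<in>S. R j) \<ge>
            (\<Sum>j\<in>S. cond_ent k \<mu> p {j} {0}) - cond_ent k \<mu> p S {0, k+1}
              - 2 * (real (card S) + 1) * \<delta>))"
proof -
  \<comment> \<open>\<open>\<mu> j\<close> is arbitrary for \<open>j > k + 1\<close>, but \<^const>\<open>product_sigma_finite\<close> speaks about all \<open>j\<close>.\<close>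
  define \<mu>' where "\<mu>' j = (if j \<in> {0..k+1} then \<mu> j else count_space {})" for j
  have sigma: "product_sigma_finite \<mu>'"
    unfolding product_sigma_finite_def \<mu>'_def
    using is_alphabet_sigma_finite[OF alphabets] by (auto intro: sigma_finite_measure_count_space_countable)
  have \<mu>': "\<mu>' j = \<mu> j" if "j \<in> {0..k+1}" for j using that by (simp add: \<mu>'_def)
  have PiM: "Pi\<^sub>M T \<mu>' = Pi\<^sub>M T \<mu>" if "T \<subseteq> {0..k+1}" for T
    by (rule PiM_cong) (use that \<mu>' in auto)
  \<comment> \<open>Every notion in the statement reads the family of measures only at coordinates
    up to k + 1, so it is the same for both families.\<close>
  have letters: "letters k \<mu>' = letters k \<mu>" by (simp add: letters_def PiM)
  have marginal: "marginal k \<mu>' = marginal k \<mu>"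
    by (intro ext) (simp only: marginal_def PiM[OF Diff_subset])
  have cond: "cond_marginal k \<mu>' = cond_marginal k \<mu>" by (simp add: cond_marginal_def[abs_def] marginal)
  have cblock: "cond_block k \<mu>' = cond_block k \<mu>" by (simp add: cond_block_def[abs_def] cond)
  have cid: "cond_indep_density k \<mu>' = cond_indep_density k \<mu>"
    by (simp add: cond_indep_density_def[abs_def] marginal cond)
  have ent: "ent k \<mu>' = ent k \<mu>" by (simp add: ent_def[abs_def] marginal letters)
  have cond_ent: "cond_ent k \<mu>' = cond_ent k \<mu>" by (simp add: cond_ent_def[abs_def] ent)
  have block: "block n \<mu>' j = block n \<mu> j" if "j \<in> {0..k+1}" for n j
    using \<mu>'[OF that] by (simp add: block_def)
  have blockM: "Pi\<^sub>M T (block n \<mu>') = Pi\<^sub>M T (block n \<mu>)" if "T \<subseteq> {0..k+1}" for T n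
    by (rule PiM_cong) (use that block in auto)
  have typical: "typical_set k \<mu>' = typical_set k \<mu>"
    by (simp add: typical_set_def[abs_def] blockM marginal ent)
  note eqs = letters marginal cond cblock cid ent cond_ent typical
  show ?thesis
  proof (rule covering_sigma_finite[where \<mu> = \<mu>' and k = k and p = p and \<delta> = \<delta> and \<Omega> = \<Omega> and
        ?U0.0 = U0 and M = M and U = U and Ulast = Ulast and R = R, unfolded eqs], goal_cases)
    case 1
    show ?case by (rule sigma)
  next
    case 2
    show ?case by (rule p_measurable)
  next
    case (3 u)
    then show ?case by (rule p_nonneg)
  next
    case 4
    show ?case by (rule p_prob)
  next
    case (5 T)
    then show ?case by (rule finite_ent)
  next
    case 6
    show ?case by (rule \<delta>)
  next
    case (7 n)
    then show ?case by (rule prob)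
  next
    case (8 n)
    then show ?case using U0[of n] block[of 0] by simp
  next
    case (9 n j m)
    then show ?case using U[of n j m] block[of j n] by simp
  next
    case (10 n)
    then show ?case using Ulast[of n] block[of "k+1"] by simp
  next
    case (11 n m m' Sc)
    have "{1..k} \<subseteq> {0..k+1}" "Sc \<subseteq> {0..k+1}" using 11(4) by auto
    moreover have "block n \<mu>' 0 = block n \<mu> 0" "block n \<mu>' (k+1) = block n \<mu> (k+1)"
      by (rule block; simp)+
    ultimately show ?case
      using I[OF 11] by (simp only: blockM)
  next
    case (12 n m)
    then show ?case by (rule II)
  qed
qed

end
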